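(* Let $n\geq 1$ and $\frac{n}{n+1}<p\leq 1$, and assume that $\Omega\subset\mathbf{R}^n$ is a domain. Then $$H^{1,p}(\Omega)=M^{1,p}_{ball}(\Omega)\quad\text{and}\quad\dot H^{1,p}(\Omega)=\dot M^{1,p}_{ball}(\Omega),$$ with equivalence of the (quasi)norms.
   Context: Write $d(x,\partial\Omega)$ for the distance from $x$ to $\partial\Omega$ (with $d(x,\partial\Omega)=\infty$ if $\Omega=\mathbf{R}^n$). Grand maximal function: for a ball $B=B(x,r)$ and an integer $N\geq1$ let $C^\infty_{0,N}(B)=\{\varphi\in C_0^\infty(B(x,r)): |\partial^\alpha\varphi|\leq r^{-n-|\alpha|}\text{ for }|\alpha|\leq N\}$. For a distribution $f$ defined on $B(x,r)$ put $$\mathcal{M}_{r,N}f(x)=\sup\{|\langle f,\varphi\rangle| : \varphi\in C^\infty_{0,N}(B(x,r')),\ 0<r'\leq r\}$$ (all $0<r'<\infty$ if $r=\infty$). Hardy space on $\Omega$: let $p\in(0,1]$ and fix an integer $N>\max(0,n(\frac1p-1))$. A distribution $f\in\mathcal{D}'(\Omega)$ belongs to $H^p(\Omega)$ iff $\|f\|_{H^p(\Omega)}:=\big\|\mathcal{M}_{d(x,\partial\Omega)/2,\,N}f(x)\big\|_{L^p(\Omega)}<\infty$ (the $L^p$-norm being taken in the variable $x\in\Omega$). Hardy-Sobolev spaces on $\Omega$ (for $p> n/(n+1)$): a locally integrable function $u:\Omega\to\mathbf{R}$ belongs to $\dot H^{1,p}(\Omega)$ iff its distributional derivatives satisfy $D_ju\in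 H^p(\Omega)$ for all $j=1,\dots,n$; the seminorm is $\|u\|_{\dot H^{1,p}(\Omega)}:=\sum_{j=1}^n\|D_ju\|_{H^p(\Omega)}$. Further $u\in H^{1,p}(\Omega)$ iff additionally $u\in L^p(\Omega)$, with $\|u\|_{H^{1,p}(\Omega)}:=\|u\|_{\dot H^{1,p}(\Omega)}+\|u\|_{L^p(\Omega)}$. The spaces $M_{ball}$: a measurable function $u$ on $\Omega$ belongs to $\dot M^{1,p}_{ball}(\Omega)$ iff there are $g\in L^p(\Omega)$ and a set $F\subset\Omega$ of measure zero such that $|u(x)-u(y)|\leq|x-y|(g(x)+g(y))$ for all $x,y\in\Omega\setminus F$ satisfying $|x-y|\leq\frac14\min(d(x,\partial\Omega),d(y,\partial\Omega))$; $\|u\|_{\dot M^{1,p}_{ball}(\Omega)}:=\inf\|g\|_{L^p(\Omega)}$ over all such $g$. Further $M^{1,p}_{ball}(\Omega)=\dot M^{1,p}_{ball}(\Omega)\cap L^p(\Omega)$ with $\|u\|_{M^{1,p}_{ball}(\Omega)}:=\|u\|_{\dot M^{1,p}_{ball}(\Omega)}+\|u\|_{L^p(\Omega)}$. *)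

theory Defs
  imports "HOL-Analysis.Analysis"
begin

section \<open>Smooth functions and distributions\<close>

definition partial_deriv :: "'n::finite \<Rightarrow> (real^'n \<Rightarrow> real) \<Rightarrow> real^'n \<Rightarrow> real" where
  "partial_deriv j f x = deriv (\<lambda>t. f (x + t *\<^sub>R axis j 1)) 0"

text \<open>
  Iterated partial derivatives are indexed by lists of coordinates. Mixed partial derivatives of
  smooth functions commute, so for smooth functions the lists of length \<open>k\<close> give exactly the
  derivatives indexed by the multi-indices of order \<open>k\<close>.
\<close>

definition partial_derivs :: "'n::finite list \<Rightarrow> (real^'n \<Rightarrow> real) \<Rightarrow> real^'n \<Rightarrow> real" where
  "partial_derivs js f = foldr partial_deriv js f"

definition smooth :: "(real^'n::finite \<Rightarrow> real) \<Rightarrow> bool" where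
  "smooth f \<longleftrightarrow> (\<forall>js. partial_derivs js f differentiable_on UNIV)"

text \<open>Test functions on \<open>\<Omega>\<close> are regarded as functions on the whole space, extended by 0.\<close>

definition support :: "(real^'n::finite \<Rightarrow> real) \<Rightarrow> (real^'n) set" where
  "support \<phi> = closure {x. \<phi> x \<noteq> 0}"

definition test_functions :: "(real^'n::finite) set \<Rightarrow> (real^'n \<Rightarrow> real) set" where
  "test_functions \<Omega> = {\<phi>. smooth \<phi> \<and> compact (support \<phi>) \<and> support \<phi> \<subseteq> \<Omega>}"

text \<open>Only the values of a functional at the test functions on \<open>\<Omega>\<close> are relevant.\<close>

definition distribution :: "(real^'n::finite) set \<Rightarrow> ((real^'n \<Rightarrow> real) \<Rightarrow> real) \<Rightarrow> bool" where
  "distribution \<Omega> T \<longleftrightarrow>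
     (\<forall>\<phi>\<in>test_functions \<Omega>. \<forall>\<psi>\<in>test_functions \<Omega>. T (\<lambda>x. \<phi> x + \<psi> x) = T \<phi> + T \<psi>) \<and>
     (\<forall>c. \<forall>\<phi>\<in>test_functions \<Omega>. T (\<lambda>x. c * \<phi> x) = c * T \<phi>) \<and>
     (\<forall>K. compact K \<and> K \<subseteq> \<Omega> \<longrightarrow>
        (\<exists>C m. \<forall>\<phi>\<in>test_functions \<Omega>. support \<phi> \<subseteq> K \<longrightarrow>
           \<bar>T \<phi>\<bar> \<le> C * (\<Sum>js | length js \<le> m. SUP x. \<bar>partial_derivs js \<phi> x\<bar>)))"

definition function_distr ::
    "(real^'n::finite) set \<Rightarrow> (real^'n \<Rightarrow> real) \<Rightarrow> (real^'n \<Rightarrow> real) \<Rightarrow> real" where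
  "function_distr \<Omega> u \<phi> = (\<integral>x. u x * \<phi> x \<partial>lebesgue_on \<Omega>)"

definition distr_deriv ::
    "'n::finite \<Rightarrow> ((real^'n \<Rightarrow> real) \<Rightarrow> real) \<Rightarrow> (real^'n \<Rightarrow> real) \<Rightarrow> real" where
  "distr_deriv j T \<phi> = - T (partial_deriv j \<phi>)"


section \<open>Lebesgue spaces\<close>

definition ennreal_powr :: "ennreal \<Rightarrow> real \<Rightarrow> ennreal" where
  "ennreal_powr a p = (if a = \<infinity> then \<infinity> else ennreal (enn2real a powr p))"

text \<open>The exponent \<open>p\<close> is positive throughout.\<close>

definition Lp_norm :: "real \<Rightarrow> (real^'n::finite) set \<Rightarrow> (real^'n \<Rightarrow> ennreal) \<Rightarrow> ennreal" where
  "Lp_norm p \<Omega> f = ennreal_powr (\<integral>\<^sup>+x. ennreal_powr (f x) p \<partial>lebesgue_on \<Omega>) (1 / p)"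

abbreviation Lp_norm_real :: "real \<Rightarrow> (real^'n::finite) set \<Rightarrow> (real^'n \<Rightarrow> real) \<Rightarrow> ennreal" where
  "Lp_norm_real p \<Omega> g \<equiv> Lp_norm p \<Omega> (\<lambda>x. ennreal \<bar>g x\<bar>)"

definition Lp_space :: "real \<Rightarrow> (real^'n::finite) set \<Rightarrow> (real^'n \<Rightarrow> real) set" where
  "Lp_space p \<Omega> = {g \<in> borel_measurable (lebesgue_on \<Omega>). Lp_norm_real p \<Omega> g < \<infinity>}"

definition locally_integrable :: "(real^'n::finite) set \<Rightarrow> (real^'n \<Rightarrow> real) \<Rightarrow> bool" where
  "locally_integrable \<Omega> u \<longleftrightarrow> (\<forall>K. compact K \<and> K \<subseteq> \<Omega> \<longrightarrow> u absolutely_integrable_on K)"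


section \<open>Hardy and Hardy--Sobolev spaces\<close>

text \<open>The infimum over an empty boundary is \<open>\<infinity>\<close>.\<close>

definition bdist :: "(real^'n::finite) set \<Rightarrow> real^'n \<Rightarrow> ennreal" where
  "bdist \<Omega> x = (INF y\<in>frontier \<Omega>. ennreal (dist x y))"

definition normalized_test_functions ::
    "nat \<Rightarrow> real^'n::finite \<Rightarrow> real \<Rightarrow> (real^'n \<Rightarrow> real) set" where
  "normalized_test_functions N x r =
     {\<phi> \<in> test_functions (ball x r).
        \<forall>js. length js \<le> N \<longrightarrow> (\<forall>y. \<bar>partial_derivs js \<phi> y\<bar> \<le> 1 / r ^ (CARD('n) + length js))}"

definition grand_maximal ::
    "ennreal \<Rightarrow> nat \<Rightarrow> ((real^'n::finite \<Rightarrow> real) \<Rightarrow> real) \<Rightarrow> real^'n \<Rightarrow> ennreal" where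
  "grand_maximal R N T x =
     (SUP \<phi> \<in> (\<Union>r\<in>{r. 0 < r \<and> ennreal r \<le> R}. normalized_test_functions N x r). ennreal \<bar>T \<phi>\<bar>)"

definition hardy_norm ::
    "real \<Rightarrow> nat \<Rightarrow> (real^'n::finite) set \<Rightarrow> ((real^'n \<Rightarrow> real) \<Rightarrow> real) \<Rightarrow> ennreal" where
  "hardy_norm p N \<Omega> T = Lp_norm p \<Omega> (\<lambda>x. grand_maximal (bdist \<Omega> x / 2) N T x)"

definition hardy_space ::
    "real \<Rightarrow> nat \<Rightarrow> (real^'n::finite) set \<Rightarrow> ((real^'n \<Rightarrow> real) \<Rightarrow> real) set" where
  "hardy_space p N \<Omega> = {T. distribution \<Omega> T \<and> hardy_norm p N \<Omega> T < \<infinity>}"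

definition hom_hardy_sobolev_norm ::
    "real \<Rightarrow> nat \<Rightarrow> (real^'n::finite) set \<Rightarrow> (real^'n \<Rightarrow> real) \<Rightarrow> ennreal" where
  "hom_hardy_sobolev_norm p N \<Omega> u =
     (\<Sum>j\<in>UNIV. hardy_norm p N \<Omega> (distr_deriv j (function_distr \<Omega> u)))"

definition hom_hardy_sobolev ::
    "real \<Rightarrow> nat \<Rightarrow> (real^'n::finite) set \<Rightarrow> (real^'n \<Rightarrow> real) set" where
  "hom_hardy_sobolev p N \<Omega> =
     {u. locally_integrable \<Omega> u \<and>
         (\<forall>j. distr_deriv j (function_distr \<Omega> u) \<in> hardy_space p N \<Omega>)}"

definition hardy_sobolev_norm ::
    "real \<Rightarrow> nat \<Rightarrow> (real^'n::finite) set \<Rightarrow> (real^'n \<Rightarrow> real) \<Rightarrow> ennreal" where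
  "hardy_sobolev_norm p N \<Omega> u = hom_hardy_sobolev_norm p N \<Omega> u + Lp_norm_real p \<Omega> u"

definition hardy_sobolev ::
    "real \<Rightarrow> nat \<Rightarrow> (real^'n::finite) set \<Rightarrow> (real^'n \<Rightarrow> real) set" where
  "hardy_sobolev p N \<Omega> = hom_hardy_sobolev p N \<Omega> \<inter> Lp_space p \<Omega>"


section \<open>Spaces defined by pointwise estimates on balls\<close>

definition ball_gradients ::
    "real \<Rightarrow> (real^'n::finite) set \<Rightarrow> (real^'n \<Rightarrow> real) \<Rightarrow> (real^'n \<Rightarrow> real) set" where
  "ball_gradients p \<Omega> u =
     {g \<in> Lp_space p \<Omega>. \<exists>F\<subseteq>\<Omega>. F \<in> null_sets lebesgue \<and>
        (\<forall>x\<in>\<Omega> - F. \<forall>y\<in>\<Omega> - F. ennreal (dist x y) \<le> min (bdist \<Omega> x) (bdist \<Omega> y) / 4 \<longrightarrow>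
           \<bar>u x - u y\<bar> \<le> dist x y * (g x + g y))}"

definition hom_M_ball :: "real \<Rightarrow> (real^'n::finite) set \<Rightarrow> (real^'n \<Rightarrow> real) set" where
  "hom_M_ball p \<Omega> = {u \<in> borel_measurable (lebesgue_on \<Omega>). ball_gradients p \<Omega> u \<noteq> {}}"

definition hom_M_ball_norm :: "real \<Rightarrow> (real^'n::finite) set \<Rightarrow> (real^'n \<Rightarrow> real) \<Rightarrow> ennreal" where
  "hom_M_ball_norm p \<Omega> u = (INF g\<in>ball_gradients p \<Omega> u. Lp_norm_real p \<Omega> g)"

definition M_ball :: "real \<Rightarrow> (real^'n::finite) set \<Rightarrow> (real^'n \<Rightarrow> real) set" where
  "M_ball p \<Omega> = hom_M_ball p \<Omega> \<inter> Lp_space p \<Omega>"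

definition M_ball_norm :: "real \<Rightarrow> (real^'n::finite) set \<Rightarrow> (real^'n \<Rightarrow> real) \<Rightarrow> ennreal" where
  "M_ball_norm p \<Omega> u = hom_M_ball_norm p \<Omega> u + Lp_norm_real p \<Omega> u"


section \<open>Equivalence of quasinorms\<close>

definition equivalent_norms_on ::
    "'a set \<Rightarrow> ('a \<Rightarrow> ennreal) \<Rightarrow> ('a \<Rightarrow> ennreal) \<Rightarrow> bool" where
  "equivalent_norms_on X \<nu> \<mu> \<longleftrightarrow>
     (\<exists>C::real. C > 0 \<and> (\<forall>u\<in>X. \<nu> u \<le> ennreal C * \<mu> u \<and> \<mu> u \<le> ennreal C * \<nu> u))"

end

theory Submission
  imports Defs
begin

text \<open>
  Write \<open>n\<close> for the dimension and \<open>s = n / (n + 1)\<close>, so that \<open>p / s > 1\<close>.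

  From a pointwise gradient \<open>g\<close> to Hardy spaces: on a ball of radius \<open>r\<close> inside \<open>\<Omega>\<close>, chaining through
  the sublevel sets \<open>{g \<le> 2 ^ k * \<mu>}\<close>, where \<open>\<mu> ^ s\<close> is a large multiple of the average of \<open>g ^ s\<close>, gives a
  constant \<open>c\<close> such that the average of \<open>\<bar>u - c\<bar>\<close> is at most a multiple of \<open>r * \<mu>\<close>. Testing \<open>u - c\<close> against
  derivatives of normalized test functions bounds the grand maximal functions of the derivatives of
  \<open>u\<close> by \<open>M(g ^ s) ^ (1 / s)\<close>, with \<open>M\<close> the Hardy--Littlewood maximal operator, which is bounded on
  \<open>L ^ (p / s)\<close>.

  Conversely, let \<open>G\<close> be the sum of the grand maximal functions of the derivatives of \<open>u\<close>, and let \<open>\<psi>\<^sub>t\<close> be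
  a standard mollifier. Since the derivative of \<open>\<psi>\<^sub>t\<close> in \<open>t\<close> is the divergence of a multiple of
  \<open>(w\<^sub>j * \<psi>)\<^sub>t\<close>, the mollification of \<open>u\<close> at \<open>x\<close> is Lipschitz in \<open>t\<close> with constant a multiple of \<open>G x\<close>,
  and similarly in the direction of \<open>y - x\<close>. Letting \<open>t\<close> tend to 0 at Lebesgue points of \<open>u\<close> shows that a
  multiple of \<open>G\<close> is a pointwise gradient of \<open>u\<close>.
\<close>

section \<open>Smooth functions\<close>

text \<open>The exponent \<open>s = n / (n + 1)\<close> is forced by the chaining. By Chebyshev's
  inequality for \<open>g ^ s\<close>, a point with \<open>g \<le> 2 ^ k * \<mu>\<close> can only be
  guaranteed within about \<open>2 ^ (- k * s / n)\<close> times the radius, so descending from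
  level \<open>k + 1\<close> to level \<open>k\<close> changes \<open>u\<close> by a multiple of
  \<open>2 ^ (k * (1 - s / n))\<close>. For this to be controlled by \<open>g ^ s\<close>, the only
  power whose integral is at hand, it must be at most of order \<open>2 ^ (k * s)\<close>, and
  \<open>n / (n + 1)\<close> is the smallest such \<open>s\<close>. The same estimate yields the
  local integrability of \<open>u\<close>, which membership in \<open>M_ball\<close> does not
  contain by definition and which must precede any talk of distributional derivatives. In the
  converse direction the maximal functions are evaluated at \<open>x\<close> and \<open>y\<close>
  only, although kernels centred between them occur. Such a kernel of scale
  \<open>r = dist x y\<close> is a test function on \<open>ball x (2 * r)\<close> with constants
  worse by a bounded factor, and the constant 1/4 in the definition of \<open>M_ball\<close> makes
  \<open>2 * r\<close> an admissible radius. All constants are uniform in \<Omega>.\<close>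

lemma partial_derivs_simps [simp]:
  "partial_derivs [] f = f"
  "partial_derivs (j # js) f = partial_deriv j (partial_derivs js f)"
  by (auto simp: partial_derivs_def)

lemma partial_derivs_append: "partial_derivs (is @ js) f = partial_derivs is (partial_derivs js f)"
  by (simp add: partial_derivs_def)

lemma partial_deriv_eq:
  fixes f :: "real^'n::finite \<Rightarrow> real"
  assumes "(f has_derivative D) (at x)"
  shows "partial_deriv j f x = D (axis j 1)"
proof -
  have lin: "linear D"
    using assms has_derivative_linear by blast
  have "((\<lambda>t. f (x + t *\<^sub>R axis j 1)) has_derivative (\<lambda>t. D (t *\<^sub>R axis j 1))) (at 0)"
    by (rule has_derivative_compose[where g = f and f = "\<lambda>t. x + t *\<^sub>R axis j 1"])
      (auto intro!: derivative_eq_intros simp: assms)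
  then have "((\<lambda>t. f (x + t *\<^sub>R axis j 1)) has_field_derivative D (axis j 1)) (at 0)"
    unfolding has_field_derivative_def
    by (simp add: linear_scale[OF lin] mult_commute_abs)
  then show ?thesis
    unfolding partial_deriv_def by (rule DERIV_imp_deriv)
qed

lemma has_derivative_partial_deriv:
  fixes f :: "real^'n::finite \<Rightarrow> real"
  assumes "f differentiable (at x)"
  shows "(f has_derivative (\<lambda>v. \<Sum>j\<in>UNIV. v $ j * partial_deriv j f x)) (at x)"
proof -
  obtain D where D: "(f has_derivative D) (at x)"
    using assms unfolding differentiable_def by blast
  have lin: "linear D"
    using D has_derivative_linear by blast
  have "D v = (\<Sum>j\<in>UNIV. v $ j * partial_deriv j f x)" for v
  proof -
    have "D v = D (\<Sum>j\<in>UNIV. v $ j *\<^sub>R axis j 1)"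
      using basis_expansion[of v] by (simp add: scalar_mult_eq_scaleR)
    also have "\<dots> = (\<Sum>j\<in>UNIV. v $ j *\<^sub>R D (axis j 1))"
      by (simp add: linear_sum[OF lin] linear_scale[OF lin])
    finally show ?thesis
      by (simp add: partial_deriv_eq[OF D])
  qed
  then have "D = (\<lambda>v. \<Sum>j\<in>UNIV. v $ j * partial_deriv j f x)"
    by auto
  with D show ?thesis
    by simp
qed

lemma partial_deriv_add:
  fixes f g :: "real^'n::finite \<Rightarrow> real"
  assumes "f differentiable (at x)" "g differentiable (at x)"
  shows "partial_deriv j (\<lambda>x. f x + g x) x = partial_deriv j f x + partial_deriv j g x"
proof -
  obtain D E where "(f has_derivative D) (at x)" "(g has_derivative E) (at x)"
    using assms unfolding differentiable_def by blast
  from partial_deriv_eq[OF this(1)] partial_deriv_eq[OF this(2)]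
    partial_deriv_eq[OF has_derivative_add[OF this]]
  show ?thesis by simp
qed

lemma partial_deriv_mult:
  fixes f g :: "real^'n::finite \<Rightarrow> real"
  assumes "f differentiable (at x)" "g differentiable (at x)"
  shows "partial_deriv j (\<lambda>x. f x * g x) x = f x * partial_deriv j g x + partial_deriv j f x * g x"
proof -
  obtain D E where "(f has_derivative D) (at x)" "(g has_derivative E) (at x)"
    using assms unfolding differentiable_def by blast
  from partial_deriv_eq[OF this(1)] partial_deriv_eq[OF this(2)]
    partial_deriv_eq[OF has_derivative_mult[OF this]]
  show ?thesis by simp
qed

lemma smooth_partial_deriv: "smooth f \<Longrightarrow> smooth (partial_deriv j f)"
  unfolding smooth_def
proof
  fix js assume "\<forall>js. partial_derivs js f differentiable_on UNIV"
  then have "partial_derivs (js @ [j]) f differentiable_on UNIV"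
    by blast
  then show "partial_derivs js (partial_deriv j f) differentiable_on UNIV"
    by (simp add: partial_derivs_append)
qed

lemma smooth_partial_derivs: "smooth f \<Longrightarrow> smooth (partial_derivs js f)"
  by (induction js) (auto intro: smooth_partial_deriv)

lemma smooth_imp_differentiable: "smooth f \<Longrightarrow> f differentiable (at x)"
  unfolding smooth_def differentiable_on_def
  by (auto dest!: spec[of _ "[]"])

lemma smooth_imp_continuous: "smooth f \<Longrightarrow> continuous_on A f"
  by (meson continuous_at_imp_continuous_on differentiable_imp_continuous_within
      smooth_imp_differentiable)

text \<open>Coinductive form of smoothness: iterated derivatives need not be computed, since
  induction on \<open>js\<close> keeps all of them in \<open>S\<close>.\<close>

lemma smooth_coinduct:
  assumes "f \<in> S"
    and "\<And>f x. f \<in> S \<Longrightarrow> f differentiable (at x)"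
    and "\<And>f j. f \<in> S \<Longrightarrow> partial_deriv j f \<in> S"
  shows "smooth f"
proof -
  have "partial_derivs js f \<in> S" for js
    by (induction js) (auto simp: assms)
  then show ?thesis
    unfolding smooth_def differentiable_on_def
    using assms(2) differentiable_at_withinI by blast
qed

text \<open>Derivatives of a bump function are products of functions of the same kind with
  polynomials in the coordinates. Closing the generators under sums and products gives a class that
  is stable under differentiation; constants enter as smooth generators.\<close>

inductive generated_algebra ::
    "((real^'n::finite \<Rightarrow> real) \<Rightarrow> bool) \<Rightarrow> (real^'n \<Rightarrow> real) \<Rightarrow> bool" for P where
  generator: "P f \<Longrightarrow> generated_algebra P f"
| add: "generated_algebra P f \<Longrightarrow> generated_algebra P g \<Longrightarrow> generated_algebra P (\<lambda>x. f x + g x)"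
| mult: "generated_algebra P f \<Longrightarrow> generated_algebra P g \<Longrightarrow> generated_algebra P (\<lambda>x. f x * g x)"

text \<open>By the sum and product rules, the whole algebra is closed under partial derivatives as
  soon as the derivatives of the generators lie in it.\<close>

lemma smooth_generated_algebra:
  assumes gen: "generated_algebra P f"
    and diff: "\<And>f x. P f \<Longrightarrow> f differentiable (at x)"
    and deriv: "\<And>f j. P f \<Longrightarrow> generated_algebra P (partial_deriv j f)"
  shows "smooth f"
proof (rule smooth_coinduct)
  show "f \<in> Collect (generated_algebra P)"
    using gen by simp
  have diff': "f differentiable (at x)" if "generated_algebra P f" for f x
    using that by induction (auto intro: diff)
  then show "f differentiable (at x)" if "f \<in> Collect (generated_algebra P)" for f x
    using that by simp
  have "generated_algebra P (partial_deriv j f)" if "generated_algebra P f" for f j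
    using that
  proof induction
    case (add f g)
    then have "partial_deriv j (\<lambda>x. f x + g x) = (\<lambda>x. partial_deriv j f x + partial_deriv j g x)"
      by (intro ext partial_deriv_add diff')
    then show ?case
      using add.IH by (auto intro: generated_algebra.add)
  next
    case (mult f g)
    then have "partial_deriv j (\<lambda>x. f x * g x) =
        (\<lambda>x. f x * partial_deriv j g x + partial_deriv j f x * g x)"
      by (intro ext partial_deriv_mult diff')
    then show ?case
      using mult by (auto intro!: generated_algebra.add generated_algebra.mult)
  qed (rule deriv)
  then show "partial_deriv j f \<in> Collect (generated_algebra P)"
    if "f \<in> Collect (generated_algebra P)" for f j
    using that by simp
qed

lemma generated_algebra_smooth: "generated_algebra smooth f \<Longrightarrow> smooth f"
  by (rule smooth_generated_algebra[where P = smooth])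
    (auto intro: smooth_imp_differentiable smooth_partial_deriv generator)

lemma smooth_add: "smooth f \<Longrightarrow> smooth g \<Longrightarrow> smooth (\<lambda>x. f x + g x)"
  by (rule generated_algebra_smooth[OF generated_algebra.add]) (auto intro: generator)

lemma smooth_mult: "smooth f \<Longrightarrow> smooth g \<Longrightarrow> smooth (\<lambda>x. f x * g x)"
  by (rule generated_algebra_smooth[OF generated_algebra.mult]) (auto intro: generator)

lemma partial_deriv_const [simp]: "partial_deriv j (\<lambda>x. c) = (\<lambda>x. 0)"
  by (rule ext) (simp add: partial_deriv_def)

lemma smooth_const: "smooth (\<lambda>x. c)"
  by (rule smooth_coinduct[where S = "range (\<lambda>c x. c)"]) auto

lemma partial_deriv_nth: "partial_deriv j (\<lambda>x. x $ k) = (\<lambda>x. axis j 1 $ k)"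
  by (intro ext partial_deriv_eq) (auto intro!: bounded_linear_imp_has_derivative bounded_linear_vec_nth)

lemma smooth_nth: "smooth (\<lambda>x :: real^'n::finite. x $ k)"
proof (rule smooth_coinduct[where S = "insert (\<lambda>x. x $ k) (range (\<lambda>c x. c))"])
  fix f :: "real^'n \<Rightarrow> real" and x
  assume "f \<in> insert (\<lambda>x. x $ k) (range (\<lambda>c x. c))"
  then show "f differentiable (at x)"
    using bounded_linear_imp_differentiable[OF bounded_linear_vec_nth[of k]] by auto
qed (auto simp: partial_deriv_nth)

lemma partial_deriv_cmult:
  assumes "f differentiable (at x)"
  shows "partial_deriv j (\<lambda>x. c * f x) x = c * partial_deriv j f x"
  using partial_deriv_mult[of "\<lambda>x. c" x f j] assms by simp

lemma smooth_cmult: "smooth f \<Longrightarrow> smooth (\<lambda>x. c * f x)"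
  by (rule smooth_mult[OF smooth_const])

lemma partial_derivs_cmult:
  assumes "smooth f"
  shows "partial_derivs js (\<lambda>x. c * f x) = (\<lambda>x. c * partial_derivs js f x)"
  by (induction js)
    (use assms in \<open>auto intro!: ext partial_deriv_cmult smooth_imp_differentiable smooth_partial_derivs\<close>)

lemma differentiable_affine:
  fixes f :: "real^'n::finite \<Rightarrow> real"
  assumes "\<And>x. f differentiable (at x)"
  shows "(\<lambda>y. f (c *\<^sub>R (y - z))) differentiable (at x)"
  using differentiable_chain_at[of "\<lambda>y. c *\<^sub>R (y - z)" x f] assms by (simp add: o_def)

lemma partial_deriv_affine:
  fixes f :: "real^'n::finite \<Rightarrow> real"
  assumes "\<And>x. f differentiable (at x)"
  shows "partial_deriv j (\<lambda>y. f (c *\<^sub>R (y - z))) = (\<lambda>y. c * partial_deriv j f (c *\<^sub>R (y - z)))"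
proof
  fix y
  obtain D where D: "(f has_derivative D) (at (c *\<^sub>R (y - z)))"
    using assms unfolding differentiable_def by blast
  then have "((\<lambda>y. f (c *\<^sub>R (y - z))) has_derivative (\<lambda>v. D (c *\<^sub>R v))) (at y)"
    by (intro has_derivative_compose[where g = f and f = "\<lambda>y. c *\<^sub>R (y - z)"])
      (auto intro!: derivative_eq_intros)
  then show "partial_deriv j (\<lambda>y. f (c *\<^sub>R (y - z))) y = c * partial_deriv j f (c *\<^sub>R (y - z))"
    using partial_deriv_eq[OF D] linear_scale[OF has_derivative_linear[OF D]]
    by (simp add: partial_deriv_eq)
qed

lemma partial_derivs_affine:
  assumes "smooth f"
  shows "partial_derivs js (\<lambda>y. f (c *\<^sub>R (y - z))) =
    (\<lambda>y. c ^ length js * partial_derivs js f (c *\<^sub>R (y - z)))"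
proof (induction js)
  case (Cons j js)
  have diff: "partial_derivs js f differentiable (at x)" for x
    by (intro smooth_imp_differentiable smooth_partial_derivs assms)
  show ?case
    by (auto simp: Cons partial_deriv_cmult partial_deriv_affine diff differentiable_affine fun_eq_iff)
qed auto

lemma smooth_affine:
  assumes "smooth f"
  shows "smooth (\<lambda>y. f (c *\<^sub>R (y - z)))"
  unfolding smooth_def
proof
  fix js
  have "(\<lambda>y. partial_derivs js f (c *\<^sub>R (y - z))) differentiable (at x)" for x
    by (intro differentiable_affine smooth_imp_differentiable smooth_partial_derivs assms)
  then show "partial_derivs js (\<lambda>y. f (c *\<^sub>R (y - z))) differentiable_on UNIV"
    unfolding partial_derivs_affine[OF assms] differentiable_on_def
    by (auto intro!: differentiable_at_withinI)
qed


section \<open>A bump function\<close>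

text \<open>All derivatives of the standard flat function \<open>exp (- (1 / t))\<close>, extended
  by 0, have this form. The polynomial parameter makes the family closed under differentiation;
  \<open>P = 1\<close> is the flat function itself.\<close>

definition flat_exp :: "real poly \<Rightarrow> real \<Rightarrow> real" where
  "flat_exp P t = (if t > 0 then poly P (1 / t) * exp (- (1 / t)) else 0)"

lemma flat_exp_tendsto_0: "(flat_exp P \<longlongrightarrow> 0) (at 0)"
proof -
  have *: "((\<lambda>x. poly P x * exp (- x)) \<longlongrightarrow> 0) at_top"
  proof -
    have "((\<lambda>x. \<Sum>i\<le>degree P. coeff P i * (x ^ i / exp x)) \<longlongrightarrow> (\<Sum>i\<le>degree P. coeff P i * 0)) at_top"
      by (intro tendsto_intros tendsto_power_div_exp_0)
    moreover have "(\<Sum>i\<le>degree P. coeff P i * (x ^ i / exp x)) = poly P x * exp (- x)" for x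
      by (simp add: poly_altdef sum_distrib_left exp_minus divide_inverse mult_ac)
    ultimately show ?thesis
      by simp
  qed
  have "((\<lambda>t. poly P (inverse t) * exp (- inverse t)) \<longlongrightarrow> 0) (at_right (0::real))"
    by (rule filterlim_compose[OF *]) (rule filterlim_inverse_at_top_right)
  then have "(flat_exp P \<longlongrightarrow> 0) (at_right 0)"
    by (rule Lim_transform_eventually)
      (auto simp: flat_exp_def divide_inverse eventually_at_filter)
  moreover have "(flat_exp P \<longlongrightarrow> 0) (at_left 0)"
    by (rule Lim_transform_eventually[OF tendsto_const])
      (auto simp: flat_exp_def eventually_at_filter)
  ultimately show ?thesis
    by (simp add: filterlim_at_split)
qed

text \<open>For \<open>t > 0\<close> the derivative of \<open>P(1/t) * exp (- 1/t)\<close> is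
  \<open>t ^ (-2) * (P - P')(1/t) * exp (- 1/t)\<close>, and \<open>[:0, 0, 1:]\<close> is the
  square of the indeterminate, which supplies \<open>t ^ (-2)\<close>.\<close>

lemma DERIV_flat_exp:
  "(flat_exp P has_real_derivative flat_exp ([:0, 0, 1:] * (P - pderiv P)) t) (at t)"
proof (cases t "0 :: real" rule: linorder_cases)
  case less
  show ?thesis
    by (rule has_field_derivative_transform_within[where d = "-t" and f = "\<lambda>t. 0"])
      (use less in \<open>auto simp: flat_exp_def dist_real_def\<close>)
next
  case equal
  \<comment> \<open>The difference quotient at 0 belongs to the family again: dividing by
    \<open>h\<close> multiplies \<open>P\<close> by the indeterminate, which is
    \<open>pCons 0 P\<close>.\<close>
  have "((\<lambda>h. flat_exp (pCons 0 P) h) \<longlongrightarrow> 0) (at 0)"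
    by (rule flat_exp_tendsto_0)
  then have "((\<lambda>h. (flat_exp P h - flat_exp P 0) / (h - 0)) \<longlongrightarrow> 0) (at 0)"
    by (rule Lim_transform_eventually) (auto simp: flat_exp_def eventually_at_filter)
  then show ?thesis
    unfolding equal has_field_derivative_iff by (simp add: flat_exp_def)
next
  case greater
  have "((\<lambda>t. poly P (1 / t) * exp (- (1 / t))) has_real_derivative
      flat_exp ([:0, 0, 1:] * (P - pderiv P)) t) (at t)"
    using greater
    by (auto intro!: derivative_eq_intros DERIV_chain2[OF poly_DERIV]
        simp: flat_exp_def field_simps power2_eq_square)
  then show ?thesis
    by (rule has_field_derivative_transform_within[where d = t])
      (use greater in \<open>auto simp: flat_exp_def dist_real_def\<close>)
qed

lemma exists_bump_function:
  obtains \<psi> :: "real^'n::finite \<Rightarrow> real"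
  where "smooth \<psi>" "\<And>x. \<psi> x \<ge> 0" "\<psi> 0 > 0" "\<And>x. norm x > 1 / 2 \<Longrightarrow> \<psi> x = 0"
proof
  \<comment> \<open>The argument of \<open>flat_exp\<close> is positive exactly on the open ball of
    radius 1/2, so the support stays at a positive distance from the unit sphere.\<close>
  define bump :: "real poly \<Rightarrow> real^'n \<Rightarrow> real" where
    "bump P x = flat_exp P (1 / 4 - x \<bullet> x)" for P x
  \<comment> \<open>Admitting all smooth functions as generators covers the factor
    \<open>- 2 * x $ j\<close> that the chain rule produces.\<close>
  define G where "G f \<longleftrightarrow> smooth f \<or> (\<exists>P. f = bump P)" for f
  have der: "(bump P has_derivative
      (\<lambda>v. flat_exp ([:0, 0, 1:] * (P - pderiv P)) (1 / 4 - x \<bullet> x) * (- 2 * (x \<bullet> v)))) (at x)"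
    for P x
    unfolding bump_def
    by (rule has_derivative_compose[where g = "flat_exp P" and f = "\<lambda>x. 1 / 4 - x \<bullet> x",
          OF _ DERIV_flat_exp[unfolded has_field_derivative_def], THEN has_derivative_eq_rhs])
      (auto intro!: derivative_eq_intros simp: inner_commute)
  have "generated_algebra G (partial_deriv j (bump P))" for P j
  proof -
    have "partial_deriv j (bump P) =
        (\<lambda>x. bump ([:0, 0, 1:] * (P - pderiv P)) x * (- 2 * x $ j))"
      by (intro ext partial_deriv_eq[OF der, THEN trans]) (auto simp: bump_def inner_axis)
    moreover have "generated_algebra G (\<lambda>x. bump ([:0, 0, 1:] * (P - pderiv P)) x * (- 2 * x $ j))"
      by (intro generated_algebra.mult generator) (use smooth_cmult[OF smooth_nth, of "-2"] in \<open>auto simp: G_def\<close>)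
    ultimately show ?thesis
      by simp
  qed
  then have "generated_algebra G (partial_deriv j f)" if "G f" for f j
    using that smooth_partial_deriv[of f j] generator[of G "partial_deriv j f"] by (auto simp: G_def)
  moreover have "f differentiable (at x)" if "G f" for f x
    using that differentiableI[OF der] smooth_imp_differentiable by (auto simp: G_def)
  moreover have "generated_algebra G (bump 1)"
    by (rule generator) (auto simp: G_def)
  ultimately show "smooth (bump 1)"
    by (blast intro: smooth_generated_algebra)
  show "bump 1 x \<ge> 0" for x
    by (simp add: bump_def flat_exp_def)
  show "bump 1 0 > 0"
    by (simp add: bump_def flat_exp_def)
  show "bump 1 x = 0" if "norm x > 1 / 2" for x
  proof -
    have "(1 / 2)\<^sup>2 < (norm x)\<^sup>2"
      using that by (intro power_strict_mono) auto
    then show ?thesis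
      by (simp add: bump_def flat_exp_def power2_norm_eq_inner power_divide)
  qed
qed


section \<open>Test functions and rescaling\<close>

lemma zero_outside_support: "x \<notin> support f \<Longrightarrow> f x = 0"
  using closure_subset[of "{x. f x \<noteq> 0}"] by (auto simp: support_def)

lemma closed_support: "closed (support f)"
  by (simp add: support_def)

lemma support_subsetI: "closed A \<Longrightarrow> (\<And>x. x \<notin> A \<Longrightarrow> f x = 0) \<Longrightarrow> support f \<subseteq> A"
  unfolding support_def by (rule closure_minimal) auto

lemma partial_deriv_outside_support:
  assumes "x \<notin> support f"
  shows "partial_deriv j f x = 0"
proof -
  have "(f has_derivative (\<lambda>v. 0)) (at x)"
  proof (rule has_derivative_transform_within_open[where s = "- support f"])
    show "((\<lambda>x. 0) has_derivative (\<lambda>v. 0)) (at x)"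
      by simp
    show "open (- support f)"
      by (simp add: closed_support open_Compl)
  qed (use assms zero_outside_support[of _ f] in auto)
  then show ?thesis
    by (rule partial_deriv_eq)
qed

lemma test_functions_subset:
  assumes "f \<in> test_functions A" "smooth g" "\<And>x. x \<notin> support f \<Longrightarrow> g x = 0"
  shows "g \<in> test_functions A"
proof -
  have "support g \<subseteq> support f"
    by (rule support_subsetI[OF closed_support assms(3)])
  then show ?thesis
    using assms(1,2) compact_Int_closed[OF _ closed_support, of "support f" g]
    by (auto simp: test_functions_def Int_absorb1)
qed

lemma test_functions_mono: "A \<subseteq> B \<Longrightarrow> test_functions A \<subseteq> test_functions B"
  by (auto simp: test_functions_def)

lemma test_functions_partial_deriv:
  "f \<in> test_functions A \<Longrightarrow> partial_deriv j f \<in> test_functions A"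
  by (rule test_functions_subset)
    (auto simp: test_functions_def smooth_partial_deriv partial_deriv_outside_support)

lemma test_functions_partial_derivs:
  "f \<in> test_functions A \<Longrightarrow> partial_derivs js f \<in> test_functions A"
  by (induction js) (auto intro: test_functions_partial_deriv)

lemma test_functions_mult_smooth:
  "f \<in> test_functions A \<Longrightarrow> smooth g \<Longrightarrow> (\<lambda>x. g x * f x) \<in> test_functions A"
  by (rule test_functions_subset) (auto simp: test_functions_def smooth_mult zero_outside_support[of _ f])

lemma test_functions_cmult: "f \<in> test_functions A \<Longrightarrow> (\<lambda>x. c * f x) \<in> test_functions A"
  by (rule test_functions_mult_smooth[OF _ smooth_const])

lemma bounded_continuous_compact_support:
  fixes f :: "real^'n::finite \<Rightarrow> real"
  assumes "continuous_on UNIV f" "compact (support f)"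
  shows "bounded (range f)"
proof -
  have "bounded (insert 0 (f ` support f))"
    using assms by (meson bounded_insert compact_continuous_image compact_imp_bounded
        continuous_on_subset subset_UNIV)
  moreover have "range f \<subseteq> insert 0 (f ` support f)"
    using zero_outside_support[of _ f] by blast
  ultimately show ?thesis
    by (rule bounded_subset)
qed

lemma test_functions_bounded: "f \<in> test_functions A \<Longrightarrow> bounded (range f)"
  by (rule bounded_continuous_compact_support)
    (auto simp: test_functions_def smooth_imp_continuous)

lemma test_functions_partial_derivs_bound:
  fixes f :: "real^'n::finite \<Rightarrow> real"
  assumes "f \<in> test_functions A"
  obtains K where "K > 0" "\<And>js y. length js \<le> N \<Longrightarrow> \<bar>partial_derivs js f y\<bar> \<le> K"
proof -
  have "\<exists>K. \<forall>y. \<bar>partial_derivs js f y\<bar> \<le> K" for js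
    using test_functions_bounded[OF test_functions_partial_derivs[OF assms, of js]]
    by (auto simp: bounded_iff)
  then obtain K where K: "\<And>js y. \<bar>partial_derivs js f y\<bar> \<le> K js"
    by metis
  have fin: "finite {js :: 'n list. length js \<le> N}"
    using finite_lists_length_le[of "UNIV :: 'n set" N] by simp
  have nonneg: "K js \<ge> 0" for js
    using K[of js 0] by linarith
  show thesis
  proof
    \<comment> \<open>The sum dominates each of the finitely many bounds; the summand 1 makes the
      result positive, so that it can be divided by.\<close>
    show "1 + (\<Sum>js | length js \<le> N. K js) > 0"
      using nonneg by (simp add: add_pos_nonneg sum_nonneg)
    fix js :: "'n list" and y assume "length js \<le> N"
    then have "K js \<le> (\<Sum>js | length js \<le> N. K js)"
      using nonneg fin by (intro member_le_sum) auto
    with K[of js y] show "\<bar>partial_derivs js f y\<bar> \<le> 1 + (\<Sum>js | length js \<le> N. K js)"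
      by linarith
  qed
qed

text \<open>The mass-preserving dilation with centre \<open>z\<close>. Derivatives of order k pick
  up exactly \<open>t ^ (- n - k)\<close>, the weight in
  \<open>normalized_test_functions\<close>.\<close>

definition rescale ::
    "real^'n::finite \<Rightarrow> real \<Rightarrow> (real^'n \<Rightarrow> real) \<Rightarrow> real^'n \<Rightarrow> real" where
  "rescale z t \<eta> = (\<lambda>y. 1 / t ^ CARD('n) * \<eta> ((1 / t) *\<^sub>R (y - z)))"

lemma partial_derivs_rescale:
  fixes \<eta> :: "real^'n::finite \<Rightarrow> real"
  assumes "smooth \<eta>"
  shows "partial_derivs js (rescale z t \<eta>) y =
    partial_derivs js \<eta> ((1 / t) *\<^sub>R (y - z)) / t ^ (CARD('n) + length js)"
  unfolding rescale_def partial_derivs_cmult[OF smooth_affine[OF assms]] partial_derivs_affine[OF assms]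
  by (simp add: power_add power_divide)

lemma smooth_rescale: "smooth \<eta> \<Longrightarrow> smooth (rescale z t \<eta>)"
  unfolding rescale_def by (intro smooth_cmult smooth_affine)

lemma rescale_eq_0:
  assumes "support \<eta> \<subseteq> ball 0 1" "t > 0" "y \<notin> ball z t"
  shows "rescale z t \<eta> y = 0"
proof -
  have "(1 / t) *\<^sub>R (y - z) \<notin> ball 0 1"
    using assms(2,3) by (simp add: dist_norm norm_minus_commute)
  then have "\<eta> ((1 / t) *\<^sub>R (y - z)) = 0"
    using assms(1) by (intro zero_outside_support[of _ \<eta>]) auto
  then show ?thesis
    by (simp add: rescale_def)
qed

lemma test_functions_rescale:
  assumes \<eta>: "\<eta> \<in> test_functions (ball 0 1)" and t: "t > 0"
  shows "rescale z t \<eta> \<in> test_functions (ball z t)"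
proof -
  let ?S = "(\<lambda>w. z + t *\<^sub>R w) ` support \<eta>"
  have S: "compact ?S"
    using \<eta> by (intro compact_continuous_image) (auto simp: test_functions_def intro!: continuous_intros)
  have sub: "support (rescale z t \<eta>) \<subseteq> ?S"
  proof (rule support_subsetI[OF compact_imp_closed[OF S]])
    fix y assume y: "y \<notin> ?S"
    have "(1 / t) *\<^sub>R (y - z) \<notin> support \<eta>"
    proof
      assume "(1 / t) *\<^sub>R (y - z) \<in> support \<eta>"
      then have "z + t *\<^sub>R ((1 / t) *\<^sub>R (y - z)) \<in> ?S"
        by (rule imageI)
      with y t show False
        by simp
    qed
    then have "\<eta> ((1 / t) *\<^sub>R (y - z)) = 0"
      by (rule zero_outside_support)
    then show "rescale z t \<eta> y = 0"
      by (simp add: rescale_def)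
  qed
  moreover have "?S \<subseteq> ball z t"
  proof safe
    fix w assume "w \<in> support \<eta>"
    then have "norm w < 1"
      using \<eta> by (auto simp: test_functions_def)
    then show "z + t *\<^sub>R w \<in> ball z t"
      using t by (simp add: dist_norm)
  qed
  moreover have "compact (support (rescale z t \<eta>))"
    using compact_Int_closed[OF S closed_support, of "rescale z t \<eta>"] by (simp add: Int_absorb1[OF sub])
  moreover have "smooth (rescale z t \<eta>)"
    using \<eta> by (auto simp: test_functions_def intro: smooth_rescale)
  ultimately show ?thesis
    using sub by (simp add: test_functions_def)
qed

text \<open>Comparability \<open>R \<le> 2 * t\<close> makes \<open>K\<close> uniform: passing from
  derivative bounds at scale \<open>t\<close> to those at scale \<open>R\<close> costs at most
  \<open>2 ^ (n + N)\<close>. The centre \<open>z\<close> may differ from \<open>x\<close>, so that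
  kernels can be moved while the maximal function is evaluated at a fixed point.\<close>

lemma rescale_grand_maximal_bound:
  fixes \<eta> :: "real^'n::finite \<Rightarrow> real"
  assumes \<eta>: "\<eta> \<in> test_functions (ball 0 1)"
  obtains K where "K > 0"
    "\<And>T x z t R \<rho>. (\<And>c \<phi>. \<phi> \<in> test_functions (ball x R) \<Longrightarrow> T (\<lambda>y. c * \<phi> y) = c * T \<phi>) \<Longrightarrow>
      0 < t \<Longrightarrow> R \<le> 2 * t \<Longrightarrow> dist x z + t \<le> R \<Longrightarrow> ennreal R \<le> \<rho> \<Longrightarrow>
      ennreal \<bar>T (rescale z t \<eta>)\<bar> \<le> ennreal K * grand_maximal \<rho> N T x"
proof -
  obtain K0 where K0: "K0 > 0" "\<And>js y. length js \<le> N \<Longrightarrow> \<bar>partial_derivs js \<eta> y\<bar> \<le> K0"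
    using test_functions_partial_derivs_bound[OF \<eta>] by blast
  define K where "K = K0 * 2 ^ (CARD('n) + N)"
  have K: "K > 0"
    using K0 by (simp add: K_def)
  have smooth: "smooth \<eta>"
    using \<eta> by (simp add: test_functions_def)
  show thesis
  proof
    show "K > 0" by fact
    fix T :: "(real^'n \<Rightarrow> real) \<Rightarrow> real" and x z :: "real^'n" and t R :: real and \<rho> :: ennreal
    assume hom: "\<And>c \<phi>. \<phi> \<in> test_functions (ball x R) \<Longrightarrow> T (\<lambda>y. c * \<phi> y) = c * T \<phi>"
      and t: "0 < t" and R: "R \<le> 2 * t" "dist x z + t \<le> R" and \<rho>: "ennreal R \<le> \<rho>"
    have "0 < R"
      using t R(2) zero_le_dist[of x z] by linarith
    have "ball z t \<subseteq> ball x R"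
      using R(2) by (simp add: ball_subset_ball_iff dist_commute)
    then have test: "rescale z t \<eta> \<in> test_functions (ball x R)"
      using test_functions_rescale[OF \<eta> t] test_functions_mono by blast
    let ?\<phi> = "\<lambda>y. (1 / K) * rescale z t \<eta> y"
    have "\<bar>partial_derivs js ?\<phi> y\<bar> \<le> 1 / R ^ (CARD('n) + length js)" if js: "length js \<le> N" for js y
    proof -
      have "\<bar>partial_derivs js ?\<phi> y\<bar> =
          (1 / K) * \<bar>partial_derivs js \<eta> ((1 / t) *\<^sub>R (y - z))\<bar> / t ^ (CARD('n) + length js)"
        unfolding partial_derivs_cmult[OF smooth_rescale[OF smooth]] partial_derivs_rescale[OF smooth]
        using K t by (simp add: abs_mult)
      also have "\<dots> \<le> (1 / K) * K0 / t ^ (CARD('n) + length js)"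
        using K0(2)[OF js] K t by (intro divide_right_mono mult_left_mono) auto
      also have "\<dots> = 1 / (2 ^ (CARD('n) + N) * t ^ (CARD('n) + length js))"
        using K0(1) by (simp add: K_def)
      also have "\<dots> \<le> 1 / (2 ^ (CARD('n) + length js) * t ^ (CARD('n) + length js))"
        using js t by (intro divide_left_mono mult_right_mono power_increasing) auto
      also have "\<dots> \<le> 1 / R ^ (CARD('n) + length js)"
        using power_mono[OF R(1), of "CARD('n) + length js"] t \<open>0 < R\<close>
        by (intro divide_left_mono) (auto simp: power_mult_distrib)
      finally show ?thesis .
    qed
    then have "?\<phi> \<in> normalized_test_functions N x R"
      using test_functions_cmult[OF test, of "1 / K"] by (simp add: normalized_test_functions_def)
    then have "ennreal \<bar>T ?\<phi>\<bar> \<le> grand_maximal \<rho> N T x"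
      unfolding grand_maximal_def using \<rho> \<open>0 < R\<close> by (intro SUP_upper) blast
    then have "ennreal K * ennreal \<bar>T ?\<phi>\<bar> \<le> ennreal K * grand_maximal \<rho> N T x"
      by (rule mult_left_mono) simp
    moreover have "T (rescale z t \<eta>) = K * T ?\<phi>"
      using hom[OF test, of "1 / K"] K by simp
    ultimately show "ennreal \<bar>T (rescale z t \<eta>)\<bar> \<le> ennreal K * grand_maximal \<rho> N T x"
      using K by (simp add: abs_mult ennreal_mult)
  qed
qed

text \<open>With \<open>w = (y - x) / t\<close> the derivative is \<open>- t ^ (- n - 1) * (n *
  \<psi> w + w \<bullet> \<nabla>\<psi> w)\<close>, and the bracket is the divergence of
  \<open>w * \<psi> w\<close>. Differentiating the rescaled field in \<open>y\<close> supplies the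
  remaining factor \<open>1 / t\<close>, so no further power of \<open>t\<close> is left
  over.\<close>

lemma rescale_has_real_derivative_scale:
  fixes \<psi> :: "real^'n::finite \<Rightarrow> real"
  assumes \<psi>: "smooth \<psi>" and t: "t > 0"
  shows "((\<lambda>t. rescale x t \<psi> y) has_real_derivative
    - (\<Sum>j\<in>UNIV. partial_deriv j (rescale x t (\<lambda>w. w $ j * \<psi> w)) y)) (at t)"
proof -
  define w where "w = (1 / t) *\<^sub>R (y - x)"
  have diff: "\<psi> differentiable (at x)" for x
    by (rule smooth_imp_differentiable[OF \<psi>])
  have "((\<lambda>t. \<psi> ((1 / t) *\<^sub>R (y - x))) has_derivative
      (\<lambda>h. \<Sum>j\<in>UNIV. ((- h / t\<^sup>2) *\<^sub>R (y - x)) $ j * partial_deriv j \<psi> w)) (at t)"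
    by (rule has_derivative_compose[where f = "\<lambda>t. (1 / t) *\<^sub>R (y - x)" and g = \<psi>])
      (use t in \<open>auto intro!: derivative_eq_intros has_derivative_partial_deriv diff
         simp: w_def power2_eq_square\<close>)
  moreover have "(\<lambda>h. \<Sum>j\<in>UNIV. ((- h / t\<^sup>2) *\<^sub>R (y - x)) $ j * partial_deriv j \<psi> w) =
      (*) (- (1 / t) * (\<Sum>j\<in>UNIV. w $ j * partial_deriv j \<psi> w))"
    by (simp add: fun_eq_iff w_def sum_distrib_left sum_distrib_right sum_negf mult_ac power2_eq_square)
  ultimately have 1: "((\<lambda>t. \<psi> ((1 / t) *\<^sub>R (y - x))) has_real_derivative
      - (1 / t) * (\<Sum>j\<in>UNIV. w $ j * partial_deriv j \<psi> w)) (at t)"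
    unfolding has_field_derivative_def by simp
  have 2: "((\<lambda>t. 1 / t ^ CARD('n)) has_real_derivative - real CARD('n) / t ^ (CARD('n) + 1)) (at t)"
  proof -
    obtain m where m: "CARD('n) = Suc m"
      using gr0_conv_Suc zero_less_card_finite by blast
    have "((\<lambda>t. 1 / t ^ Suc m) has_real_derivative
        (0 * t ^ Suc m - 1 * (real (Suc m) * t ^ m)) / (t ^ Suc m * t ^ Suc m)) (at t)"
      using DERIV_divide[OF DERIV_const DERIV_pow[of "Suc m" t], of 1] t by simp
    moreover have "(0 * t ^ Suc m - 1 * (real (Suc m) * t ^ m)) / (t ^ Suc m * t ^ Suc m) =
        - real (Suc m) / t ^ (Suc m + 1)"
      using t by (simp add: divide_simps)
    ultimately show ?thesis
      unfolding m by simp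
  qed
  have "partial_deriv j (rescale x t (\<lambda>w. w $ j * \<psi> w)) y =
      (w $ j * partial_deriv j \<psi> w + \<psi> w) / t ^ (CARD('n) + 1)" for j
  proof -
    have "partial_deriv j (\<lambda>w. w $ j * \<psi> w) w = w $ j * partial_deriv j \<psi> w + \<psi> w"
      using partial_deriv_mult[OF smooth_imp_differentiable[OF smooth_nth] diff]
      by (simp add: partial_deriv_nth)
    then show ?thesis
      using partial_derivs_rescale[OF smooth_mult[OF smooth_nth[of j] \<psi>], of "[j]" x t y]
      by (simp add: w_def)
  qed
  then have "(\<Sum>j\<in>UNIV. partial_deriv j (rescale x t (\<lambda>w. w $ j * \<psi> w)) y) =
      ((\<Sum>j\<in>UNIV. w $ j * partial_deriv j \<psi> w) + CARD('n) * \<psi> w) / t ^ (CARD('n) + 1)"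
    by (simp add: sum.distrib flip: sum_divide_distrib)
  then have "- (\<Sum>j\<in>UNIV. partial_deriv j (rescale x t (\<lambda>w. w $ j * \<psi> w)) y) =
      1 / t ^ CARD('n) * (- (1 / t) * (\<Sum>j\<in>UNIV. w $ j * partial_deriv j \<psi> w)) +
      - real CARD('n) / t ^ (CARD('n) + 1) * \<psi> w"
    using t by (simp add: field_simps)
  then show ?thesis
    unfolding rescale_def
    using DERIV_mult[OF 2 1] by (simp add: w_def rescale_def mult_ac add_ac)
qed

text \<open>The kernel depends only on \<open>y\<close> minus its centre, so moving the centre along
  \<open>b\<close> is minus the directional derivative in \<open>y\<close>.\<close>

lemma rescale_has_real_derivative_translate:
  fixes \<psi> :: "real^'n::finite \<Rightarrow> real"
  assumes \<psi>: "smooth \<psi>" and t: "t > 0"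
  shows "((\<lambda>s. rescale (a + s *\<^sub>R b) t \<psi> y) has_real_derivative
    - (\<Sum>j\<in>UNIV. b $ j * partial_deriv j (rescale (a + s *\<^sub>R b) t \<psi>) y)) (at s)"
proof -
  define w where "w = (1 / t) *\<^sub>R (y - (a + s *\<^sub>R b))"
  have diff: "\<psi> differentiable (at x)" for x
    by (rule smooth_imp_differentiable[OF \<psi>])
  have "((\<lambda>s. \<psi> ((1 / t) *\<^sub>R (y - (a + s *\<^sub>R b)))) has_derivative
      (\<lambda>h. \<Sum>j\<in>UNIV. ((- h / t) *\<^sub>R b) $ j * partial_deriv j \<psi> w)) (at s)"
    by (rule has_derivative_compose[where f = "\<lambda>s. (1 / t) *\<^sub>R (y - (a + s *\<^sub>R b))" and g = \<psi>])
      (use t in \<open>auto intro!: derivative_eq_intros has_derivative_partial_deriv diff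
         simp: w_def\<close>)
  moreover have "(\<lambda>h. \<Sum>j\<in>UNIV. ((- h / t) *\<^sub>R b) $ j * partial_deriv j \<psi> w) =
      (*) (- (1 / t) * (\<Sum>j\<in>UNIV. b $ j * partial_deriv j \<psi> w))"
    by (simp add: fun_eq_iff sum_distrib_left sum_distrib_right sum_negf mult_ac)
  ultimately have 1: "((\<lambda>s. \<psi> ((1 / t) *\<^sub>R (y - (a + s *\<^sub>R b)))) has_real_derivative
      - (1 / t) * (\<Sum>j\<in>UNIV. b $ j * partial_deriv j \<psi> w)) (at s)"
    unfolding has_field_derivative_def by simp
  have "partial_deriv j (rescale (a + s *\<^sub>R b) t \<psi>) y = partial_deriv j \<psi> w / t ^ (CARD('n) + 1)" for j
    using partial_derivs_rescale[OF \<psi>, of "[j]" "a + s *\<^sub>R b" t y] by (simp add: w_def)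
  then have "- (\<Sum>j\<in>UNIV. b $ j * partial_deriv j (rescale (a + s *\<^sub>R b) t \<psi>) y) =
      1 / t ^ CARD('n) * (- (1 / t) * (\<Sum>j\<in>UNIV. b $ j * partial_deriv j \<psi> w))"
    by (simp add: sum_divide_distrib sum_distrib_left sum_negf mult_ac)
  then show ?thesis
    using DERIV_cmult[OF 1, of "1 / t ^ CARD('n)"] by (simp add: rescale_def)
qed

lemma rescale_partial_deriv_bound:
  fixes \<eta> :: "real^'n::finite \<Rightarrow> real"
  assumes "smooth \<eta>" "\<And>y. \<bar>partial_deriv j \<eta> y\<bar> \<le> K" "0 < r" "r \<le> t"
  shows "\<bar>partial_deriv j (rescale z t \<eta>) y\<bar> \<le> K / r ^ (CARD('n) + 1)"
proof -
  have "K \<ge> 0"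
    using assms(2)[of 0] by linarith
  have "\<bar>partial_deriv j (rescale z t \<eta>) y\<bar> = \<bar>partial_deriv j \<eta> ((1 / t) *\<^sub>R (y - z))\<bar> / t ^ (CARD('n) + 1)"
    using partial_derivs_rescale[OF assms(1), of "[j]" z t y] assms(3,4) by simp
  also have "\<dots> \<le> K / t ^ (CARD('n) + 1)"
    using assms by (intro divide_right_mono) auto
  also have "\<dots> \<le> K / r ^ (CARD('n) + 1)"
    using assms \<open>K \<ge> 0\<close> by (intro divide_left_mono power_mono) auto
  finally show ?thesis .
qed

text \<open>By the mean value inequality the difference quotients inherit the bound \<open>w\<close>
  of the derivative, so dominated convergence applies along every sequence tending to
  \<open>s0\<close>.\<close>

lemma has_real_derivative_integral_dominated:
  fixes f f' :: "real \<Rightarrow> 'a \<Rightarrow> real"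
  assumes d: "d > 0"
    and int: "\<And>s. s \<in> ball s0 d \<Longrightarrow> integrable M (f s)"
    and deriv: "\<And>s y. s \<in> ball s0 d \<Longrightarrow> ((\<lambda>s. f s y) has_real_derivative f' s y) (at s)"
    and bound: "\<And>s y. s \<in> ball s0 d \<Longrightarrow> \<bar>f' s y\<bar> \<le> w y"
    and w: "integrable M w"
    and meas: "f' s0 \<in> borel_measurable M"
  shows "((\<lambda>s. \<integral>y. f s y \<partial>M) has_real_derivative (\<integral>y. f' s0 y \<partial>M)) (at s0)"
proof -
  have "((\<lambda>s. ((\<integral>y. f s y \<partial>M) - (\<integral>y. f s0 y \<partial>M)) / (s - s0)) \<longlongrightarrow> (\<integral>y. f' s0 y \<partial>M))
      (at s0 within ball s0 d)"
    unfolding tendsto_at_iff_sequentially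
  proof (intro allI impI)
    fix X :: "nat \<Rightarrow> real" assume X: "\<forall>i. X i \<in> ball s0 d - {s0}" and lim: "X \<longlonglongrightarrow> s0"
    let ?q = "\<lambda>i y. (f (X i) y - f s0 y) / (X i - s0)"
    have s0: "s0 \<in> ball s0 d"
      using d by simp
    have int_q: "integrable M (?q i)" for i
      using X int s0 by auto
    have "(\<lambda>i. \<integral>y. ?q i y \<partial>M) \<longlonglongrightarrow> (\<integral>y. f' s0 y \<partial>M)"
    proof (rule integral_dominated_convergence[where w = w])
      show "AE y in M. (\<lambda>i. ?q i y) \<longlonglongrightarrow> f' s0 y"
      proof (rule AE_I2)
        fix y
        have "((\<lambda>s. (f s y - f s0 y) / (s - s0)) \<longlongrightarrow> f' s0 y) (at s0)"
          using deriv[OF s0] unfolding has_field_derivative_iff by blast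
        then show "(\<lambda>i. ?q i y) \<longlonglongrightarrow> f' s0 y"
          by (rule filterlim_compose) (use X lim in \<open>auto simp: filterlim_at\<close>)
      qed
      show "AE y in M. norm (?q i y) \<le> w y" for i
      proof (rule AE_I2)
        fix y
        have "norm (f (X i) y - f s0 y) \<le> w y * norm (X i - s0)"
          by (rule field_differentiable_bound[where S = "ball s0 d" and f' = "\<lambda>s. f' s y"])
            (use X deriv bound s0 in \<open>auto intro: has_field_derivative_at_within\<close>)
        then show "norm (?q i y) \<le> w y"
          using X by (simp add: pos_divide_le_eq)
      qed
    qed (use meas w int_q in auto)
    moreover have "(\<integral>y. ?q i y \<partial>M) = ((\<integral>y. f (X i) y \<partial>M) - (\<integral>y. f s0 y \<partial>M)) / (X i - s0)" for i
      using X int s0 by simp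
    ultimately show "((\<lambda>s. ((\<integral>y. f s y \<partial>M) - (\<integral>y. f s0 y \<partial>M)) / (s - s0)) \<circ> X) \<longlonglongrightarrow> (\<integral>y. f' s0 y \<partial>M)"
      unfolding o_def by (simp only:)
  qed
  then show ?thesis
    unfolding has_field_derivative_iff using d by (simp add: at_within_open[of s0 "ball s0 d"])
qed

section \<open>Distance to the boundary\<close>

lemma ball_subset_bdist:
  assumes "x \<in> \<Omega>" "ennreal R \<le> bdist \<Omega> x"
  shows "ball x R \<subseteq> \<Omega>"
proof (rule ccontr)
  assume not: "\<not> ball x R \<subseteq> \<Omega>"
  then have "0 < R"
    by (metis ball_empty empty_subsetI linorder_not_le)
  then have "x \<in> ball x R \<inter> \<Omega>"
    using assms(1) by simp
  \<comment> \<open>A connected set that meets both \<Omega> and its complement meets the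
    frontier.\<close>
  then have "ball x R \<inter> frontier \<Omega> \<noteq> {}"
    using not by (intro connected_Int_frontier connected_ball) blast+
  then obtain y where y: "y \<in> frontier \<Omega>" "dist x y < R"
    by auto
  then have "bdist \<Omega> x \<le> ennreal (dist x y)"
    unfolding bdist_def by (intro INF_lower)
  also have "\<dots> < ennreal R"
    using y(2) by (simp add: ennreal_lessI \<open>0 < R\<close>)
  finally show False
    using assms(2) by simp
qed

lemma bdist_pos:
  assumes "open \<Omega>" "x \<in> \<Omega>"
  shows "bdist \<Omega> x > 0"
proof -
  obtain e where e: "e > 0" "ball x e \<subseteq> \<Omega>"
    using assms openE by blast
  have "ennreal e \<le> bdist \<Omega> x"
    unfolding bdist_def
  proof (rule INF_greatest)
    fix y assume "y \<in> frontier \<Omega>"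
    then have "y \<notin> \<Omega>"
      using assms(1) by (simp add: frontier_def interior_open)
    then show "ennreal e \<le> ennreal (dist x y)"
      using e(2) by (intro ennreal_leI) (auto simp: not_less[symmetric] subset_iff)
  qed
  then show ?thesis
    using e(1) by (metis ennreal_less_zero_iff order_less_le_trans)
qed

lemma bdist_triangle: "bdist \<Omega> x \<le> bdist \<Omega> y + ennreal (dist x y)"
proof -
  \<comment> \<open>Truncated subtraction moves the constant to the left, so that the infimum on the
    right can be estimated point by point; an empty frontier is covered as well.\<close>
  have "bdist \<Omega> x - ennreal (dist x y) \<le> bdist \<Omega> y"
    unfolding bdist_def[of \<Omega> y]
  proof (rule INF_greatest)
    fix z assume "z \<in> frontier \<Omega>"
    then have "bdist \<Omega> x \<le> ennreal (dist x z)"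
      unfolding bdist_def by (rule INF_lower)
    also have "\<dots> \<le> ennreal (dist y z) + ennreal (dist x y)"
      using dist_triangle[of x z y] by (simp add: ennreal_leI add.commute flip: ennreal_plus)
    finally show "bdist \<Omega> x - ennreal (dist x y) \<le> ennreal (dist y z)"
      by (simp add: ennreal_minus_le_iff add.commute)
  qed
  then show ?thesis
    by (simp add: ennreal_minus_le_iff add.commute)
qed


section \<open>The Hardy--Littlewood maximal function\<close>

lemma ennreal_less_divide_iff:
  fixes a b c :: ennreal
  assumes "c \<noteq> 0" "c < top"
  shows "a < b / c \<longleftrightarrow> a * c < b"
  using assms
  by (cases a; cases b; cases c)
    (auto simp: divide_ennreal ennreal_less_iff field_simps ennreal_top_mult ennreal_top_divide
      simp flip: ennreal_mult)

text \<open>Centred balls, normalized by \<open>r ^ DIM('a)\<close> rather than by the volume. This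
  only moves factors of \<open>unit_ball_vol\<close> into the constants.\<close>

definition maximal :: "('a::euclidean_space \<Rightarrow> ennreal) \<Rightarrow> 'a \<Rightarrow> ennreal" where
  "maximal h x = (SUP r\<in>{0<..}. (\<integral>\<^sup>+y\<in>ball x r. h y \<partial>lebesgue) / ennreal (r ^ DIM('a)))"

lemma less_maximal_iff:
  fixes h :: "'a::euclidean_space \<Rightarrow> ennreal"
  shows "a < maximal h x \<longleftrightarrow> (\<exists>r>0. a * ennreal (r ^ DIM('a)) < (\<integral>\<^sup>+y\<in>ball x r. h y \<partial>lebesgue))"
  unfolding maximal_def less_SUP_iff by (auto simp: ennreal_less_divide_iff)

lemma ball_integral_le_maximal:
  fixes h :: "'a::euclidean_space \<Rightarrow> ennreal"
  assumes "r > 0"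
  shows "(\<integral>\<^sup>+y\<in>ball x r. h y \<partial>lebesgue) \<le> maximal h x * ennreal (r ^ DIM('a))"
  by (metis assms less_irrefl less_maximal_iff not_less)

text \<open>Lower semicontinuity. If the ball of radius \<open>r\<close> about \<open>x\<close>
  carries too much mass, so does a slightly smaller concentric ball, by continuity from below; and
  every point near \<open>x\<close> has that smaller ball inside its own ball of radius
  \<open>r\<close>.\<close>

lemma open_less_maximal:
  fixes h :: "'a::euclidean_space \<Rightarrow> ennreal"
  assumes [measurable]: "h \<in> borel_measurable lebesgue"
  shows "open {x. a < maximal h x}"
proof (rule openI)
  fix x assume "x \<in> {x. a < maximal h x}"
  then obtain r where r: "r > 0" "a * ennreal (r ^ DIM('a)) < (\<integral>\<^sup>+y\<in>ball x r. h y \<partial>lebesgue)"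
    by (auto simp: less_maximal_iff)
  \<comment> \<open>Radii that start at 0 and increase to \<open>r\<close> without reaching
    it.\<close>
  define \<rho> where "\<rho> k = r - r / real (Suc k)" for k
  have \<rho>: "\<rho> k < r" for k
    using r(1) by (simp add: \<rho>_def)
  have un: "(\<Union>k. ball x (\<rho> k)) = ball x r"
  proof
    show "(\<Union>k. ball x (\<rho> k)) \<subseteq> ball x r"
      using \<rho> by (force simp: less_imp_le intro: order.strict_trans)
    show "ball x r \<subseteq> (\<Union>k. ball x (\<rho> k))"
    proof
      fix y assume "y \<in> ball x r"
      then have "0 < (r - dist x y) / r"
        using r(1) by simp
      then obtain k where "inverse (real (Suc k)) < (r - dist x y) / r"
        using reals_Archimedean by blast
      then have "dist x y < \<rho> k"
        using r(1) by (simp add: \<rho>_def field_simps)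
      then show "y \<in> (\<Union>k. ball x (\<rho> k))"
        by auto
    qed
  qed
  have mono: "\<rho> k \<le> \<rho> l" if "k \<le> l" for k l
    using r(1) that by (auto simp: \<rho>_def intro!: divide_left_mono)
  have "(SUP k. emeasure (density lebesgue h) (ball x (\<rho> k))) =
      emeasure (density lebesgue h) (\<Union>k. ball x (\<rho> k))"
    by (rule SUP_emeasure_incseq) (auto simp: incseq_def dest!: mono)
  then have "(SUP k. \<integral>\<^sup>+y\<in>ball x (\<rho> k). h y \<partial>lebesgue) = (\<integral>\<^sup>+y\<in>ball x r. h y \<partial>lebesgue)"
    by (simp add: un emeasure_density)
  with r(2) have "a * ennreal (r ^ DIM('a)) < (SUP k. \<integral>\<^sup>+y\<in>ball x (\<rho> k). h y \<partial>lebesgue)"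
    by simp
  then obtain k where k: "a * ennreal (r ^ DIM('a)) < (\<integral>\<^sup>+y\<in>ball x (\<rho> k). h y \<partial>lebesgue)"
    unfolding less_SUP_iff by blast
  show "\<exists>e>0. ball x e \<subseteq> {x. a < maximal h x}"
  proof (intro exI conjI subsetI)
    show "r - \<rho> k > 0"
      using \<rho>[of k] by simp
    fix z assume z: "z \<in> ball x (r - \<rho> k)"
    have "ball x (\<rho> k) \<subseteq> ball z r"
      using z by (auto simp: ball_subset_ball_iff dist_commute)
    then have "(\<integral>\<^sup>+y\<in>ball x (\<rho> k). h y \<partial>lebesgue) \<le> (\<integral>\<^sup>+y\<in>ball z r. h y \<partial>lebesgue)"
      by (intro nn_integral_mono) (auto split: split_indicator)
    with k r(1) show "z \<in> {x. a < maximal h x}"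
      by (auto simp: less_maximal_iff)
  qed
qed

lemma borel_measurable_maximal [measurable (raw)]:
  fixes h :: "'a::euclidean_space \<Rightarrow> ennreal"
  assumes "h \<in> borel_measurable lebesgue"
  shows "maximal h \<in> borel_measurable lebesgue"
proof -
  have "maximal h \<in> borel_measurable borel"
    by (rule borel_measurableI_greater) (auto simp: open_less_maximal[OF assms])
  then show ?thesis
    by (intro measurable_completion) simp
qed

lemma emeasure_lebesgue_ball:
  fixes c :: "'a::euclidean_space"
  assumes "r \<ge> 0"
  shows "emeasure lebesgue (ball c r) = ennreal (unit_ball_vol DIM('a) * r ^ DIM('a))"
  using emeasure_ball[OF assms, of c] by (simp add: emeasure_completion)

text \<open>Countable subadditivity written as an integral over the index set, the form that fits an
  unenumerated countable family of Vitali balls.\<close>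

lemma emeasure_UN_le_count_space:
  assumes "countable I" and [measurable]: "\<And>i. i \<in> I \<Longrightarrow> X i \<in> sets M"
  shows "emeasure M (\<Union>i\<in>I. X i) \<le> (\<integral>\<^sup>+i. emeasure M (X i) \<partial>count_space I)"
proof -
  have [measurable]: "(\<Union>i\<in>I. X i) \<in> sets M"
    using assms by (intro sets.countable_UN'') auto
  have "emeasure M (\<Union>i\<in>I. X i) = (\<integral>\<^sup>+x. indicator (\<Union>i\<in>I. X i) x \<partial>M)"
    by simp
  also have "\<dots> \<le> (\<integral>\<^sup>+x. \<integral>\<^sup>+i. indicator (X i) x \<partial>count_space I \<partial>M)"
  proof (rule nn_integral_mono)
    fix x
    show "indicator (\<Union>i\<in>I. X i) x \<le> (\<integral>\<^sup>+i. indicator (X i) x \<partial>count_space I)"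
    proof (cases "x \<in> (\<Union>i\<in>I. X i)")
      case True
      then obtain i where i: "i \<in> I" "x \<in> X i"
        by blast
      have "(indicator (X i) x :: ennreal) \<le> (\<integral>\<^sup>+i. indicator (X i) x \<partial>count_space I)"
        using nn_integral_ge_point[OF i(1), of "\<lambda>i. indicator (X i) x"] .
      with i True show ?thesis
        by simp
    qed simp
  qed
  also have "\<dots> = (\<integral>\<^sup>+i. \<integral>\<^sup>+x. indicator (X i) x \<partial>M \<partial>count_space I)"
    by (rule nn_integral_count_space_nn_integral) (use assms in auto)
  also have "\<dots> = (\<integral>\<^sup>+i. emeasure M (X i) \<partial>count_space I)"
    by (intro nn_integral_cong) simp
  finally show ?thesis .
qed

text \<open>Vitali covering: disjoint balls are selected whose fivefold enlargements cover the level
  set, and the volume of each is paid for by the mass of \<open>h\<close> on it. Hence the constant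
  is \<open>5 ^ n\<close> times the volume of the unit ball.\<close>

lemma maximal_weak_type:
  obtains C where "C > 0"
    "\<And>(h :: 'a::euclidean_space \<Rightarrow> ennreal) t. h \<in> borel_measurable lebesgue \<Longrightarrow> t > 0 \<Longrightarrow>
      ennreal t * emeasure lebesgue {x. ennreal t < maximal h x} \<le> ennreal C * (\<integral>\<^sup>+x. h x \<partial>lebesgue)"
proof
  define n where "n = DIM('a)"
  define C where "C = unit_ball_vol (real n) * 5 ^ n"
  show C: "C > 0"
    by (simp add: C_def)
  fix h :: "'a \<Rightarrow> ennreal" and t :: real
  assume [measurable]: "h \<in> borel_measurable lebesgue" and t: "t > 0"
  let ?S = "{x. ennreal t < maximal h x}"
  show "ennreal t * emeasure lebesgue ?S \<le> ennreal C * (\<integral>\<^sup>+x. h x \<partial>lebesgue)"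
  proof (cases "(\<integral>\<^sup>+x. h x \<partial>lebesgue) = \<infinity>")
    case True
    then show ?thesis
      using C by (simp add: ennreal_mult_top)
  next
    case False
    then obtain I where I: "(\<integral>\<^sup>+x. h x \<partial>lebesgue) = ennreal I" "I \<ge> 0"
      by (cases "\<integral>\<^sup>+x. h x \<partial>lebesgue") auto
    define K where "K = {i. snd i > 0 \<and>
      ennreal t * ennreal (snd i ^ n) < (\<integral>\<^sup>+y\<in>ball (fst i) (snd i). h y \<partial>lebesgue)}"
    \<comment> \<open>The covering lemma requires bounded radii. A ball in \<open>K\<close> of
      radius \<open>r\<close> satisfies \<open>t * r ^ n < I\<close>, and
      \<open>r \<le> r ^ n\<close> once \<open>r \<ge> 1\<close>.\<close>
    have bound: "0 < snd i \<and> snd i \<le> max 1 (I / t)" if "i \<in> K" for i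
    proof -
      define r where "r = snd i"
      have r: "r > 0" "ennreal t * ennreal (r ^ n) < (\<integral>\<^sup>+y\<in>ball (fst i) r. h y \<partial>lebesgue)"
        using that by (auto simp: K_def r_def)
      have "(\<integral>\<^sup>+y\<in>ball (fst i) r. h y \<partial>lebesgue) \<le> (\<integral>\<^sup>+y. h y \<partial>lebesgue)"
        by (intro nn_integral_mono) (auto split: split_indicator)
      with r(2) have "ennreal (t * r ^ n) < ennreal I"
        using t r(1) I(1) by (simp add: ennreal_mult')
      then have "r ^ n < I / t"
        using t r(1) by (simp add: ennreal_less_iff field_simps)
      moreover have "r \<le> r ^ n" if "r \<ge> 1"
        using that by (intro self_le_power) (auto simp: n_def)
      ultimately show ?thesis
        using r(1) unfolding r_def[symmetric] by (cases "r \<ge> 1") auto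
    qed
    have "?S \<subseteq> (\<Union>i\<in>K. ball (fst i) (snd i))"
    proof
      fix x assume "x \<in> ?S"
      then obtain r where "r > 0" "ennreal t * ennreal (r ^ n) < (\<integral>\<^sup>+y\<in>ball x r. h y \<partial>lebesgue)"
        by (auto simp: less_maximal_iff n_def)
      then have "(x, r) \<in> K" "x \<in> ball (fst (x, r)) (snd (x, r))"
        by (auto simp: K_def)
      then show "x \<in> (\<Union>i\<in>K. ball (fst i) (snd i))"
        by (rule UN_I)
    qed
    from Vitali_covering_lemma_balls[OF this bound] obtain D where D: "countable D" "D \<subseteq> K"
      and disj: "pairwise (\<lambda>i j. disjnt (ball (fst i) (snd i)) (ball (fst j) (snd j))) D"
      and cover: "?S \<subseteq> (\<Union>i\<in>D. ball (fst i) (5 * snd i))"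
      by blast
    have pos: "snd i > 0" if "i \<in> D" for i
      using bound D(2) that by blast
    have "ennreal t * emeasure lebesgue ?S \<le> ennreal t * emeasure lebesgue (\<Union>i\<in>D. ball (fst i) (5 * snd i))"
      using D(1) by (intro mult_left_mono emeasure_mono cover sets.countable_UN'') auto
    also have "\<dots> \<le> ennreal t * (\<integral>\<^sup>+i. emeasure lebesgue (ball (fst i) (5 * snd i)) \<partial>count_space D)"
      using D(1) by (intro mult_left_mono emeasure_UN_le_count_space) auto
    also have "\<dots> = (\<integral>\<^sup>+i. ennreal t * emeasure lebesgue (ball (fst i) (5 * snd i)) \<partial>count_space D)"
      by (simp add: nn_integral_cmult)
    also have "\<dots> \<le> (\<integral>\<^sup>+i. ennreal C * emeasure (density lebesgue h) (ball (fst i) (snd i)) \<partial>count_space D)"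
    proof (rule nn_integral_mono)
      fix i assume "i \<in> space (count_space D)"
      then have i: "i \<in> D"
        by simp
      have "ennreal t * emeasure lebesgue (ball (fst i) (5 * snd i)) =
          ennreal C * (ennreal t * ennreal (snd i ^ n))"
        using pos[OF i] t
        by (simp add: emeasure_lebesgue_ball C_def n_def power_mult_distrib mult_ac
            del: emeasure_completion flip: ennreal_mult)
      also have "\<dots> \<le> ennreal C * emeasure (density lebesgue h) (ball (fst i) (snd i))"
        using i D(2) by (intro mult_left_mono) (auto simp: K_def emeasure_density less_imp_le)
      finally show "ennreal t * emeasure lebesgue (ball (fst i) (5 * snd i)) \<le>
          ennreal C * emeasure (density lebesgue h) (ball (fst i) (snd i))" .
    qed
    also have "\<dots> = ennreal C * (\<integral>\<^sup>+i. emeasure (density lebesgue h) (ball (fst i) (snd i)) \<partial>count_space D)"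
      by (simp add: nn_integral_cmult)
    also have "\<dots> = ennreal C * emeasure (density lebesgue h) (\<Union>i\<in>D. ball (fst i) (snd i))"
      by (subst emeasure_UN_countable)
        (use D(1) disj in \<open>auto simp: disjoint_family_on_def pairwise_def disjnt_def\<close>)
    also have "\<dots> \<le> ennreal C * emeasure (density lebesgue h) UNIV"
      by (intro mult_left_mono emeasure_mono) auto
    also have "\<dots> = ennreal C * (\<integral>\<^sup>+x. h x \<partial>lebesgue)"
      by (simp add: emeasure_density)
    finally show ?thesis .
  qed
qed

section \<open>From the weak to the strong maximal inequality\<close>

lemma nn_integral_powr_Ioo:
  assumes "a > -1" "c \<ge> 0"
  shows "(\<integral>\<^sup>+t. ennreal (t powr a) * indicator {0<..<c} t \<partial>lborel) = ennreal (c powr (a + 1) / (a + 1))"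
proof -
  have "(\<integral>\<^sup>+t. ennreal (t powr a) * indicator {0<..<c} t \<partial>lborel) =
      (\<integral>\<^sup>+t. ennreal (t powr a) * indicator {0..c} t \<partial>lborel)"
  proof (rule nn_integral_cong_AE)
    have "AE t in lborel. t \<noteq> 0 \<and> t \<noteq> (c::real)"
      using AE_lborel_singleton[of 0] AE_lborel_singleton[of c] by eventually_elim auto
    then show "AE t in lborel. ennreal (t powr a) * indicator {0<..<c} t = ennreal (t powr a) * indicator {0..c} t"
      by eventually_elim (auto split: split_indicator)
  qed
  also have "\<dots> = ennreal (c powr (a + 1) / (a + 1))"
    by (rule nn_integral_has_integral_lebesgue'[OF _ has_integral_powr_from_0]) (use assms in auto)
  finally show ?thesis .
qed

lemma ennreal_powr_layer_cake:
  assumes q: "q \<ge> 1"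
  shows "ennreal_powr a q \<le>
    (\<integral>\<^sup>+t. ennreal (q * t powr (q - 1)) * indicator {t. 0 < t \<and> ennreal t < a} t \<partial>lborel)"
    (is "_ \<le> ?I a")
proof -
  have real: "?I (ennreal c) = ennreal (c powr q)" if "c \<ge> 0" for c
  proof -
    have "?I (ennreal c) = (\<integral>\<^sup>+t. ennreal q * (ennreal (t powr (q - 1)) * indicator {0<..<c} t) \<partial>lborel)"
      using q that by (intro nn_integral_cong) (auto split: split_indicator simp: ennreal_mult' ennreal_less_iff)
    also have "\<dots> = ennreal q * (\<integral>\<^sup>+t. ennreal (t powr (q - 1)) * indicator {0<..<c} t \<partial>lborel)"
      by (rule nn_integral_cmult) measurable
    also have "\<dots> = ennreal q * ennreal (c powr q / q)"
      using q that by (simp add: nn_integral_powr_Ioo)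
    also have "\<dots> = ennreal (c powr q)"
      using q that by (simp flip: ennreal_mult')
    finally show ?thesis .
  qed
  show ?thesis
  proof (cases a)
    case (real c)
    then show ?thesis
      using \<open>\<And>c. c \<ge> 0 \<Longrightarrow> ?I (ennreal c) = ennreal (c powr q)\<close>[of c] by (simp add: ennreal_powr_def)
  next
    case top
    \<comment> \<open>For an infinite value the integral dominates the one at each natural number
      \<open>n\<close>, which is \<open>n powr q \<ge> n\<close> when \<open>n\<close> is positive;
      hence it is infinite.\<close>
    have "of_nat n \<le> ?I top" for n :: nat
    proof (cases "n = 0")
      case False
      have "real n \<le> real n powr q"
        using False q by (simp add: powr_mono[of 1 q "real n", simplified])
      then have "of_nat n \<le> ?I (ennreal (real n))"
        by (simp add: real ennreal_of_nat_eq_real_of_nat ennreal_leI)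
      also have "\<dots> \<le> ?I top"
        by (intro nn_integral_mono) (auto split: split_indicator)
      finally show ?thesis .
    qed simp
    then have "?I top = top"
      using ennreal_Ex_less_of_nat[of "?I top"] by (auto simp: less_top[symmetric] dest: leD)
    then show ?thesis
      using top by simp
  qed
qed

lemma sigma_finite_lebesgue: "sigma_finite_measure (lebesgue :: 'a::euclidean_space measure)"
proof
  have "(\<Union>n::nat. cball 0 (real n)) = (UNIV :: 'a set)"
    using real_arch_simple by (fastforce simp: dist_norm)
  moreover have "emeasure lebesgue (cball 0 (real n) :: 'a set) \<noteq> \<infinity>" for n
    using lmeasurable_cball[of "0::'a" "real n"] by (simp add: fmeasurable_def)
  ultimately show "\<exists>A. countable A \<and> A \<subseteq> sets lebesgue \<and> \<Union> A = space (lebesgue :: 'a measure) \<and>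
      (\<forall>a\<in>A. emeasure lebesgue a \<noteq> \<infinity>)"
    by (intro exI[of _ "range (\<lambda>n::nat. cball 0 (real n))"]) auto
qed

text \<open>Tonelli's theorem, used in both directions: with \<open>v = 1\<close> to express the
  norm of a maximal function by its distribution function, and with \<open>v = h\<close> to
  integrate over the level sets of \<open>h\<close> back.\<close>

lemma layer_cake_swap:
  fixes g v :: "'a \<Rightarrow> ennreal" and w :: "real \<Rightarrow> ennreal"
  assumes M: "sigma_finite_measure M"
    and [measurable]: "g \<in> borel_measurable M" "v \<in> borel_measurable M" "w \<in> borel_measurable lborel"
  shows "(\<integral>\<^sup>+x. v x * (\<integral>\<^sup>+t. w t * indicator {t. 0 < t \<and> ennreal t < g x} t \<partial>lborel) \<partial>M) =
    (\<integral>\<^sup>+t. w t * indicator {0<..} t * (\<integral>\<^sup>+x. v x * indicator {x. ennreal t < g x} x \<partial>M) \<partial>lborel)"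
proof -
  interpret M: sigma_finite_measure M
    by fact
  interpret pair_sigma_finite "lborel :: real measure" M
    by unfold_locales
  let ?f = "\<lambda>t x. if 0 < t \<and> ennreal t < g x then v x * w t else 0"
  have "(\<integral>\<^sup>+x. v x * (\<integral>\<^sup>+t. w t * indicator {t. 0 < t \<and> ennreal t < g x} t \<partial>lborel) \<partial>M) =
      (\<integral>\<^sup>+x. \<integral>\<^sup>+t. ?f t x \<partial>lborel \<partial>M)"
  proof (rule nn_integral_cong)
    fix x
    have "v x * (\<integral>\<^sup>+t. w t * indicator {t. 0 < t \<and> ennreal t < g x} t \<partial>lborel) =
        (\<integral>\<^sup>+t. v x * (w t * indicator {t. 0 < t \<and> ennreal t < g x} t) \<partial>lborel)"
      by (rule nn_integral_cmult[symmetric]) measurable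
    also have "\<dots> = (\<integral>\<^sup>+t. ?f t x \<partial>lborel)"
      by (intro nn_integral_cong) auto
    finally show "v x * (\<integral>\<^sup>+t. w t * indicator {t. 0 < t \<and> ennreal t < g x} t \<partial>lborel) =
        (\<integral>\<^sup>+t. ?f t x \<partial>lborel)" .
  qed
  also have "\<dots> = (\<integral>\<^sup>+t. \<integral>\<^sup>+x. ?f t x \<partial>M \<partial>lborel)"
    by (rule Fubini') measurable
  also have "\<dots> = (\<integral>\<^sup>+t. w t * indicator {0<..} t * (\<integral>\<^sup>+x. v x * indicator {x. ennreal t < g x} x \<partial>M) \<partial>lborel)"
  proof (rule nn_integral_cong)
    fix t :: real
    have [measurable]: "(\<lambda>x. v x * indicator {x. ennreal t < g x} x) \<in> borel_measurable M"
    proof -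
      have "(\<lambda>x. v x * indicator {x. ennreal t < g x} x) = (\<lambda>x. if ennreal t < g x then v x else 0)"
        by auto
      also have "\<dots> \<in> borel_measurable M"
        by measurable
      finally show ?thesis .
    qed
    have "w t * indicator {0<..} t * (\<integral>\<^sup>+x. v x * indicator {x. ennreal t < g x} x \<partial>M) =
        (\<integral>\<^sup>+x. w t * indicator {0<..} t * (v x * indicator {x. ennreal t < g x} x) \<partial>M)"
      by (rule nn_integral_cmult[symmetric]) measurable
    also have "\<dots> = (\<integral>\<^sup>+x. ?f t x \<partial>M)"
      by (intro nn_integral_cong) (auto simp: mult_ac)
    finally show "(\<integral>\<^sup>+x. ?f t x \<partial>M) =
        w t * indicator {0<..} t * (\<integral>\<^sup>+x. v x * indicator {x. ennreal t < g x} x \<partial>M)" ..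
  qed
  finally show ?thesis .
qed

text \<open>The part of \<open>h\<close> below \<open>t / (2 * V)\<close> contributes at most
  \<open>t / 2\<close>, because a ball of radius \<open>r\<close> has volume
  \<open>V * r ^ DIM('a)\<close>. The large values must account for the other half.\<close>

lemma maximal_truncate:
  fixes h :: "'a::euclidean_space \<Rightarrow> real"
  assumes [measurable]: "h \<in> borel_measurable lebesgue" and t: "t > 0"
  assumes less: "ennreal t < maximal (\<lambda>x. ennreal (h x)) x"
  defines "V \<equiv> unit_ball_vol (real DIM('a))"
  shows "ennreal (t / 2) <
    maximal (\<lambda>x. ennreal (h x) * indicator {x. t < 2 * V * h x} x) x"
proof (rule ccontr)
  assume not: "\<not> ?thesis"
  let ?h = "\<lambda>x. ennreal (h x) * indicator {x. t < 2 * V * h x} x"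
  have V: "V > 0"
    by (simp add: V_def)
  have "{x \<in> space lebesgue. t < 2 * V * h x} \<in> sets lebesgue"
    by measurable
  moreover have "(\<lambda>x. ennreal (h x)) \<in> borel_measurable lebesgue"
    by measurable
  ultimately have meas: "(\<lambda>y. ?h y * indicator A y) \<in> borel_measurable lebesgue" if "A \<in> sets lebesgue" for A
    using that by (intro borel_measurable_times_ennreal borel_measurable_indicator) auto
  have [simp]: "(\<lambda>y. ?h y * indicator (ball x r) y) \<in> borel_measurable lebesgue" for x r
    by (intro meas sets_completionI_sets) simp
  have [simp]: "(\<lambda>y. c * indicator (ball x r) y :: ennreal) \<in> borel_measurable lebesgue" for c x r
    by (intro borel_measurable_times_ennreal borel_measurable_const borel_measurable_indicator
        sets_completionI_sets) simp
  obtain r where r: "r > 0"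
    "ennreal t * ennreal (r ^ DIM('a)) < (\<integral>\<^sup>+y\<in>ball x r. ennreal (h y) \<partial>lebesgue)"
    using less by (auto simp: less_maximal_iff)
  have "(\<integral>\<^sup>+y\<in>ball x r. ennreal (h y) \<partial>lebesgue) \<le>
      (\<integral>\<^sup>+y. ?h y * indicator (ball x r) y + ennreal (t / (2 * V)) * indicator (ball x r) y \<partial>lebesgue)"
    using t V by (intro nn_integral_mono) (auto split: split_indicator simp: field_simps not_less intro!: ennreal_leI)
  also have "\<dots> = (\<integral>\<^sup>+y\<in>ball x r. ?h y \<partial>lebesgue) + ennreal (t / (2 * V)) * emeasure lebesgue (ball x r)"
    by (subst nn_integral_add) (auto simp: nn_integral_cmult_indicator simp del: emeasure_completion)
  also have "\<dots> \<le> ennreal (t / 2) * ennreal (r ^ DIM('a)) + ennreal (t / (2 * V)) * emeasure lebesgue (ball x r)"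
    using not by (intro add_right_mono order_trans[OF ball_integral_le_maximal[OF r(1)]] mult_right_mono)
      (auto simp: not_less)
  also have "\<dots> = ennreal t * ennreal (r ^ DIM('a))"
    using r(1) t V by (simp add: emeasure_lebesgue_ball del: emeasure_completion flip: V_def ennreal_mult ennreal_plus)
  finally show False
    using r(2) by simp
qed

text \<open>Marcinkiewicz interpolation between the weak type at exponent 1 and the trivial bound
  for bounded functions: at height \<open>t\<close>, the weak estimate is applied only to the part
  of \<open>h\<close> above \<open>t / (2 * V)\<close>.\<close>

theorem maximal_strong_type:
  assumes q: "q > 1"
  obtains C where "C > 0"
    "\<And>h :: 'a::euclidean_space \<Rightarrow> real. h \<in> borel_measurable lebesgue \<Longrightarrow> (\<And>x. h x \<ge> 0) \<Longrightarrow>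
      (\<integral>\<^sup>+x. ennreal_powr (maximal (\<lambda>x. ennreal (h x)) x) q \<partial>lebesgue) \<le>
      ennreal C * (\<integral>\<^sup>+x. ennreal (h x powr q) \<partial>lebesgue)"
proof -
  obtain C1 where C1: "C1 > 0"
    "\<And>(h :: 'a \<Rightarrow> ennreal) t. h \<in> borel_measurable lebesgue \<Longrightarrow> t > 0 \<Longrightarrow>
      ennreal t * emeasure lebesgue {x. ennreal t < maximal h x} \<le> ennreal C1 * (\<integral>\<^sup>+x. h x \<partial>lebesgue)"
    using maximal_weak_type[where 'a = 'a] by blast
  define V where "V = unit_ball_vol (real DIM('a))"
  have V: "V > 0"
    by (simp add: V_def)
  \<comment> \<open>The leading 2 comes from the height \<open>t / 2\<close> left after truncation.
    The last factor is the integral of \<open>t powr (q - 2)\<close> over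
    \<open>0 < t < 2 * V\<close>, whose convergence at 0 is where \<open>q > 1\<close>
    enters.\<close>
  define C where "C = 2 * C1 * q * (2 * V) powr (q - 1) / (q - 1)"
  show thesis
  proof
    show "C > 0"
      using C1 q V by (simp add: C_def)
    fix h :: "'a \<Rightarrow> real"
    assume h [measurable]: "h \<in> borel_measurable lebesgue" and nonneg: "\<And>x. h x \<ge> 0"
    let ?M = "maximal (\<lambda>x. ennreal (h x))"
    have M: "?M \<in> borel_measurable lebesgue"
      by (rule borel_measurable_maximal) measurable
    have "(\<integral>\<^sup>+x. ennreal_powr (?M x) q \<partial>lebesgue) \<le>
        (\<integral>\<^sup>+x. 1 * (\<integral>\<^sup>+t. ennreal (q * t powr (q - 1)) * indicator {t. 0 < t \<and> ennreal t < ?M x} t \<partial>lborel) \<partial>lebesgue)"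
      using q ennreal_powr_layer_cake[of q] by (intro nn_integral_mono) auto
    also have "\<dots> = (\<integral>\<^sup>+t. ennreal (q * t powr (q - 1)) * indicator {0<..} t *
        (\<integral>\<^sup>+x. 1 * indicator {x. ennreal t < ?M x} x \<partial>lebesgue) \<partial>lborel)"
      by (rule layer_cake_swap[OF sigma_finite_lebesgue M]) auto
    also have "\<dots> \<le> (\<integral>\<^sup>+t. ennreal (2 * C1 * q * t powr (q - 2)) * indicator {0<..} t *
        (\<integral>\<^sup>+x. ennreal (h x) * indicator {x. ennreal t < ennreal (2 * V * h x)} x \<partial>lebesgue) \<partial>lborel)"
    proof (rule nn_integral_mono)
      fix t :: real
      show "ennreal (q * t powr (q - 1)) * indicator {0<..} t *
          (\<integral>\<^sup>+x. 1 * indicator {x. ennreal t < ?M x} x \<partial>lebesgue) \<le>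
          ennreal (2 * C1 * q * t powr (q - 2)) * indicator {0<..} t *
          (\<integral>\<^sup>+x. ennreal (h x) * indicator {x. ennreal t < ennreal (2 * V * h x)} x \<partial>lebesgue)"
      proof (cases "t > 0")
        case t: True
        let ?h = "\<lambda>x. ennreal (h x) * indicator {x. t < 2 * V * h x} x"
        have h' [measurable]: "?h \<in> borel_measurable lebesgue"
          by measurable
        have open_sets: "open {x. ennreal t < ?M x}" "open {x. ennreal (t / 2) < maximal ?h x}"
          by (intro open_less_maximal; measurable)+
        have "{x. ennreal t < ?M x} \<subseteq> {x. ennreal (t / 2) < maximal ?h x}"
          using maximal_truncate[OF h t] by (auto simp: V_def)
        then have "ennreal (t / 2) * emeasure lebesgue {x. ennreal t < ?M x} \<le>
            ennreal (t / 2) * emeasure lebesgue {x. ennreal (t / 2) < maximal ?h x}"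
          by (intro mult_left_mono emeasure_mono borel_open sets_completionI_sets) (use open_sets in auto)
        also have "\<dots> \<le> ennreal C1 * (\<integral>\<^sup>+x. ?h x \<partial>lebesgue)"
          using t by (intro C1(2) h') auto
        finally have weak: "ennreal (t / 2) * emeasure lebesgue {x. ennreal t < ?M x} \<le>
            ennreal C1 * (\<integral>\<^sup>+x. ?h x \<partial>lebesgue)" .
        have "t powr (q - 1) = t * t powr (q - 2)"
          using t powr_add[of t 1 "q - 2"] by simp
        then have eq: "q * t powr (q - 1) = (2 * q * t powr (q - 2)) * (t / 2)"
          by simp
        have "ennreal (q * t powr (q - 1)) * emeasure lebesgue {x. ennreal t < ?M x} =
            ennreal (2 * q * t powr (q - 2)) * (ennreal (t / 2) * emeasure lebesgue {x. ennreal t < ?M x})"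
          unfolding eq using t q by (subst ennreal_mult) (auto simp: mult.assoc)
        also have "\<dots> \<le> ennreal (2 * q * t powr (q - 2)) * (ennreal C1 * (\<integral>\<^sup>+x. ?h x \<partial>lebesgue))"
          by (intro mult_left_mono weak) auto
        also have "\<dots> = ennreal (2 * C1 * q * t powr (q - 2)) * (\<integral>\<^sup>+x. ?h x \<partial>lebesgue)"
        proof -
          have "ennreal (2 * C1 * q * t powr (q - 2)) = ennreal (2 * q * t powr (q - 2)) * ennreal C1"
            using C1(1) q by (subst ennreal_mult[symmetric]) (auto simp: mult_ac)
          then show ?thesis
            by (simp only: mult.assoc)
        qed
        also have "(\<integral>\<^sup>+x. ?h x \<partial>lebesgue) =
            (\<integral>\<^sup>+x. ennreal (h x) * indicator {x. ennreal t < ennreal (2 * V * h x)} x \<partial>lebesgue)"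
          using t by (intro nn_integral_cong) (auto split: split_indicator simp: ennreal_less_iff)
        finally show ?thesis
          using t open_sets(1) by (simp add: nn_integral_indicator[OF sets_completionI_sets] del: emeasure_completion)
      qed auto
    qed
    also have "\<dots> = (\<integral>\<^sup>+x. ennreal (h x) * (\<integral>\<^sup>+t. ennreal (2 * C1 * q * t powr (q - 2)) *
        indicator {t. 0 < t \<and> ennreal t < ennreal (2 * V * h x)} t \<partial>lborel) \<partial>lebesgue)"
      by (rule layer_cake_swap[symmetric, OF sigma_finite_lebesgue]) measurable
    also have "\<dots> = (\<integral>\<^sup>+x. ennreal C * ennreal (h x powr q) \<partial>lebesgue)"
    proof (rule nn_integral_cong)
      fix x
      have set_eq: "{t. 0 < t \<and> ennreal t < ennreal (2 * V * h x)} = {0<..<2 * V * h x}"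
        by (auto simp: ennreal_less_iff)
      have "ennreal (h x) * (\<integral>\<^sup>+t. ennreal (2 * C1 * q * t powr (q - 2)) *
          indicator {t. 0 < t \<and> ennreal t < ennreal (2 * V * h x)} t \<partial>lborel) =
          ennreal (h x) * (\<integral>\<^sup>+t. ennreal (2 * C1 * q) * (ennreal (t powr (q - 2)) * indicator {0<..<2 * V * h x} t) \<partial>lborel)"
        unfolding set_eq using C1(1) q
        by (intro arg_cong[where f = "(*) (ennreal (h x))"] nn_integral_cong) (simp add: ennreal_mult mult.assoc)
      also have "\<dots> = ennreal (h x) * (ennreal (2 * C1 * q) * (\<integral>\<^sup>+t. ennreal (t powr (q - 2)) * indicator {0<..<2 * V * h x} t \<partial>lborel))"
        by (subst nn_integral_cmult) auto
      also have "\<dots> = ennreal (2 * C1 * q * h x) * (\<integral>\<^sup>+t. ennreal (t powr (q - 2)) * indicator {0<..<2 * V * h x} t \<partial>lborel)"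
        using C1(1) q nonneg[of x] by (simp add: ennreal_mult mult_ac)
      also have "\<dots> = ennreal (2 * C1 * q * h x) * ennreal ((2 * V * h x) powr (q - 1) / (q - 1))"
        using nn_integral_powr_Ioo[of "q - 2" "2 * V * h x"] q V nonneg[of x] by simp
      also have "\<dots> = ennreal (2 * C1 * q * h x * ((2 * V * h x) powr (q - 1) / (q - 1)))"
        using C1(1) q nonneg[of x] by (simp flip: ennreal_mult)
      also have "2 * C1 * q * h x * ((2 * V * h x) powr (q - 1) / (q - 1)) = C * h x powr q"
      proof (cases "h x = 0")
        case False
        then have "h x powr q = h x * h x powr (q - 1)"
          using nonneg[of x] powr_add[of "h x" 1 "q - 1"] by simp
        then show ?thesis
          using V nonneg[of x] by (simp add: C_def powr_mult)
      qed (use q in simp)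
      also have "ennreal \<dots> = ennreal C * ennreal (h x powr q)"
        using \<open>C > 0\<close> by (simp add: ennreal_mult)
      finally show "ennreal (h x) * (\<integral>\<^sup>+t. ennreal (2 * C1 * q * t powr (q - 2)) *
          indicator {t. 0 < t \<and> ennreal t < ennreal (2 * V * h x)} t \<partial>lborel) = ennreal C * ennreal (h x powr q)" .
    qed
    also have "\<dots> = ennreal C * (\<integral>\<^sup>+x. ennreal (h x powr q) \<partial>lebesgue)"
      by (rule nn_integral_cmult) measurable
    finally show "(\<integral>\<^sup>+x. ennreal_powr (?M x) q \<partial>lebesgue) \<le>
        ennreal C * (\<integral>\<^sup>+x. ennreal (h x powr q) \<partial>lebesgue)" .
  qed
qed


section \<open>Lebesgue's differentiation theorem\<close>

text \<open>Measurability supplies continuous functions converging almost everywhere, but without a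
  majorant. Clamping to the interval from \<open>- m\<close> to \<open>m\<close> provides a constant
  one, integrable on a ball, and clamping \<open>f\<close> itself costs little for large
  \<open>m\<close>.\<close>

lemma continuous_L1_approximation:
  fixes f :: "'a::euclidean_space \<Rightarrow> real"
  assumes f: "integrable lebesgue f" and e: "e > 0"
  obtains c where "continuous_on UNIV c"
    "(\<integral>\<^sup>+x. ennreal \<bar>f x - c x\<bar> \<partial>lebesgue_on (ball 0 R)) < ennreal e"
proof -
  let ?B = "lebesgue_on (ball 0 R :: 'a set)"
  have fB: "integrable ?B f"
    using f integrable_mult_indicator[of "ball 0 R" lebesgue f] by (simp add: integrable_restrict_space)
  have [measurable]: "f \<in> borel_measurable lebesgue"
    using f by simp
  obtain N g where N: "negligible N" and cont: "\<And>n. continuous_on UNIV (g n)"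
    and lim: "\<And>x. x \<notin> N \<Longrightarrow> (\<lambda>n. g n x) \<longlonglongrightarrow> f x"
    using measurable_on_iff_borel_measurable[of UNIV f] f by (auto simp: measurable_on_def)
  define clamp where "clamp m y = max (- real m) (min (real m) y)" for m :: nat and y
  have meas: "h \<in> borel_measurable ?B" if "h \<in> borel_measurable lebesgue" for h :: "'a \<Rightarrow> real"
    using that by (rule measurable_restrict_space1)
  have "(\<lambda>m. \<integral>\<^sup>+x. norm (f x - clamp m (f x)) \<partial>?B) \<longlonglongrightarrow> 0"
  proof (rule nn_integral_dominated_convergence_norm[where w = "\<lambda>x. \<bar>f x\<bar>"])
    show "(\<lambda>x. clamp m (f x)) \<in> borel_measurable ?B" for m
      unfolding clamp_def by (rule meas) measurable
    show "(\<integral>\<^sup>+x. ennreal \<bar>f x\<bar> \<partial>?B) < \<infinity>"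
      using fB by (simp add: integrable_iff_bounded)
    show "AE x in ?B. (\<lambda>m. clamp m (f x)) \<longlonglongrightarrow> f x"
    proof (rule AE_I2)
      fix x
      have "\<forall>\<^sub>F m in sequentially. f x = clamp m (f x)"
      proof -
        obtain M :: nat where "\<bar>f x\<bar> \<le> real M"
          using real_arch_simple by blast
        then show ?thesis
          unfolding eventually_sequentially by (intro exI[of _ M]) (auto simp: clamp_def)
      qed
      then show "(\<lambda>m. clamp m (f x)) \<longlonglongrightarrow> f x"
        by (rule Lim_transform_eventually[OF tendsto_const])
    qed
  qed (auto simp: clamp_def intro!: meas)
  then have "\<forall>\<^sub>F m in sequentially. (\<integral>\<^sup>+x. norm (f x - clamp m (f x)) \<partial>?B) < ennreal (e / 2)"
    using e by (intro order_tendstoD(2)) auto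
  then obtain m where m: "(\<integral>\<^sup>+x. norm (f x - clamp m (f x)) \<partial>?B) < ennreal (e / 2)"
    by (auto simp: eventually_sequentially)
  have cont': "continuous_on UNIV (\<lambda>x. clamp m (g n x))" for n
    unfolding clamp_def by (intro continuous_intros cont)
  have "(\<lambda>n. \<integral>\<^sup>+x. norm (clamp m (f x) - clamp m (g n x)) \<partial>?B) \<longlonglongrightarrow> 0"
  proof (rule nn_integral_dominated_convergence_norm[where w = "\<lambda>x. real m"])
    show "(\<lambda>x. clamp m (g n x)) \<in> borel_measurable ?B" for n
      by (intro meas measurable_completion) (use cont' in \<open>auto intro: borel_measurable_continuous_onI\<close>)
    show "(\<integral>\<^sup>+x. ennreal (real m) \<partial>?B) < \<infinity>"
      using lmeasurable_ball[of "0::'a" R]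
      by (simp add: emeasure_restrict_space fmeasurable_def ennreal_mult_less_top del: emeasure_completion)
    show "AE x in ?B. (\<lambda>n. clamp m (g n x)) \<longlonglongrightarrow> clamp m (f x)"
    proof -
      have "AE x in lebesgue. x \<notin> N"
        using N by (intro AE_not_in) (simp add: negligible_iff_null_sets)
      then have "AE x in ?B. x \<notin> N"
        by (simp add: AE_restrict_space_iff) (auto elim: eventually_mono)
      then show ?thesis
        by eventually_elim (auto simp: clamp_def intro!: tendsto_intros lim)
    qed
  qed (auto simp: clamp_def intro!: meas)
  then have "\<forall>\<^sub>F n in sequentially. (\<integral>\<^sup>+x. norm (clamp m (f x) - clamp m (g n x)) \<partial>?B) < ennreal (e / 2)"
    using e by (intro order_tendstoD(2)) auto
  then obtain n where n: "(\<integral>\<^sup>+x. norm (clamp m (f x) - clamp m (g n x)) \<partial>?B) < ennreal (e / 2)"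
    by (auto simp: eventually_sequentially)
  have [measurable]: "(\<lambda>x. clamp m (f x)) \<in> borel_measurable ?B" "f \<in> borel_measurable ?B"
    "(\<lambda>x. clamp m (g n x)) \<in> borel_measurable ?B"
  proof -
    have "(\<lambda>x. clamp m (f x)) \<in> borel_measurable lebesgue"
      unfolding clamp_def by measurable
    moreover have "(\<lambda>x. clamp m (g n x)) \<in> borel_measurable lebesgue"
      using borel_measurable_continuous_onI[OF cont'] by (intro measurable_completion) simp
    ultimately show "(\<lambda>x. clamp m (f x)) \<in> borel_measurable ?B" "f \<in> borel_measurable ?B"
      "(\<lambda>x. clamp m (g n x)) \<in> borel_measurable ?B"
      by (auto intro!: meas)
  qed
  have "(\<integral>\<^sup>+x. ennreal \<bar>f x - clamp m (g n x)\<bar> \<partial>?B) \<le>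
      (\<integral>\<^sup>+x. ennreal (norm (f x - clamp m (f x))) + ennreal (norm (clamp m (f x) - clamp m (g n x))) \<partial>?B)"
    by (intro nn_integral_mono) (auto simp flip: ennreal_plus intro!: ennreal_leI)
  also have "\<dots> = (\<integral>\<^sup>+x. norm (f x - clamp m (f x)) \<partial>?B) + (\<integral>\<^sup>+x. norm (clamp m (f x) - clamp m (g n x)) \<partial>?B)"
    by (rule nn_integral_add) measurable
  also have "\<dots> < ennreal (e / 2) + ennreal (e / 2)"
    by (rule add_strict_mono[OF m n])
  also have "\<dots> = ennreal e"
    using e by (simp flip: ennreal_plus)
  finally show thesis
    using that[OF cont'] by blast
qed

text \<open>\<open>f\<close> is compared with a continuous \<open>c\<close> that is close to it in
  \<open>L ^ 1\<close>. A point is good if both the maximal function of the cut-off difference and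
  \<open>\<bar>f x - c x\<bar>\<close> are small there; the weak type estimate and Chebyshev's
  inequality make the exceptional set small. Covering the bad set avoids any question of its
  measurability.\<close>

lemma negligible_not_lebesgue_point:
  fixes f :: "'a::euclidean_space \<Rightarrow> real"
  assumes f: "integrable lebesgue f" and e: "e > 0"
  shows "negligible {x \<in> ball 0 R. \<not> (\<exists>\<delta>>0. \<forall>t. 0 < t \<and> t < \<delta> \<longrightarrow>
    (\<integral>\<^sup>+y\<in>ball x t. ennreal \<bar>f y - f x\<bar> \<partial>lebesgue) \<le> ennreal (e * t ^ DIM('a)))}"
    (is "negligible ?Bad")
  unfolding negligible_outer_le
proof (intro allI impI)
  fix \<epsilon> :: real assume \<epsilon>: "\<epsilon> > 0"
  define n where "n = DIM('a)"
  define V where "V = unit_ball_vol (real DIM('a))"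
  have V: "V > 0"
    by (simp add: V_def)
  obtain C where C: "C > 0"
    "\<And>(h :: 'a \<Rightarrow> ennreal) t. h \<in> borel_measurable lebesgue \<Longrightarrow> t > 0 \<Longrightarrow>
      ennreal t * emeasure lebesgue {x. ennreal t < maximal h x} \<le> ennreal C * (\<integral>\<^sup>+x. h x \<partial>lebesgue)"
    using maximal_weak_type[where 'a = 'a] by blast
  \<comment> \<open>At a good point the normalized oscillation is at most
    \<open>a + 2 * b * V\<close>, which equals \<open>e\<close>.\<close>
  define a where "a = e / 3"
  define b where "b = e / (3 * V)"
  have ab: "a > 0" "b > 0"
    using e V by (auto simp: a_def b_def)
  \<comment> \<open>Solves \<open>C * \<eta> / a + \<eta> / b = \<epsilon>\<close>, where the left
    side bounds the measure of the two exceptional sets.\<close>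
  define \<eta> where "\<eta> = \<epsilon> / (C / a + 1 / b)"
  have \<eta>: "\<eta> > 0"
    using \<epsilon> C(1) ab by (simp add: \<eta>_def add_pos_pos)
  obtain c where c: "continuous_on UNIV c"
    "(\<integral>\<^sup>+x. ennreal \<bar>f x - c x\<bar> \<partial>lebesgue_on (ball 0 (R + 1))) < ennreal \<eta>"
    using continuous_L1_approximation[OF f \<eta>] by blast
  have [measurable]: "f \<in> borel_measurable lebesgue" "c \<in> borel_measurable lebesgue"
    using f c(1) by (auto intro!: measurable_completion borel_measurable_continuous_onI)
  \<comment> \<open>Only balls of radius less than 1 about points of \<open>ball 0 R\<close> will be
    used, so the cut-off at radius \<open>R + 1\<close> does not affect them.\<close>
  define h where "h x = ennreal \<bar>f x - c x\<bar> * indicator (ball 0 (R + 1)) x" for x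
  have h [measurable]: "h \<in> borel_measurable lebesgue"
    unfolding h_def by (intro borel_measurable_times_ennreal borel_measurable_indicator sets_completionI_sets) auto
  have int_h: "(\<integral>\<^sup>+x. h x \<partial>lebesgue) \<le> ennreal \<eta>"
    using c(2) by (simp add: h_def nn_integral_restrict_space)
  let ?S1 = "{x. ennreal a < maximal h x}" and ?S2 = "{x. ennreal b \<le> h x}"
  have sets: "?S1 \<in> sets lebesgue" "?S2 \<in> sets lebesgue"
  proof -
    show "?S1 \<in> sets lebesgue"
      using open_less_maximal[OF h] by (intro sets_completionI_sets) auto
    have "{x \<in> space lebesgue. ennreal b \<le> h x} \<in> sets lebesgue"
      by measurable
    then show "?S2 \<in> sets lebesgue"
      by simp
  qed
  have 1: "emeasure lebesgue ?S1 \<le> ennreal (C * \<eta> / a)"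
  proof -
    have "ennreal a * emeasure lebesgue ?S1 \<le> ennreal C * ennreal \<eta>"
      using C(2)[OF h ab(1)] int_h by (meson mult_left_mono order_trans zero_le)
    also have "\<dots> = ennreal a * ennreal (C * \<eta> / a)"
      using ab C(1) \<eta> by (simp flip: ennreal_mult)
    finally show ?thesis
      using ab(1) by (subst (asm) ennreal_mult_le_mult_iff) auto
  qed
  have 2: "emeasure lebesgue ?S2 \<le> ennreal (\<eta> / b)"
  proof -
    have "ennreal b * emeasure lebesgue ?S2 = (\<integral>\<^sup>+x. ennreal b * indicator ?S2 x \<partial>lebesgue)"
      using sets by (simp add: nn_integral_cmult_indicator del: emeasure_completion)
    also have "\<dots> \<le> (\<integral>\<^sup>+x. h x \<partial>lebesgue)"
      by (intro nn_integral_mono) (auto split: split_indicator)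
    also have "\<dots> \<le> ennreal b * ennreal (\<eta> / b)"
      using int_h ab \<eta> by (simp flip: ennreal_mult)
    finally show ?thesis
      using ab(2) by (subst (asm) ennreal_mult_le_mult_iff) auto
  qed
  have le: "emeasure lebesgue (?S1 \<union> ?S2) \<le> ennreal \<epsilon>"
  proof -
    have "emeasure lebesgue (?S1 \<union> ?S2) \<le> ennreal (C * \<eta> / a) + ennreal (\<eta> / b)"
      by (rule order_trans[OF emeasure_subadditive[OF sets] add_mono[OF 1 2]])
    also have "\<dots> = ennreal (C * \<eta> / a + \<eta> / b)"
      using ab C(1) \<eta> by simp
    also have "C * \<eta> / a + \<eta> / b = \<eta> * (C / a + 1 / b)"
      by (simp add: algebra_simps)
    also have "\<dots> = \<epsilon>"
      using ab C(1) by (simp add: \<eta>_def add_pos_pos less_imp_neq[symmetric])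
    finally show ?thesis .
  qed
  have Bad: "?Bad \<subseteq> ?S1 \<union> ?S2"
  proof (rule ccontr)
    assume "\<not> ?Bad \<subseteq> ?S1 \<union> ?S2"
    then obtain x where x: "x \<in> ?Bad" "x \<notin> ?S1" "x \<notin> ?S2"
      by blast
    then have xR: "norm x < R"
      by simp
    have fc: "\<bar>f x - c x\<bar> < b"
      using x(3) xR ab by (simp add: h_def not_le ennreal_less_iff)
    have "isCont c x"
      using c(1) by (simp add: continuous_on_eq_continuous_at)
    then obtain \<delta> where \<delta>: "\<delta> > 0" "\<And>y. dist y x < \<delta> \<Longrightarrow> dist (c y) (c x) < b"
      using ab(2) unfolding continuous_at_eps_delta by blast
    have "(\<integral>\<^sup>+y\<in>ball x t. ennreal \<bar>f y - f x\<bar> \<partial>lebesgue) \<le> ennreal (e * t ^ n)"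
      if t: "0 < t" "t < min 1 \<delta>" for t
    proof -
      have ball [measurable]: "(\<lambda>y. ennreal k * indicator (ball x t) y) \<in> borel_measurable lebesgue" for k
        by (intro borel_measurable_times_ennreal borel_measurable_const borel_measurable_indicator
            sets_completionI_sets) simp
      have hball: "(\<lambda>y. h y * indicator (ball x t) y) \<in> borel_measurable lebesgue"
        by (intro borel_measurable_times_ennreal h borel_measurable_indicator sets_completionI_sets) simp
      have "(\<integral>\<^sup>+y\<in>ball x t. ennreal \<bar>f y - f x\<bar> \<partial>lebesgue) \<le>
          (\<integral>\<^sup>+y. h y * indicator (ball x t) y + ennreal (2 * b) * indicator (ball x t) y \<partial>lebesgue)"
      proof (rule nn_integral_mono)
        fix y
        show "ennreal \<bar>f y - f x\<bar> * indicator (ball x t) y \<le>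
            h y * indicator (ball x t) y + ennreal (2 * b) * indicator (ball x t) y"
        proof (cases "y \<in> ball x t")
          case True
          then have "norm y < R + 1"
            using xR t norm_triangle_ineq2[of y x] by (simp add: dist_norm norm_minus_commute)
          then have "h y = ennreal \<bar>f y - c y\<bar>"
            by (simp add: h_def)
          moreover have "\<bar>c y - c x\<bar> < b"
            using \<delta>(2)[of y] True t by (simp add: dist_commute dist_real_def)
          then have "\<bar>f y - f x\<bar> \<le> \<bar>f y - c y\<bar> + 2 * b"
            using fc by linarith
          ultimately show ?thesis
            using True ab by (simp flip: ennreal_plus add: ennreal_leI)
        qed simp
      qed
      also have "\<dots> = (\<integral>\<^sup>+y\<in>ball x t. h y \<partial>lebesgue) + ennreal (2 * b) * emeasure lebesgue (ball x t)"
        by (subst nn_integral_add[OF hball ball])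
          (simp add: nn_integral_cmult_indicator del: emeasure_completion)
      also have "\<dots> \<le> ennreal a * ennreal (t ^ n) + ennreal (2 * b) * emeasure lebesgue (ball x t)"
        using x(2) by (intro add_right_mono order_trans[OF ball_integral_le_maximal[OF t(1)]])
          (auto simp: not_less n_def intro: mult_right_mono)
      also have "\<dots> = ennreal (a * t ^ n + 2 * b * (V * t ^ n))"
        using t ab V by (simp add: emeasure_lebesgue_ball n_def V_def ennreal_mult del: emeasure_completion)
      also have "a * t ^ n + 2 * b * (V * t ^ n) = e * t ^ n"
        using V by (simp add: a_def b_def field_simps)
      finally show ?thesis .
    qed
    then have "\<exists>\<delta>>0. \<forall>t. 0 < t \<and> t < \<delta> \<longrightarrow>
        (\<integral>\<^sup>+y\<in>ball x t. ennreal \<bar>f y - f x\<bar> \<partial>lebesgue) \<le> ennreal (e * t ^ DIM('a))"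
      using \<delta>(1) by (intro exI[of _ "min 1 \<delta>"]) (auto simp: n_def)
    with x(1) show False
      by blast
  qed
  have lm: "?S1 \<union> ?S2 \<in> lmeasurable"
    using sets le by (intro fmeasurableI) (auto simp: top_unique intro: le_less_trans)
  moreover have "measure lebesgue (?S1 \<union> ?S2) \<le> \<epsilon>"
    using le \<epsilon> by (simp add: measure_def enn2real_leI)
  ultimately show "\<exists>T. ?Bad \<subseteq> T \<and> T \<in> lmeasurable \<and> measure lebesgue T \<le> \<epsilon>"
    using Bad by blast
qed

theorem lebesgue_differentiation:
  fixes f :: "'a::euclidean_space \<Rightarrow> real"
  assumes f: "integrable lebesgue f"
  shows "AE x in lebesgue. \<forall>e>0. \<exists>\<delta>>0. \<forall>t. 0 < t \<and> t < \<delta> \<longrightarrow>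
    (\<integral>\<^sup>+y\<in>ball x t. ennreal \<bar>f y - f x\<bar> \<partial>lebesgue) \<le> ennreal (e * t ^ DIM('a))"
proof -
  \<comment> \<open>One index controls the radius and the tolerance at once, so countably many
    negligible sets suffice.\<close>
  define Bad where "Bad k = {x \<in> ball 0 (real (Suc k)). \<not> (\<exists>\<delta>>0. \<forall>t. 0 < t \<and> t < \<delta> \<longrightarrow>
    (\<integral>\<^sup>+y\<in>ball x t. ennreal \<bar>f y - f x\<bar> \<partial>lebesgue) \<le> ennreal (inverse (real (Suc k)) * t ^ DIM('a)))}" for k
  have "negligible (Bad k)" for k
    unfolding Bad_def by (rule negligible_not_lebesgue_point[OF f]) simp
  then have "negligible (\<Union>k. Bad k)"
    by (rule negligible_Union_nat)
  then have "(\<Union>k. Bad k) \<in> null_sets lebesgue"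
    by (simp add: negligible_iff_null_sets)
  then show ?thesis
  proof (rule AE_I', intro subsetI)
    fix x
    assume "x \<in> {x \<in> space lebesgue. \<not> (\<forall>e>0. \<exists>\<delta>>0. \<forall>t. 0 < t \<and> t < \<delta> \<longrightarrow>
      (\<integral>\<^sup>+y\<in>ball x t. ennreal \<bar>f y - f x\<bar> \<partial>lebesgue) \<le> ennreal (e * t ^ DIM('a)))}"
    then obtain e where e: "e > 0" and not: "\<not> (\<exists>\<delta>>0. \<forall>t. 0 < t \<and> t < \<delta> \<longrightarrow>
      (\<integral>\<^sup>+y\<in>ball x t. ennreal \<bar>f y - f x\<bar> \<partial>lebesgue) \<le> ennreal (e * t ^ DIM('a)))"
      by blast
    obtain k where k: "inverse (real (Suc k)) < min e (1 / (norm x + 1))"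
      using reals_Archimedean[of "min e (1 / (norm x + 1))"] e
      by (auto simp: add_nonneg_pos)
    then have "inverse (real (Suc k)) < inverse (norm x + 1)"
      by (simp add: inverse_eq_divide)
    then have "norm x + 1 < real (Suc k)"
      by (rule inverse_less_imp_less) simp
    then have "x \<in> ball 0 (real (Suc k))"
      by simp
    moreover have "\<not> (\<exists>\<delta>>0. \<forall>t. 0 < t \<and> t < \<delta> \<longrightarrow>
      (\<integral>\<^sup>+y\<in>ball x t. ennreal \<bar>f y - f x\<bar> \<partial>lebesgue) \<le> ennreal (inverse (real (Suc k)) * t ^ DIM('a)))"
    proof
      assume "\<exists>\<delta>>0. \<forall>t. 0 < t \<and> t < \<delta> \<longrightarrow>
        (\<integral>\<^sup>+y\<in>ball x t. ennreal \<bar>f y - f x\<bar> \<partial>lebesgue) \<le> ennreal (inverse (real (Suc k)) * t ^ DIM('a))"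
      moreover have "ennreal (inverse (real (Suc k)) * t ^ DIM('a)) \<le> ennreal (e * t ^ DIM('a))" if "t > 0" for t
        using that k by (intro ennreal_leI mult_right_mono) auto
      ultimately show False
        using not by (meson order_trans)
    qed
    ultimately show "x \<in> (\<Union>k. Bad k)"
      unfolding Bad_def by blast
  qed
qed


section \<open>A Poincare inequality for pointwise gradients\<close>

text \<open>Near the sphere, \<open>ball q r\<close> may stick out of \<open>ball z \<rho>\<close>.
  Moving \<open>q\<close> towards \<open>z\<close> by the fraction \<open>r / (2 * \<rho>)\<close>
  displaces it by at most \<open>r / 2\<close> and leaves room \<open>r / 2\<close> inside.\<close>

lemma ball_with_comparable_subball:
  fixes z q :: "'a::euclidean_space"
  assumes "q \<in> ball z \<rho>" "0 < r" "r \<le> 2 * \<rho>"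
  obtains q' where "ball q' (r / 2) \<subseteq> ball q r \<inter> ball z \<rho>"
proof
  define a where "a = r / (2 * \<rho>)"
  have \<rho>: "\<rho> > 0"
    using assms(2,3) by linarith
  have a: "0 \<le> a" "a \<le> 1" "a * \<rho> = r / 2"
    using assms \<rho> by (auto simp: a_def)
  have d: "norm (z - q) \<le> \<rho>"
    using assms(1) by (simp add: dist_norm)
  have 1: "dist (q + a *\<^sub>R (z - q)) q \<le> r / 2"
    using a d mult_left_mono[of "norm (z - q)" \<rho> a] by (simp add: dist_norm)
  have "q + a *\<^sub>R (z - q) - z = - ((1 - a) *\<^sub>R (z - q))"
    by (simp add: algebra_simps)
  then have "dist (q + a *\<^sub>R (z - q)) z = (1 - a) * norm (z - q)"
    using a by (simp add: dist_norm)
  also have "\<dots> \<le> (1 - a) * \<rho>"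
    using a d by (intro mult_left_mono) auto
  also have "\<dots> = \<rho> - r / 2"
    using a by (simp add: algebra_simps)
  finally have 2: "dist (q + a *\<^sub>R (z - q)) z \<le> \<rho> - r / 2" .
  show "ball (q + a *\<^sub>R (z - q)) (r / 2) \<subseteq> ball q r \<inter> ball z \<rho>"
    using 1 2 by (simp add: ball_subset_ball_iff)
qed

text \<open>Chebyshev's inequality on the comparable subball of radius \<open>r / 2\<close>: if
  \<open>g\<close> exceeded \<open>\<mu>\<close> on it outside \<open>F\<close>, the integral would
  be at least \<open>\<mu> powr s\<close> times its volume.\<close>

lemma exists_small_value_near:
  fixes g :: "'a::euclidean_space \<Rightarrow> real"
  assumes g: "g \<in> borel_measurable lebesgue" "\<And>x. g x \<ge> 0" and F: "F \<in> null_sets lebesgue"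
    and q: "q \<in> ball z \<rho>" and r: "0 < r" "r \<le> 2 * \<rho>" and s: "s > 0" and \<mu>: "\<mu> > 0"
    and small: "(\<integral>\<^sup>+y\<in>ball z \<rho>. ennreal (g y powr s) \<partial>lebesgue) <
      ennreal (\<mu> powr s * (unit_ball_vol (real DIM('a)) * (r / 2) ^ DIM('a)))"
  obtains y where "y \<in> ball z \<rho>" "dist y q < r" "y \<notin> F" "g y \<le> \<mu>"
proof -
  obtain q' where q': "ball q' (r / 2) \<subseteq> ball q r \<inter> ball z \<rho>"
    using ball_with_comparable_subball[OF q r] by blast
  have "\<exists>y\<in>ball q' (r / 2). y \<notin> F \<and> g y \<le> \<mu>"
  proof (rule ccontr)
    assume "\<not> ?thesis"
    then have big: "\<mu> < g y" if "y \<in> ball q' (r / 2)" "y \<notin> F" for y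
      using that by force
    have "ennreal (\<mu> powr s * (unit_ball_vol (real DIM('a)) * (r / 2) ^ DIM('a))) =
        ennreal (\<mu> powr s) * emeasure lebesgue (ball q' (r / 2))"
      using r by (simp add: emeasure_lebesgue_ball ennreal_mult del: emeasure_completion)
    also have "\<dots> = (\<integral>\<^sup>+y. ennreal (\<mu> powr s) * indicator (ball q' (r / 2)) y \<partial>lebesgue)"
      by (simp add: nn_integral_cmult_indicator del: emeasure_completion)
    also have "\<dots> \<le> (\<integral>\<^sup>+y\<in>ball z \<rho>. ennreal (g y powr s) \<partial>lebesgue)"
    proof (rule nn_integral_mono_AE)
      have "ennreal (\<mu> powr s) * indicator (ball q' (r / 2)) y \<le> ennreal (g y powr s) * indicator (ball z \<rho>) y"
        if "y \<notin> F" for y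
      proof (cases "y \<in> ball q' (r / 2)")
        case True
        then have "y \<in> ball z \<rho>"
          using q' by blast
        then show ?thesis
          using True big[OF True that] \<mu> s by (simp add: ennreal_leI powr_mono2)
      qed simp
      with AE_not_in[OF F] show "AE y in lebesgue. ennreal (\<mu> powr s) * indicator (ball q' (r / 2)) y \<le>
          ennreal (g y powr s) * indicator (ball z \<rho>) y"
        by (auto elim: eventually_mono)
    qed
    finally show False
      using small by simp
  qed
  then obtain y where "y \<in> ball q' (r / 2)" "y \<notin> F" "g y \<le> \<mu>"
    by blast
  moreover from this q' have "y \<in> ball z \<rho>" "y \<in> ball q r"
    by blast+
  ultimately show thesis
    using that[of y] by (simp add: dist_commute)
qed

text \<open>A point of level \<open>2 ^ (k + 1) * \<mu>\<close> has a neighbour of level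
  \<open>2 ^ k * \<mu>\<close> within distance \<open>r k\<close>, so the step changes
  \<open>u\<close> by at most \<open>3 * 2 ^ k * \<mu> * r k\<close>, a multiple of
  \<open>\<rho> * \<mu> * (2 ^ k) powr s\<close>. These increments grow geometrically, hence their
  sum is comparable with the last one, that is with \<open>(g x / \<mu>) powr s\<close>.\<close>

lemma oscillation_of_pointwise_gradient:
  fixes u g :: "'a::euclidean_space \<Rightarrow> real"
  defines "n \<equiv> DIM('a)"
  defines "s \<equiv> real n / (real n + 1)" and "V \<equiv> unit_ball_vol (real n)"
  assumes g: "g \<in> borel_measurable lebesgue" "\<And>x. g x \<ge> 0" and F: "F \<in> null_sets lebesgue"
    and \<rho>: "\<rho> > 0" and \<mu>: "\<mu> > 0"
    and grad: "\<And>x y. x \<in> ball z \<rho> - F \<Longrightarrow> y \<in> ball z \<rho> - F \<Longrightarrow> dist x y \<le> \<rho> / 4 \<Longrightarrow>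
      \<bar>u x - u y\<bar> \<le> dist x y * (g x + g y)"
    and small: "(\<integral>\<^sup>+y\<in>ball z \<rho>. ennreal (g y powr s) \<partial>lebesgue) \<le>
      ennreal (\<mu> powr s * (V * \<rho> ^ n) / (2 * 64 ^ n))"
  obtains c where
    "\<And>x. x \<in> ball z \<rho> - F \<Longrightarrow> \<bar>u x - c\<bar> \<le> 15 * \<rho> * \<mu> * (1 + 2 * (g x / \<mu>) powr s)"
proof -
  have n: "n > 0"
    by (simp add: n_def)
  have s: "1 / 2 \<le> s" "s < 1" "real n * (1 - s) = s"
    using n by (auto simp: s_def field_simps)
  have V: "V > 0"
    by (simp add: V_def)
  \<comment> \<open>As \<open>n * (1 - s) = s\<close>, volumes of balls of radius \<open>r k\<close>
    shrink like \<open>(2 ^ k) powr (- s)\<close> and balance \<open>(2 ^ k * \<mu>) powr s\<close>,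
    so one smallness hypothesis serves all levels. The subball has radius \<open>r k / 2\<close>,
    whence \<open>64 ^ n\<close>; the extra 2 in the hypothesis makes the comparison strict.\<close>
  define r where "r k = \<rho> * (2 ^ k) powr (s - 1) / 32" for k :: nat
  have r: "0 < r k" "r k \<le> \<rho> / 32" for k
  proof -
    have "((2::real) ^ k) powr (s - 1) \<le> (2 ^ k) powr 0"
      using s by (intro powr_mono) auto
    then show "0 < r k" "r k \<le> \<rho> / 32"
      using \<rho> by (auto simp: r_def)
  qed
  have near: "\<exists>y. y \<in> ball z \<rho> - F \<and> dist y q < r k \<and> g y \<le> 2 ^ k * \<mu>" if q: "q \<in> ball z \<rho>" for q k
  proof -
    have "(2 ^ k * \<mu>) powr s * (V * (r k / 2) ^ n) = \<mu> powr s * (V * \<rho> ^ n) / 64 ^ n"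
    proof -
      have "((2 ^ k) powr (s - 1)) ^ n = ((2::real) ^ k) powr (real n * (s - 1))"
        by (simp add: powr_powr mult_ac flip: powr_realpow)
      also have "real n * (s - 1) = - s"
        using s(3) by (simp add: algebra_simps)
      finally have "(2 ^ k) powr s * ((2 ^ k) powr (s - 1)) ^ n = (1::real)"
        by (simp flip: powr_add)
      then have "((2 ^ k) powr s * ((2 ^ k) powr (s - 1)) ^ n) * (\<mu> powr s * (V * \<rho> ^ n) / 64 ^ n) =
          \<mu> powr s * (V * \<rho> ^ n) / 64 ^ n"
        by simp
      then show ?thesis
        using \<mu> by (simp add: r_def powr_mult power_mult_distrib power_divide mult_ac)
    qed
    moreover have "\<mu> powr s * (V * \<rho> ^ n) / (2 * 64 ^ n) < \<mu> powr s * (V * \<rho> ^ n) / 64 ^ n"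
      using \<mu> V \<rho> by (simp add: field_simps)
    ultimately have "(\<integral>\<^sup>+y\<in>ball z \<rho>. ennreal (g y powr s) \<partial>lebesgue) <
        ennreal ((2 ^ k * \<mu>) powr s * (V * (r k / 2) ^ n))"
      using small \<mu> V \<rho> by (auto intro!: le_less_trans[OF small] ennreal_lessI)
    then obtain y where "y \<in> ball z \<rho>" "dist y q < r k" "y \<notin> F" "g y \<le> 2 ^ k * \<mu>"
      using exists_small_value_near[OF g F q, of "r k" s "2 ^ k * \<mu>"] r[of k] s \<mu> \<rho>
      unfolding n_def V_def by auto
    then show ?thesis
      by blast
  qed
  obtain x0 where x0: "x0 \<in> ball z \<rho> - F" "g x0 \<le> \<mu>"
    using near[of z 0] \<rho> by auto
  have base: "\<bar>u x - u x0\<bar> \<le> 9 * \<rho> * \<mu>" if x: "x \<in> ball z \<rho> - F" "g x \<le> \<mu>" for x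
  proof -
    \<comment> \<open>The segment is shorter than \<open>2 * \<rho>\<close>, so its 16 pieces have
      length at most \<open>\<rho> / 8\<close>. With two corrections of at most
      \<open>\<rho> / 32\<close>, consecutive chain points stay within
      \<open>\<rho> / 4\<close>.\<close>
    define q where "q i = (1 - real i / 16) *\<^sub>R x + (real i / 16) *\<^sub>R x0" for i
    have q_in: "q i \<in> ball z \<rho>" if "i \<le> 16" for i
      unfolding q_def using that x(1) x0(1) by (intro convexD[OF convex_ball]) auto
    have "dist x x0 < 2 * \<rho>"
      using x(1) x0(1) dist_triangle[of x x0 z] by (simp add: dist_commute)
    then have q_dist: "dist (q i) (q (Suc i)) \<le> \<rho> / 8" for i
    proof -
      have "q i - q (Suc i) = (real (Suc i) / 16 - real i / 16) *\<^sub>R (x - x0)"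
        unfolding q_def by (simp add: algebra_simps del: of_nat_Suc)
      also have "real (Suc i) / 16 - real i / 16 = 1 / 16"
        by (simp add: add_divide_distrib)
      finally have "q i - q (Suc i) = (1 / 16) *\<^sub>R (x - x0)" .
      then show ?thesis
        using \<open>dist x x0 < 2 * \<rho>\<close> by (simp add: dist_norm)
    qed
    have step: "\<bar>u y - u y'\<bar> \<le> \<rho> * \<mu> / 2"
      if "y \<in> ball z \<rho> - F" "y' \<in> ball z \<rho> - F" "g y \<le> \<mu>" "g y' \<le> \<mu>" "dist y y' \<le> \<rho> / 4" for y y'
    proof -
      have "\<bar>u y - u y'\<bar> \<le> dist y y' * (g y + g y')"
        using grad that by blast
      also have "\<dots> \<le> \<rho> / 4 * (2 * \<mu>)"
        using that g(2) \<rho> by (intro mult_mono) (auto intro: add_nonneg_nonneg)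
      finally show ?thesis
        by (simp add: mult.commute)
    qed
    have "\<exists>y\<in>ball z \<rho> - F. g y \<le> \<mu> \<and> dist y (q i) \<le> \<rho> / 32 \<and> \<bar>u x - u y\<bar> \<le> real i * (\<rho> * \<mu> / 2)"
      if "i \<le> 16" for i
      using that
    proof (induction i)
      case 0
      then show ?case
        using x \<rho> by (intro bexI[of _ x]) (auto simp: q_def)
    next
      case (Suc i)
      then obtain y where y: "y \<in> ball z \<rho> - F" "g y \<le> \<mu>" "dist y (q i) \<le> \<rho> / 32"
        "\<bar>u x - u y\<bar> \<le> real i * (\<rho> * \<mu> / 2)"
        by auto
      obtain y' where y': "y' \<in> ball z \<rho> - F" "dist y' (q (Suc i)) < r 0" "g y' \<le> \<mu>"
        using near[OF q_in[OF Suc.prems], of 0] by auto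
      have "dist y y' \<le> dist y (q i) + dist (q i) (q (Suc i)) + dist y' (q (Suc i))"
        using dist_triangle[of y y' "q i"] dist_triangle[of "q i" y' "q (Suc i)"]
        by (simp add: dist_commute)
      also have "\<dots> \<le> \<rho> / 4"
        using y(3) q_dist[of i] y'(2) r(2)[of 0] \<rho> by simp
      finally have "\<bar>u y - u y'\<bar> \<le> \<rho> * \<mu> / 2"
        using y y' by (intro step) auto
      moreover have "real (Suc i) * (\<rho> * \<mu> / 2) = real i * (\<rho> * \<mu> / 2) + \<rho> * \<mu> / 2"
        by (simp add: algebra_simps)
      ultimately have "\<bar>u x - u y'\<bar> \<le> real (Suc i) * (\<rho> * \<mu> / 2)"
        using y(4) by linarith
      then show ?case
        using y' r(2)[of 0] by (intro bexI[of _ y']) auto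
    qed
    moreover have "q 16 = x0"
      by (simp add: q_def)
    ultimately obtain y where y: "y \<in> ball z \<rho> - F" "g y \<le> \<mu>" "dist y x0 \<le> \<rho> / 32"
        "\<bar>u x - u y\<bar> \<le> real 16 * (\<rho> * \<mu> / 2)"
      by (metis order_refl)
    \<comment> \<open>The chain ends near \<open>x0\<close>, not at it. One further step makes 17 of
      them, each costing at most \<open>\<rho> * \<mu> / 2\<close>, and
      \<open>17 / 2 \<le> 9\<close>.\<close>
    then have "\<bar>u y - u x0\<bar> \<le> \<rho> * \<mu> / 2"
      using x0 \<rho> by (intro step) auto
    moreover have "\<bar>u x - u y\<bar> \<le> 8 * (\<rho> * \<mu>)"
      using y(4) by (simp add: mult.commute)
    moreover have "0 \<le> \<rho> * \<mu>" "9 * \<rho> * \<mu> = 9 * (\<rho> * \<mu>)"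
      using \<rho> \<mu> by auto
    ultimately show ?thesis
      by linarith
  qed
  \<comment> \<open>Since \<open>s \<ge> 1 / 2\<close>, going up one level multiplies the claimed
    bound by at least 7/5, and \<open>15 + 3 / 32 \<le> 15 * (7 / 5)\<close> absorbs the
    increment.\<close>
  have pow: "7 / 5 \<le> 2 powr s"
  proof -
    have "7 / 5 \<le> sqrt 2"
      by (rule real_le_rsqrt) (simp add: power2_eq_square)
    also have "\<dots> \<le> 2 powr s"
      using s(1) powr_mono[of "1 / 2" s 2] by (simp add: powr_half_sqrt)
    finally show ?thesis .
  qed
  have level: "\<bar>u x - u x0\<bar> \<le> 15 * \<rho> * \<mu> * (2 ^ k) powr s"
    if "x \<in> ball z \<rho> - F" "g x \<le> 2 ^ k * \<mu>" for x k
    using that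
  proof (induction k arbitrary: x)
    case 0
    moreover have "\<rho> * \<mu> \<ge> 0"
      using \<rho> \<mu> by simp
    ultimately show ?case
      using base[of x] by simp
  next
    case (Suc k)
    obtain y where y: "y \<in> ball z \<rho> - F" "dist y x < r k" "g y \<le> 2 ^ k * \<mu>"
      using near[of x k] Suc.prems(1) by auto
    have "\<bar>u x - u y\<bar> \<le> dist x y * (g x + g y)"
      using Suc.prems(1) y r(2)[of k] \<rho> by (intro grad) (auto simp: dist_commute)
    also have "\<dots> \<le> r k * (3 * (2 ^ k * \<mu>))"
      using y Suc.prems(2) g(2) r(1)[of k] by (intro mult_mono) (auto simp: dist_commute intro: add_nonneg_nonneg)
    also have "\<dots> = 3 / 32 * \<rho> * \<mu> * (2 ^ k * (2 ^ k) powr (s - 1))"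
      by (simp add: r_def)
    also have "2 ^ k * (2 ^ k) powr (s - 1) = ((2::real) ^ k) powr s"
      using powr_add[of "(2::real) ^ k" 1 "s - 1"] by simp
    finally have "\<bar>u x - u x0\<bar> \<le> 15 * \<rho> * \<mu> * (2 ^ k) powr s + 3 / 32 * \<rho> * \<mu> * (2 ^ k) powr s"
      using Suc.IH[OF y(1,3)] by linarith
    also have "\<dots> \<le> 15 * \<rho> * \<mu> * ((2 ^ k) powr s * (7 / 5))"
      using \<rho> \<mu> by simp
    also have "\<dots> \<le> 15 * \<rho> * \<mu> * ((2 ^ k) powr s * 2 powr s)"
      using \<rho> \<mu> pow by (intro mult_left_mono) auto
    also have "(2 ^ k) powr s * 2 powr s = ((2::real) ^ Suc k) powr s"
      by (simp add: powr_mult mult.commute)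
    finally show ?case .
  qed
  show thesis
  proof
    fix x assume x: "x \<in> ball z \<rho> - F"
    have ex: "\<exists>k. g x \<le> 2 ^ k * \<mu>"
      using real_arch_pow[of 2 "g x / \<mu>"] \<mu> by (auto simp: field_simps intro: less_imp_le)
    \<comment> \<open>By minimality either \<open>k = 0\<close>, which the summand 1 covers, or
      \<open>2 ^ k * \<mu> < 2 * g x\<close>.\<close>
    define k where "k = (LEAST k. g x \<le> 2 ^ k * \<mu>)"
    have k: "g x \<le> 2 ^ k * \<mu>"
      unfolding k_def using ex by (rule LeastI_ex)
    have "(2 ^ k) powr s \<le> 1 + 2 * (g x / \<mu>) powr s"
    proof (cases k)
      case (Suc l)
      then have "\<not> g x \<le> 2 ^ l * \<mu>"
        using not_less_Least[of l "\<lambda>k. g x \<le> 2 ^ k * \<mu>"] by (simp add: k_def)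
      then have "2 ^ k \<le> 2 * (g x / \<mu>)"
        using \<mu> Suc by (simp add: field_simps)
      then have "(2 ^ k) powr s \<le> (2 * (g x / \<mu>)) powr s"
        using s by (intro powr_mono2) auto
      also have "\<dots> = 2 powr s * (g x / \<mu>) powr s"
        by (rule powr_mult)
      also have "\<dots> \<le> 2 * (g x / \<mu>) powr s"
        using s powr_mono[of s 1 2] by (intro mult_right_mono) auto
      finally show ?thesis
        by simp
    qed simp
    then have "15 * \<rho> * \<mu> * (2 ^ k) powr s \<le> 15 * \<rho> * \<mu> * (1 + 2 * (g x / \<mu>) powr s)"
      using \<rho> \<mu> by (intro mult_left_mono) auto
    with level[OF x k] show "\<bar>u x - u x0\<bar> \<le> 15 * \<rho> * \<mu> * (1 + 2 * (g x / \<mu>) powr s)"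
      by linarith
  qed
qed

text \<open>The pointwise oscillation bound is integrated. Its constant part contributes 15 and the
  part with \<open>g powr s\<close> at most 30, because the smallness hypothesis cancels the
  division by \<open>\<mu> powr s\<close>.\<close>

lemma poincare_pointwise_gradient:
  fixes u g :: "'a::euclidean_space \<Rightarrow> real"
  defines "n \<equiv> DIM('a)"
  defines "s \<equiv> real n / (real n + 1)" and "V \<equiv> unit_ball_vol (real n)"
  assumes g: "g \<in> borel_measurable lebesgue" "\<And>x. g x \<ge> 0" and F: "F \<in> null_sets lebesgue"
    and \<rho>: "\<rho> > 0" and \<mu>: "\<mu> > 0"
    and grad: "\<And>x y. x \<in> ball z \<rho> - F \<Longrightarrow> y \<in> ball z \<rho> - F \<Longrightarrow> dist x y \<le> \<rho> / 4 \<Longrightarrow>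
      \<bar>u x - u y\<bar> \<le> dist x y * (g x + g y)"
    and small: "(\<integral>\<^sup>+y\<in>ball z \<rho>. ennreal (g y powr s) \<partial>lebesgue) \<le>
      ennreal (\<mu> powr s * (V * \<rho> ^ n) / (2 * 64 ^ n))"
  obtains c where "(\<integral>\<^sup>+y\<in>ball z \<rho>. ennreal \<bar>u y - c\<bar> \<partial>lebesgue) \<le> ennreal (45 * V * \<mu> * \<rho> ^ (n + 1))"
proof -
  obtain c where c:
    "\<And>x. x \<in> ball z \<rho> - F \<Longrightarrow> \<bar>u x - c\<bar> \<le> 15 * \<rho> * \<mu> * (1 + 2 * (g x / \<mu>) powr s)"
    using oscillation_of_pointwise_gradient[OF g F \<rho> \<mu> grad small[unfolded s_def n_def V_def]]
    unfolding s_def n_def by blast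
  have V: "V > 0"
    by (simp add: V_def)
  define A where "A = 15 * \<rho> * \<mu>"
  define B where "B = 30 * \<rho> * \<mu> / \<mu> powr s"
  have AB: "A > 0" "B > 0"
    using \<rho> \<mu> by (auto simp: A_def B_def)
  have [measurable]: "(\<lambda>y. ennreal (g y powr s) * indicator (ball z \<rho>) y) \<in> borel_measurable lebesgue"
  proof -
    have "(\<lambda>y. ennreal (g y powr s)) \<in> borel_measurable lebesgue"
      using g(1) by measurable
    then show ?thesis
      by (intro borel_measurable_times_ennreal borel_measurable_indicator sets_completionI_sets) auto
  qed
  have [measurable]: "(\<lambda>y. ennreal A * indicator (ball z \<rho>) y) \<in> borel_measurable lebesgue"
    by (intro borel_measurable_times_ennreal borel_measurable_const borel_measurable_indicator
        sets_completionI_sets) auto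
  have "(\<integral>\<^sup>+y\<in>ball z \<rho>. ennreal \<bar>u y - c\<bar> \<partial>lebesgue) \<le>
      (\<integral>\<^sup>+y. ennreal A * indicator (ball z \<rho>) y +
        ennreal B * (ennreal (g y powr s) * indicator (ball z \<rho>) y) \<partial>lebesgue)"
  proof (rule nn_integral_mono_AE)
    have "ennreal \<bar>u y - c\<bar> * indicator (ball z \<rho>) y \<le> ennreal A * indicator (ball z \<rho>) y +
        ennreal B * (ennreal (g y powr s) * indicator (ball z \<rho>) y)" if "y \<notin> F" for y
    proof (cases "y \<in> ball z \<rho>")
      case True
      then have "\<bar>u y - c\<bar> \<le> 15 * \<rho> * \<mu> * (1 + 2 * (g y / \<mu>) powr s)"
        using c that by blast
      also have "\<dots> = A + B * g y powr s"
        using g(2)[of y] \<mu> by (simp add: A_def B_def powr_divide algebra_simps)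
      finally show ?thesis
        using True AB by (simp add: ennreal_leI flip: ennreal_plus ennreal_mult)
    qed simp
    with AE_not_in[OF F] show "AE y in lebesgue. ennreal \<bar>u y - c\<bar> * indicator (ball z \<rho>) y \<le>
        ennreal A * indicator (ball z \<rho>) y + ennreal B * (ennreal (g y powr s) * indicator (ball z \<rho>) y)"
      by (auto elim: eventually_mono)
  qed
  also have "\<dots> = (\<integral>\<^sup>+y. ennreal A * indicator (ball z \<rho>) y \<partial>lebesgue) +
      (\<integral>\<^sup>+y. ennreal B * (ennreal (g y powr s) * indicator (ball z \<rho>) y) \<partial>lebesgue)"
    by (rule nn_integral_add) measurable
  also have "(\<integral>\<^sup>+y. ennreal B * (ennreal (g y powr s) * indicator (ball z \<rho>) y) \<partial>lebesgue) =
      ennreal B * (\<integral>\<^sup>+y\<in>ball z \<rho>. ennreal (g y powr s) \<partial>lebesgue)"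
    by (rule nn_integral_cmult) measurable
  also have "(\<integral>\<^sup>+y. ennreal A * indicator (ball z \<rho>) y \<partial>lebesgue) = ennreal (A * (V * \<rho> ^ n))"
    using AB \<rho> by (simp add: nn_integral_cmult_indicator emeasure_lebesgue_ball V_def n_def ennreal_mult
        del: emeasure_completion)
  also have "ennreal (A * (V * \<rho> ^ n)) + ennreal B * (\<integral>\<^sup>+y\<in>ball z \<rho>. ennreal (g y powr s) \<partial>lebesgue) \<le>
      ennreal (A * (V * \<rho> ^ n)) + ennreal B * ennreal (\<mu> powr s * (V * \<rho> ^ n) / (2 * 64 ^ n))"
    by (intro add_left_mono mult_left_mono small) auto
  also have "\<dots> = ennreal (A * (V * \<rho> ^ n) + B * (\<mu> powr s * (V * \<rho> ^ n) / (2 * 64 ^ n)))"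
    using AB V \<rho> by (simp flip: ennreal_mult ennreal_plus)
  also have "\<dots> \<le> ennreal (45 * V * \<mu> * \<rho> ^ (n + 1))"
  proof (rule ennreal_leI)
    have "B * (\<mu> powr s * (V * \<rho> ^ n) / (2 * 64 ^ n)) = 30 * \<rho> * \<mu> * (V * \<rho> ^ n) / (2 * 64 ^ n)"
      using \<mu> by (simp add: B_def)
    also have "\<dots> \<le> 30 * \<rho> * \<mu> * (V * \<rho> ^ n) / 1"
      using V \<rho> \<mu> by (intro divide_left_mono) (auto intro: order_trans[OF one_le_power[of 64 n]])
    finally show "A * (V * \<rho> ^ n) + B * (\<mu> powr s * (V * \<rho> ^ n) / (2 * 64 ^ n)) \<le> 45 * V * \<mu> * \<rho> ^ (n + 1)"
      by (simp add: A_def algebra_simps)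
  qed
  finally show thesis
    by (rule that)
qed


section \<open>Locally integrable functions as distributions\<close>

lemma test_functions_measurable: "\<phi> \<in> test_functions A \<Longrightarrow> \<phi> \<in> borel_measurable lebesgue"
  by (intro measurable_completion)
    (auto simp: test_functions_def intro!: borel_measurable_continuous_onI smooth_imp_continuous)

lemma integrable_mult_bounded:
  fixes v \<phi> :: "'a \<Rightarrow> real"
  assumes "integrable M v" "\<phi> \<in> borel_measurable M" "\<And>x. \<bar>\<phi> x\<bar> \<le> K"
  shows "integrable M (\<lambda>x. v x * \<phi> x)"
proof (rule Bochner_Integration.integrable_bound[where f = "\<lambda>x. K * v x"])
  have "K \<ge> 0"
    using assms(3)[of undefined] by linarith
  then show "AE x in M. norm (v x * \<phi> x) \<le> norm (K * v x)"
    using assms(3) by (auto simp: abs_mult mult.commute intro!: mult_right_mono AE_I2)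
qed (use assms in auto)

lemma integrable_mult_test_function:
  assumes "integrable lebesgue v" "\<phi> \<in> test_functions A"
  shows "integrable lebesgue (\<lambda>x. v x * \<phi> x)"
proof -
  obtain K where "\<And>x. \<bar>\<phi> x\<bar> \<le> K"
    using test_functions_bounded[OF assms(2)] by (auto simp: bounded_iff)
  then show ?thesis
    using integrable_mult_bounded[OF assms(1) test_functions_measurable[OF assms(2)]] by blast
qed

lemma integrable_indicator_compact:
  fixes K :: "'a::euclidean_space set"
  assumes "compact K"
  shows "integrable lebesgue (indicat_real K)"
  using lmeasurable_compact[OF assms] by (simp add: fmeasurable_def less_top[symmetric] del: emeasure_completion)

lemma integrable_test_function:
  assumes "\<phi> \<in> test_functions A"
  shows "integrable lebesgue \<phi>"
proof -
  have "compact (support \<phi>)"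
    using assms by (simp add: test_functions_def)
  then have "integrable lebesgue (\<lambda>x. indicat_real (support \<phi>) x * \<phi> x)"
    by (rule integrable_mult_test_function[OF integrable_indicator_compact assms])
  moreover have "(\<lambda>x. indicat_real (support \<phi>) x * \<phi> x) = \<phi>"
    using zero_outside_support[of _ \<phi>] by (auto simp: fun_eq_iff indicator_def)
  ultimately show ?thesis
    by simp
qed

text \<open>The integral of a translate along the axis \<open>j\<close> does not depend on the
  shift; differentiating this constant under the integral sign gives the claim.\<close>

lemma integral_partial_deriv_test_function:
  fixes \<phi> :: "real^'n::finite \<Rightarrow> real"
  assumes \<phi>: "\<phi> \<in> test_functions A"
  shows "(\<integral>x. partial_deriv j \<phi> x \<partial>lebesgue) = 0"
proof -
  \<comment> \<open>All points that a shift by at most 1 moves into the support. A multiple of its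
    indicator is the integrable majorant.\<close>
  define S where "S = (\<lambda>(x, t). x - t *\<^sub>R axis j 1) ` (support \<phi> \<times> cball 0 (1::real))"
  have smooth: "smooth \<phi>" and supp: "compact (support \<phi>)"
    using \<phi> by (auto simp: test_functions_def)
  have S: "compact S"
    unfolding S_def using supp
    by (intro compact_continuous_image compact_Times) (auto simp: case_prod_beta intro!: continuous_intros)
  have \<phi>': "partial_deriv j \<phi> \<in> test_functions A"
    by (rule test_functions_partial_deriv[OF \<phi>])
  obtain K where K: "\<And>x. \<bar>partial_deriv j \<phi> x\<bar> \<le> K"
    using test_functions_bounded[OF \<phi>'] by (auto simp: bounded_iff)
  have meas: "(\<lambda>x. f (x + t *\<^sub>R axis j 1)) \<in> borel_measurable lborel" if "f \<in> test_functions A" for f t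
    using that by (auto simp: test_functions_def
        intro!: borel_measurable_continuous_onI continuous_on_compose2[OF smooth_imp_continuous[of f UNIV]] continuous_intros)
  have shift: "(\<integral>x. f (x + t *\<^sub>R axis j 1) \<partial>lborel) = (\<integral>x. f x \<partial>lborel)"
    "integrable lborel (\<lambda>x. f (x + t *\<^sub>R axis j 1)) \<longleftrightarrow> integrable lborel f"
    if f: "f \<in> test_functions A" for f t
  proof -
    have [measurable]: "f \<in> borel_measurable borel"
      using f by (auto simp: test_functions_def intro!: borel_measurable_continuous_onI smooth_imp_continuous)
    have "(\<integral>x. f x \<partial>distr lborel borel ((+) (t *\<^sub>R axis j 1))) = (\<integral>x. f (x + t *\<^sub>R axis j 1) \<partial>lborel)"
      by (subst integral_distr) (auto simp: add.commute)
    then show "(\<integral>x. f (x + t *\<^sub>R axis j 1) \<partial>lborel) = (\<integral>x. f x \<partial>lborel)"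
      by (simp add: lborel_distr_plus)
    have "integrable (distr lborel borel ((+) (t *\<^sub>R axis j 1))) f \<longleftrightarrow>
        integrable lborel (\<lambda>x. f (x + t *\<^sub>R axis j 1))"
      by (subst integrable_distr_eq) (auto simp: add.commute)
    then show "integrable lborel (\<lambda>x. f (x + t *\<^sub>R axis j 1)) \<longleftrightarrow> integrable lborel f"
      by (simp add: lborel_distr_plus)
  qed
  have int: "integrable lborel f" if f: "f \<in> test_functions A" for f
    using integrable_test_function[OF f] meas[OF f, of 0] by (simp add: integrable_completion)
  have "((\<lambda>t. \<integral>x. \<phi> (x + t *\<^sub>R axis j 1) \<partial>lborel) has_real_derivative
      (\<integral>x. partial_deriv j \<phi> (x + 0 *\<^sub>R axis j 1) \<partial>lborel)) (at 0)"
  proof (rule has_real_derivative_integral_dominated[where d = 1 and w = "\<lambda>x. K * indicator S x"])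
    show "integrable lborel (\<lambda>x. \<phi> (x + t *\<^sub>R axis j 1))" for t
      using shift(2)[OF \<phi>] int[OF \<phi>] by simp
    show "((\<lambda>t. \<phi> (x + t *\<^sub>R axis j 1)) has_real_derivative partial_deriv j \<phi> (x + t *\<^sub>R axis j 1)) (at t)" for t x
    proof -
      have "((\<lambda>t. \<phi> (x + t *\<^sub>R axis j 1)) has_derivative
          (\<lambda>h. \<Sum>i\<in>UNIV. (h *\<^sub>R axis j 1) $ i * partial_deriv i \<phi> (x + t *\<^sub>R axis j 1))) (at t)"
        by (rule has_derivative_compose[where f = "\<lambda>t. x + t *\<^sub>R axis j 1" and g = \<phi>])
          (auto intro!: derivative_eq_intros has_derivative_partial_deriv smooth_imp_differentiable[OF smooth])
      moreover have "(\<lambda>h. \<Sum>i\<in>UNIV. (h *\<^sub>R axis j 1) $ i * partial_deriv i \<phi> (x + t *\<^sub>R axis j 1)) =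
          (*) (partial_deriv j \<phi> (x + t *\<^sub>R axis j 1))"
        by (simp add: fun_eq_iff axis_def if_distrib[of "\<lambda>a. _ * a * _"] if_distribR sum.If_cases
            if_distrib[of "\<lambda>a. a * _"] mult.commute cong: if_cong)
      ultimately show ?thesis
        by (simp add: has_field_derivative_def)
    qed
    show "\<bar>partial_deriv j \<phi> (x + t *\<^sub>R axis j 1)\<bar> \<le> K * indicator S x" if t: "t \<in> ball 0 1" for t x
    proof (cases "x + t *\<^sub>R axis j 1 \<in> support \<phi>")
      case True
      then have "(x + t *\<^sub>R axis j 1, t) \<in> support \<phi> \<times> cball 0 1"
        using t by auto
      then have "x \<in> S"
        unfolding S_def by (rule rev_image_eqI) simp
      then show ?thesis
        using K by simp
    next
      case False
      then show ?thesis
        using K[of 0] by (auto simp: partial_deriv_outside_support)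
    qed
    show "integrable lborel (\<lambda>x. K * indicator S x)"
      using S emeasure_bounded_finite[OF compact_imp_bounded[OF S]]
      by (intro integrable_mult_right integrable_real_indicator) (auto intro: borel_compact)
  qed (use meas[OF \<phi>', of 0] in auto)
  moreover have "(\<lambda>t. \<integral>x. \<phi> (x + t *\<^sub>R axis j 1) \<partial>lborel) = (\<lambda>t. \<integral>x. \<phi> x \<partial>lborel)"
    using shift(1)[OF \<phi>] by simp
  ultimately have "((\<lambda>t. \<integral>x. \<phi> x \<partial>lborel) has_real_derivative (\<integral>x. partial_deriv j \<phi> x \<partial>lborel)) (at 0)"
    by simp
  then have "(\<integral>x. partial_deriv j \<phi> x \<partial>lborel) = 0"
    using DERIV_unique[OF _ DERIV_const] by blast
  then show ?thesis
    using meas[OF \<phi>', of 0] by (simp add: integral_completion)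
qed

lemma integrable_indicator_locally_integrable:
  assumes "locally_integrable \<Omega> u" "compact K" "K \<subseteq> \<Omega>"
  shows "integrable lebesgue (\<lambda>x. indicator K x * u x)"
  using assms by (simp add: locally_integrable_def set_integrable_def)

text \<open>Trades \<open>u\<close> on \<Omega> for its cut-off to \<open>K\<close>, which is
  integrable on the whole space when \<open>K\<close> is compact and \<open>u\<close> locally
  integrable.\<close>

lemma function_distr_eq:
  assumes "open \<Omega>" "K \<subseteq> \<Omega>" "\<And>x. x \<notin> K \<Longrightarrow> \<phi> x = 0"
  shows "function_distr \<Omega> u \<phi> = (\<integral>x. indicator K x * u x * \<phi> x \<partial>lebesgue)"
proof -
  have "function_distr \<Omega> u \<phi> = (\<integral>x. indicator \<Omega> x *\<^sub>R (u x * \<phi> x) \<partial>lebesgue)"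
    unfolding function_distr_def using assms(1) by (intro integral_restrict_space) auto
  also have "\<dots> = (\<integral>x. indicator K x * u x * \<phi> x \<partial>lebesgue)"
    using assms(2,3) by (intro Bochner_Integration.integral_cong) (auto simp: indicator_def)
  finally show ?thesis .
qed

lemma distribution_distr_deriv:
  fixes u :: "real^'n::finite \<Rightarrow> real"
  assumes \<Omega>: "open \<Omega>" and u: "locally_integrable \<Omega> u"
  shows "distribution \<Omega> (distr_deriv j (function_distr \<Omega> u))"
  unfolding distribution_def
proof (intro conjI ballI allI impI)
  let ?T = "distr_deriv j (function_distr \<Omega> u)"
  have eq: "?T \<phi> = - (\<integral>x. indicator K x * u x * partial_deriv j \<phi> x \<partial>lebesgue)"
    if "\<phi> \<in> test_functions \<Omega>" "support \<phi> \<subseteq> K" "K \<subseteq> \<Omega>" for \<phi> K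
    unfolding distr_deriv_def using that \<Omega>
    by (subst function_distr_eq[where K = K]) (auto intro: partial_deriv_outside_support dest: subsetD)
  have int: "integrable lebesgue (\<lambda>x. indicator K x * u x * partial_deriv j \<phi> x)"
    if "\<phi> \<in> test_functions \<Omega>" "compact K" "K \<subseteq> \<Omega>" for \<phi> K
    using that by (intro integrable_mult_test_function[where A = \<Omega>] test_functions_partial_deriv
        integrable_indicator_locally_integrable[OF u])
  have diff: "\<phi> differentiable (at x)" if "\<phi> \<in> test_functions \<Omega>" for \<phi> x
    using that by (auto simp: test_functions_def intro: smooth_imp_differentiable)
  fix \<phi> assume \<phi>: "\<phi> \<in> test_functions \<Omega>"
  define K where "K = support \<phi>"
  have K: "compact K" "K \<subseteq> \<Omega>"
    using \<phi> by (auto simp: K_def test_functions_def)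
  {
    fix \<psi> assume \<psi>: "\<psi> \<in> test_functions \<Omega>"
    \<comment> \<open>A common compact set for both functions and their sum, so that the integrals
      can be added.\<close>
    define L where "L = support \<phi> \<union> support \<psi>"
    have L: "compact L" "L \<subseteq> \<Omega>"
      using \<phi> \<psi> by (auto simp: L_def test_functions_def)
    have supp: "support (\<lambda>x. \<phi> x + \<psi> x) \<subseteq> L"
      by (rule support_subsetI)
        (auto simp: L_def closed_support zero_outside_support[of _ \<phi>] zero_outside_support[of _ \<psi>])
    have "compact (support (\<lambda>x. \<phi> x + \<psi> x))"
      using compact_Int_closed[OF L(1) closed_support, of "\<lambda>x. \<phi> x + \<psi> x"] by (simp add: Int_absorb1[OF supp])
    then have sum: "(\<lambda>x. \<phi> x + \<psi> x) \<in> test_functions \<Omega>"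
      using \<phi> \<psi> supp L(2) by (auto simp: test_functions_def smooth_add)
    have deriv: "partial_deriv j (\<lambda>x. \<phi> x + \<psi> x) = (\<lambda>x. partial_deriv j \<phi> x + partial_deriv j \<psi> x)"
      by (intro ext partial_deriv_add diff \<phi> \<psi>)
    have "?T (\<lambda>x. \<phi> x + \<psi> x) = - (\<integral>x. indicator L x * u x * partial_deriv j \<phi> x +
        indicator L x * u x * partial_deriv j \<psi> x \<partial>lebesgue)"
      unfolding eq[OF sum supp L(2)] deriv by (simp add: algebra_simps)
    also have "\<dots> = ?T \<phi> + ?T \<psi>"
      using int[OF \<phi> L] int[OF \<psi> L] \<phi> \<psi> L by (simp add: eq[of _ L] L_def)
    finally show "?T (\<lambda>x. \<phi> x + \<psi> x) = ?T \<phi> + ?T \<psi>" .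
  }
  fix c :: real
  have "support (\<lambda>x. c * \<phi> x) \<subseteq> K"
    unfolding K_def by (rule support_subsetI) (auto simp: closed_support zero_outside_support[of _ \<phi>])
  moreover have "partial_deriv j (\<lambda>x. c * \<phi> x) = (\<lambda>x. c * partial_deriv j \<phi> x)"
    by (intro ext partial_deriv_cmult diff \<phi>)
  ultimately show "?T (\<lambda>x. c * \<phi> x) = c * ?T \<phi>"
    using K eq[OF test_functions_cmult[OF \<phi>, of c], of K] eq[OF \<phi>, of K]
    by (simp add: K_def mult.left_commute)
next
  fix K assume K: "compact K \<and> K \<subseteq> \<Omega>"
  \<comment> \<open>The witnesses are this \<open>L ^ 1\<close> norm of \<open>u\<close> on
    \<open>K\<close> and the order 1, since a single derivative falls on the test function.\<close>
  define C where "C = (\<integral>x. \<bar>indicator K x * u x\<bar> \<partial>lebesgue)"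
  have int: "integrable lebesgue (\<lambda>x. indicator K x * u x)"
    using integrable_indicator_locally_integrable[OF u] K by blast
  show "\<exists>C m. \<forall>\<phi>\<in>test_functions \<Omega>. support \<phi> \<subseteq> K \<longrightarrow>
    \<bar>distr_deriv j (function_distr \<Omega> u) \<phi>\<bar> \<le> C * (\<Sum>js | length js \<le> m. SUP x. \<bar>partial_derivs js \<phi> x\<bar>)"
  proof (intro exI ballI impI)
    fix \<phi> assume \<phi>: "\<phi> \<in> test_functions \<Omega>" and supp: "support \<phi> \<subseteq> K"
    define P where "P js = (SUP x. \<bar>partial_derivs js \<phi> x\<bar>)" for js
    have le: "\<bar>partial_derivs js \<phi> x\<bar> \<le> P js" for js x
    proof -
      have "bounded (range (\<lambda>x. \<bar>partial_derivs js \<phi> x\<bar>))"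
        using test_functions_bounded[OF test_functions_partial_derivs[OF \<phi>]] by (auto simp: bounded_iff)
      then show ?thesis
        unfolding P_def by (intro cSUP_upper bounded_imp_bdd_above) auto
    qed
    have nonneg: "P js \<ge> 0" for js
      using le[of js 0] by linarith
    have "finite {js :: 'n list. length js \<le> 1}"
      using finite_lists_length_le[of "UNIV :: 'n set" 1] by simp
    then have Pj: "P [j] \<le> (\<Sum>js | length js \<le> 1. P js)"
      using nonneg by (intro member_le_sum) auto
    have "\<bar>distr_deriv j (function_distr \<Omega> u) \<phi>\<bar> = \<bar>\<integral>x. indicator K x * u x * partial_deriv j \<phi> x \<partial>lebesgue\<bar>"
      unfolding distr_deriv_def using K supp \<Omega>
      by (subst function_distr_eq[where K = K]) (auto intro: partial_deriv_outside_support dest: subsetD)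
    also have "\<dots> \<le> (\<integral>x. \<bar>indicator K x * u x * partial_deriv j \<phi> x\<bar> \<partial>lebesgue)"
      by (rule integral_abs_bound)
    also have "\<dots> \<le> (\<integral>x. \<bar>indicator K x * u x\<bar> * P [j] \<partial>lebesgue)"
    proof (rule integral_mono)
      show "integrable lebesgue (\<lambda>x. \<bar>indicator K x * u x * partial_deriv j \<phi> x\<bar>)"
        by (intro integrable_abs integrable_mult_test_function[OF int test_functions_partial_deriv[OF \<phi>]])
      show "integrable lebesgue (\<lambda>x. \<bar>indicator K x * u x\<bar> * P [j])"
        by (intro integrable_mult_left integrable_abs int)
      show "\<bar>indicator K x * u x * partial_deriv j \<phi> x\<bar> \<le> \<bar>indicator K x * u x\<bar> * P [j]" for x
        using le[of "[j]" x] by (simp add: abs_mult mult_left_mono)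
    qed
    also have "\<dots> = C * P [j]"
      by (simp add: C_def)
    also have "\<dots> \<le> C * (\<Sum>js | length js \<le> 1. P js)"
      using Pj by (intro mult_left_mono) (auto simp: C_def)
    finally show "\<bar>distr_deriv j (function_distr \<Omega> u) \<phi>\<bar> \<le>
        C * (\<Sum>js | length js \<le> 1. SUP x. \<bar>partial_derivs js \<phi> x\<bar>)"
      by (simp add: P_def)
  qed
qed


section \<open>Powers of extended nonnegative reals\<close>

lemma ennreal_powr_ennreal: "c \<ge> 0 \<Longrightarrow> ennreal_powr (ennreal c) p = ennreal (c powr p)"
  by (simp add: ennreal_powr_def)

lemma ennreal_powr_top [simp]: "ennreal_powr top p = top"
  by (simp add: ennreal_powr_def)

lemma ennreal_powr_mono: "p > 0 \<Longrightarrow> a \<le> b \<Longrightarrow> ennreal_powr a p \<le> ennreal_powr b p"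
  by (cases a; cases b) (auto simp: ennreal_powr_ennreal top_unique intro!: ennreal_leI powr_mono2)

lemma ennreal_powr_mult:
  "C > 0 \<Longrightarrow> p > 0 \<Longrightarrow> ennreal_powr (ennreal C * a) p = ennreal (C powr p) * ennreal_powr a p"
  by (cases a) (auto simp: ennreal_powr_ennreal ennreal_mult_top powr_mult simp flip: ennreal_mult)

lemma ennreal_powr_powr: "ennreal_powr (ennreal_powr a p) q = ennreal_powr a (p * q)"
  by (cases a) (auto simp: ennreal_powr_ennreal powr_powr)

lemma ennreal_powr_less_top_iff: "ennreal_powr a p < top \<longleftrightarrow> a < top"
  by (cases a) (auto simp: ennreal_powr_ennreal)

lemma borel_measurable_ennreal_powr [measurable (raw)]:
  assumes [measurable]: "f \<in> borel_measurable M"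
  shows "(\<lambda>x. ennreal_powr (f x) p) \<in> borel_measurable M"
  unfolding ennreal_powr_def by measurable

lemma Lp_norm_le_cmult:
  assumes p: "p > 0" and C: "C > 0" and A: "A \<in> sets lebesgue"
    and meas: "g \<in> borel_measurable (lebesgue_on A)"
    and le: "\<And>x. x \<in> A \<Longrightarrow> f x \<le> ennreal C * g x"
  shows "Lp_norm p A f \<le> ennreal C * Lp_norm p A g"
proof -
  have "(\<integral>\<^sup>+x. ennreal_powr (f x) p \<partial>lebesgue_on A) \<le> (\<integral>\<^sup>+x. ennreal (C powr p) * ennreal_powr (g x) p \<partial>lebesgue_on A)"
  proof (rule nn_integral_mono)
    fix x assume "x \<in> space (lebesgue_on A)"
    then have "x \<in> A"
      by (simp add: space_restrict_space)
    then show "ennreal_powr (f x) p \<le> ennreal (C powr p) * ennreal_powr (g x) p"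
      using ennreal_powr_mono[OF p le] by (simp add: ennreal_powr_mult[OF C p])
  qed
  also have "\<dots> = ennreal (C powr p) * (\<integral>\<^sup>+x. ennreal_powr (g x) p \<partial>lebesgue_on A)"
    using meas by (intro nn_integral_cmult) measurable
  finally have "Lp_norm p A f \<le> ennreal_powr (ennreal (C powr p) * (\<integral>\<^sup>+x. ennreal_powr (g x) p \<partial>lebesgue_on A)) (1 / p)"
    unfolding Lp_norm_def using p by (intro ennreal_powr_mono) auto
  also have "\<dots> = ennreal C * Lp_norm p A g"
    unfolding Lp_norm_def using p C by (subst ennreal_powr_mult) (auto simp: powr_powr)
  finally show ?thesis .
qed


section \<open>From pointwise gradients to grand maximal functions\<close>

lemma ennreal_le_divide_iff:
  fixes a b c :: ennreal
  assumes "c \<noteq> 0" "c < top"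
  shows "a \<le> b / c \<longleftrightarrow> a * c \<le> b"
  using divide_less_ennreal[OF assms, of b a] by (simp add: not_less[symmetric])

lemma double_le_bdist:
  assumes "r \<ge> 0" "ennreal r \<le> bdist \<Omega> x / 2"
  shows "ennreal (2 * r) \<le> bdist \<Omega> x"
proof -
  have "ennreal r * 2 \<le> bdist \<Omega> x"
    using assms(2) ennreal_le_divide_iff[of 2 "ennreal r" "bdist \<Omega> x"] by simp
  then show ?thesis
    using assms(1) by (simp add: ennreal_mult mult.commute)
qed

lemma half_ball_subset:
  assumes "r \<ge> 0" "x \<in> \<Omega>" "ennreal r \<le> bdist \<Omega> x / 2"
  shows "ball x (2 * r) \<subseteq> \<Omega>" "ball x r \<subseteq> \<Omega>"
proof -
  show "ball x (2 * r) \<subseteq> \<Omega>"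
    by (intro ball_subset_bdist assms double_le_bdist)
  then show "ball x r \<subseteq> \<Omega>"
    using assms(1) subset_ball[of r "2 * r" x] by auto
qed

lemma bdist_on_half_ball:
  assumes "r \<ge> 0" "ennreal r \<le> bdist \<Omega> x / 2" "y \<in> ball x r"
  shows "ennreal r \<le> bdist \<Omega> y"
proof -
  have "ennreal (2 * r) \<le> bdist \<Omega> y + ennreal (dist x y)"
    using double_le_bdist[OF assms(1,2)] bdist_triangle order_trans by blast
  also have "\<dots> \<le> bdist \<Omega> y + ennreal r"
    using assms(3) by (intro add_left_mono ennreal_leI) simp
  finally show ?thesis
    using assms(1) by (cases "bdist \<Omega> y") (auto simp flip: ennreal_plus)
qed

text \<open>The inequality from \<open>ball_gradients\<close>, detached from integrability and with
  a named exceptional set, so that \<open>u\<close> and \<open>g\<close> can be replaced by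
  extensions from \<Omega>.\<close>

definition pointwise_gradient ::
    "(real^'n::finite) set \<Rightarrow> (real^'n) set \<Rightarrow> (real^'n \<Rightarrow> real) \<Rightarrow> (real^'n \<Rightarrow> real) \<Rightarrow> bool" where
  "pointwise_gradient \<Omega> F u g \<longleftrightarrow>
     (\<forall>x\<in>\<Omega> - F. \<forall>y\<in>\<Omega> - F. ennreal (dist x y) \<le> min (bdist \<Omega> x) (bdist \<Omega> y) / 4 \<longrightarrow>
        \<bar>u x - u y\<bar> \<le> dist x y * (g x + g y))"

text \<open>In a ball of radius \<open>r \<le> bdist \<Omega> x / 2\<close> every point keeps
  distance at least \<open>r\<close> from the boundary, so pairs at distance at most
  \<open>r / 4\<close> are admissible for \<open>M_ball\<close>. This is why the chaining argument
  only uses steps of that length.\<close>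

lemma gradient_on_half_ball:
  fixes u g :: "real^'n::finite \<Rightarrow> real"
  assumes grad: "pointwise_gradient \<Omega> F u g"
    and r: "r \<ge> 0" "x \<in> \<Omega>" "ennreal r \<le> bdist \<Omega> x / 2"
    and y: "y \<in> ball x r - F" "y' \<in> ball x r - F" "dist y y' \<le> r / 4"
  shows "\<bar>u y - u y'\<bar> \<le> dist y y' * (g y + g y')"
proof (rule grad[unfolded pointwise_gradient_def, rule_format])
  show "y \<in> \<Omega> - F" "y' \<in> \<Omega> - F"
    using y half_ball_subset(2)[OF r] by auto
  have "ennreal (dist y y') * 4 = ennreal (dist y y' * 4)"
    by (simp add: ennreal_mult)
  also have "\<dots> \<le> ennreal r"
    using y(3) by (intro ennreal_leI) simp
  also have "\<dots> \<le> min (bdist \<Omega> y) (bdist \<Omega> y')"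
    using y bdist_on_half_ball[OF r(1,3)] by simp
  finally show "ennreal (dist y y') \<le> min (bdist \<Omega> y) (bdist \<Omega> y') / 4"
    by (simp add: ennreal_le_divide_iff)
qed

lemma exists_half_ball_radius:
  assumes "open \<Omega>" "x \<in> \<Omega>"
  obtains r where "r > 0" "ennreal r \<le> bdist \<Omega> x / 2"
proof (cases "bdist \<Omega> x")
  case (real b)
  with bdist_pos[OF assms] show thesis
    by (intro that[of "b / 2"]) (auto simp: ennreal_divide_numeral)
next
  case top
  then show thesis
    by (intro that[of 1]) (auto simp: ennreal_top_divide)
qed

lemma exists_powr_ge:
  fixes a s :: real
  assumes "s > 0"
  obtains \<mu> where "\<mu> > 0" "a \<le> \<mu> powr s"
proof
  show "(max a 1) powr (1 / s) > 0"
    by simp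
  show "a \<le> ((max a 1) powr (1 / s)) powr s"
    using assms by (simp add: powr_powr)
qed

text \<open>The integral of \<open>g powr s\<close> over the ball is finite because
  \<open>g powr s \<le> 1 + g powr p\<close>. The Poincare inequality, with any \<open>\<mu>\<close>
  large enough for that integral, makes \<open>u - c\<close> and hence \<open>u\<close> integrable
  there.\<close>

lemma pointwise_gradient_imp_locally_bounded_integral:
  fixes u g :: "real^'n::finite \<Rightarrow> real"
  assumes \<Omega>: "open \<Omega>" "x \<in> \<Omega>"
    and g: "g \<in> borel_measurable lebesgue" "\<And>x. g x \<ge> 0" and F: "F \<in> null_sets lebesgue"
    and grad: "pointwise_gradient \<Omega> F u g"
    and u: "u \<in> borel_measurable lebesgue"
    and p: "real CARD('n) / (real CARD('n) + 1) \<le> p"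
    and fin: "(\<integral>\<^sup>+x. ennreal (g x powr p) \<partial>lebesgue) < \<infinity>"
  obtains r where "r > 0" "ball x r \<subseteq> \<Omega>" "(\<integral>\<^sup>+y\<in>ball x r. ennreal \<bar>u y\<bar> \<partial>lebesgue) < \<infinity>"
proof -
  define n where "n = CARD('n)"
  define s where "s = real n / (real n + 1)"
  define V where "V = unit_ball_vol (real n)"
  have V: "V > 0"
    by (simp add: V_def)
  have s: "s > 0" "s \<le> p"
    using p by (auto simp: s_def n_def)
  obtain r where r: "r > 0" "ennreal r \<le> bdist \<Omega> x / 2"
    using exists_half_ball_radius[OF \<Omega>] by blast
  have ball [simp]: "(\<lambda>y. c * indicator (ball x r) y :: ennreal) \<in> borel_measurable lebesgue" for c
    by (intro borel_measurable_times_ennreal borel_measurable_const borel_measurable_indicator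
        sets_completionI_sets) simp
  have ball_fin: "emeasure lebesgue (ball x r) < \<infinity>"
    using r(1) by (simp add: emeasure_lebesgue_ball del: emeasure_completion)
  have gp [measurable]: "(\<lambda>y. ennreal (g y powr p)) \<in> borel_measurable lebesgue"
    using g(1) by measurable
  have "(\<integral>\<^sup>+y\<in>ball x r. ennreal (g y powr s) \<partial>lebesgue) \<le>
      (\<integral>\<^sup>+y. 1 * indicator (ball x r) y + ennreal (g y powr p) \<partial>lebesgue)"
  proof (rule nn_integral_mono)
    fix y
    have "g y powr s \<le> 1 + g y powr p"
    proof (cases "g y \<le> 1")
      case True
      then have "g y powr s \<le> 1"
        using g(2)[of y] s by (intro powr_le1) auto
      then show ?thesis
        by (simp add: add_increasing2)
    next
      case False
      then have "g y powr s \<le> g y powr p"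
        using s by (intro powr_mono) auto
      then show ?thesis
        by simp
    qed
    then have "ennreal (g y powr s) \<le> ennreal (1 + g y powr p)"
      by (rule ennreal_leI)
    also have "\<dots> = 1 + ennreal (g y powr p)"
      by (simp add: ennreal_plus)
    finally show "ennreal (g y powr s) * indicator (ball x r) y \<le> 1 * indicator (ball x r) y + ennreal (g y powr p)"
      by (auto split: split_indicator)
  qed
  also have "\<dots> = emeasure lebesgue (ball x r) + (\<integral>\<^sup>+y. ennreal (g y powr p) \<partial>lebesgue)"
    using ball[of 1] by (subst nn_integral_add[OF ball gp])
      (simp add: nn_integral_cmult_indicator del: emeasure_completion)
  also have "\<dots> < \<infinity>"
    using fin ball_fin by simp
  finally obtain I where I: "(\<integral>\<^sup>+y\<in>ball x r. ennreal (g y powr s) \<partial>lebesgue) = ennreal I" "I \<ge> 0"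
    by (cases "\<integral>\<^sup>+y\<in>ball x r. ennreal (g y powr s) \<partial>lebesgue") auto
  obtain \<mu> where \<mu>: "\<mu> > 0" "I * (2 * 64 ^ n) / (V * r ^ n) \<le> \<mu> powr s"
    using exists_powr_ge[OF s(1)] by blast
  have "I \<le> \<mu> powr s * (V * r ^ n) / (2 * 64 ^ n)"
    using \<mu>(2) V r(1) by (simp add: field_simps)
  then have small: "(\<integral>\<^sup>+y\<in>ball x r. ennreal (g y powr s) \<partial>lebesgue) \<le>
      ennreal (\<mu> powr s * (V * r ^ n) / (2 * 64 ^ n))"
    unfolding I(1) by (rule ennreal_leI)
  have grad': "\<bar>u y - u y'\<bar> \<le> dist y y' * (g y + g y')"
    if "y \<in> ball x r - F" "y' \<in> ball x r - F" "dist y y' \<le> r / 4" for y y'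
    by (rule gradient_on_half_ball[OF grad _ \<Omega>(2) r(2) that]) (use r(1) in auto)
  obtain c where c: "(\<integral>\<^sup>+y\<in>ball x r. ennreal \<bar>u y - c\<bar> \<partial>lebesgue) \<le> ennreal (45 * V * \<mu> * r ^ (n + 1))"
    using poincare_pointwise_gradient[where u = u and z = x and \<rho> = r and \<mu> = \<mu>, OF g F r(1) \<mu>(1) grad'] small
    by (auto simp: n_def s_def V_def)
  show thesis
  proof
    show "r > 0" by fact
    show "ball x r \<subseteq> \<Omega>"
      by (rule half_ball_subset(2)[OF _ \<Omega>(2) r(2)]) (use r(1) in simp)
    have "(\<integral>\<^sup>+y\<in>ball x r. ennreal \<bar>u y\<bar> \<partial>lebesgue) \<le>
        (\<integral>\<^sup>+y. ennreal \<bar>u y - c\<bar> * indicator (ball x r) y + ennreal \<bar>c\<bar> * indicator (ball x r) y \<partial>lebesgue)"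
      by (intro nn_integral_mono)
        (auto split: split_indicator simp flip: ennreal_plus intro!: ennreal_leI)
    also have "\<dots> = (\<integral>\<^sup>+y. ennreal \<bar>u y - c\<bar> * indicator (ball x r) y \<partial>lebesgue) +
        ennreal \<bar>c\<bar> * emeasure lebesgue (ball x r)"
    proof -
      have "(\<lambda>y. ennreal \<bar>u y - c\<bar>) \<in> borel_measurable lebesgue"
        using u by measurable
      then have "(\<lambda>y. ennreal \<bar>u y - c\<bar> * indicator (ball x r) y) \<in> borel_measurable lebesgue"
        by (intro borel_measurable_times_ennreal borel_measurable_indicator sets_completionI_sets) auto
      from nn_integral_add[OF this ball] show ?thesis
        by (simp add: nn_integral_cmult_indicator del: emeasure_completion)
    qed
    also have "\<dots> < \<infinity>"
      using c ball_fin by (simp add: ennreal_mult_less_top le_less_trans)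
    finally show "(\<integral>\<^sup>+y\<in>ball x r. ennreal \<bar>u y\<bar> \<partial>lebesgue) < \<infinity>" .
  qed
qed

lemma nn_integral_finite_on_compact:
  fixes f :: "'a::euclidean_space \<Rightarrow> ennreal"
  assumes f: "f \<in> borel_measurable lebesgue" and K: "compact K"
    and fin: "\<And>x. x \<in> K \<Longrightarrow> \<exists>r>0. (\<integral>\<^sup>+y\<in>ball x r. f y \<partial>lebesgue) < \<infinity>"
  shows "(\<integral>\<^sup>+y\<in>K. f y \<partial>lebesgue) < \<infinity>"
proof -
  obtain r where r: "\<And>x. x \<in> K \<Longrightarrow> r x > 0 \<and> (\<integral>\<^sup>+y\<in>ball x (r x). f y \<partial>lebesgue) < \<infinity>"
    using fin by metis
  have "K \<subseteq> (\<Union>x\<in>K. ball x (r x))"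
    using r by force
  then obtain D where D: "D \<subseteq> K" "finite D" "K \<subseteq> (\<Union>x\<in>D. ball x (r x))"
    using compactE_image[OF K, of K "\<lambda>x. ball x (r x)"] by auto
  have "(\<integral>\<^sup>+y\<in>K. f y \<partial>lebesgue) \<le> (\<integral>\<^sup>+y. (\<Sum>x\<in>D. f y * indicator (ball x (r x)) y) \<partial>lebesgue)"
  proof (rule nn_integral_mono)
    fix y
    show "f y * indicator K y \<le> (\<Sum>x\<in>D. f y * indicator (ball x (r x)) y)"
    proof (cases "y \<in> K")
      case True
      then obtain x where x: "x \<in> D" "y \<in> ball x (r x)"
        using D(3) by blast
      then have "f y * indicator (ball x (r x)) y \<le> (\<Sum>x\<in>D. f y * indicator (ball x (r x)) y)"
        using D(2) by (intro member_le_sum) auto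
      with x True show ?thesis
        by simp
    qed simp
  qed
  also have "\<dots> = (\<Sum>x\<in>D. \<integral>\<^sup>+y\<in>ball x (r x). f y \<partial>lebesgue)"
    by (intro nn_integral_sum borel_measurable_times_ennreal f borel_measurable_indicator
        sets_completionI_sets) auto
  also have "\<dots> < \<infinity>"
    using r D(1,2) by (auto simp: less_top subset_iff)
  finally show ?thesis .
qed

text \<open>Derivatives of test functions have integral 0, so \<open>u\<close> may be replaced by
  \<open>u - c\<close>. The bound \<open>1 / r ^ (n + 1)\<close> on the derivative cancels the
  \<open>r ^ (n + 1)\<close> of the Poincare inequality, which makes the estimate independent of the
  radius.\<close>

lemma grand_maximal_le_maximal:
  fixes u g :: "real^'n::finite \<Rightarrow> real"
  defines "n \<equiv> CARD('n)"
  defines "s \<equiv> real n / (real n + 1)" and "V \<equiv> unit_ball_vol (real n)"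
  assumes \<Omega>: "open \<Omega>" "x \<in> \<Omega>" and u: "locally_integrable \<Omega> u" and N: "N \<ge> 1"
    and g: "g \<in> borel_measurable lebesgue" "\<And>x. g x \<ge> 0" and F: "F \<in> null_sets lebesgue"
    and grad: "pointwise_gradient \<Omega> F u g"
  shows "grand_maximal (bdist \<Omega> x / 2) N (distr_deriv j (function_distr \<Omega> u)) x \<le>
    ennreal (45 * V * (2 * 64 ^ n / V) powr (1 / s)) *
    ennreal_powr (maximal (\<lambda>y. ennreal (g y powr s)) x) (1 / s)"
  unfolding grand_maximal_def
proof (rule SUP_least, safe)
  let ?T = "distr_deriv j (function_distr \<Omega> u)" and ?M = "maximal (\<lambda>y. ennreal (g y powr s)) x"
  have V: "V > 0"
    by (simp add: V_def)
  have s: "s > 0"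
    by (simp add: s_def n_def)
  fix r \<phi>
  assume r: "0 < r" "ennreal r \<le> bdist \<Omega> x / 2" and \<phi>: "\<phi> \<in> normalized_test_functions N x r"
  have test: "\<phi> \<in> test_functions (ball x r)" and bound: "\<bar>partial_deriv j \<phi> y\<bar> \<le> 1 / r ^ (n + 1)" for y
    using \<phi> N by (auto simp: normalized_test_functions_def n_def dest!: spec[of _ "[j]"])
  have sub: "ball x r \<subseteq> \<Omega>"
    by (rule half_ball_subset(2)[OF _ \<Omega>(2) r(2)]) (use r(1) in simp)
  \<comment> \<open>Every \<open>\<mu>\<close> compatible with the value of the maximal function
    gives a bound; the best one is selected at the end.\<close>
  have main: "\<bar>?T \<phi>\<bar> \<le> 45 * V * \<mu>" if \<mu>: "\<mu> > 0" "?M \<le> ennreal (\<mu> powr s * V / (2 * 64 ^ n))" for \<mu>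
  proof -
    have grad': "\<bar>u y - u y'\<bar> \<le> dist y y' * (g y + g y')"
      if "y \<in> ball x r - F" "y' \<in> ball x r - F" "dist y y' \<le> r / 4" for y y'
      by (rule gradient_on_half_ball[OF grad _ \<Omega>(2) r(2) that]) (use r(1) in auto)
    have "(\<integral>\<^sup>+y\<in>ball x r. ennreal (g y powr s) \<partial>lebesgue) \<le> ?M * ennreal (r ^ n)"
      using ball_integral_le_maximal[OF r(1), where 'a = "real^'n"] by (simp add: n_def)
    also have "\<dots> \<le> ennreal (\<mu> powr s * V / (2 * 64 ^ n)) * ennreal (r ^ n)"
      by (intro mult_right_mono \<mu>(2)) simp
    also have "\<dots> = ennreal (\<mu> powr s * (V * r ^ n) / (2 * 64 ^ n))"
      using V r(1) by (simp flip: ennreal_mult add: mult_ac)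
    finally obtain c where c: "(\<integral>\<^sup>+y\<in>ball x r. ennreal \<bar>u y - c\<bar> \<partial>lebesgue) \<le> ennreal (45 * V * \<mu> * r ^ (n + 1))"
      using poincare_pointwise_gradient[where u = u and z = x and \<rho> = r and \<mu> = \<mu>, OF g F r(1) \<mu>(1) grad']
      by (auto simp: n_def s_def V_def)
    define K where "K = support \<phi>"
    have K: "compact K" "K \<subseteq> ball x r"
      using test by (auto simp: K_def test_functions_def)
    have \<phi>': "partial_deriv j \<phi> \<in> test_functions (ball x r)"
      by (rule test_functions_partial_deriv[OF test])
    have int_u: "integrable lebesgue (\<lambda>y. indicator K y * u y)"
      using integrable_indicator_locally_integrable[OF u K(1)] K(2) sub by blast
    have int_c: "integrable lebesgue (\<lambda>y. c * indicat_real K y)"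
      by (intro integrable_mult_right integrable_indicator_compact K)
    have int: "integrable lebesgue (\<lambda>y. indicator K y * u y - c * indicator K y)"
      by (intro Bochner_Integration.integrable_diff int_u int_c)
    have eq0: "(\<integral>y. c * indicator K y * partial_deriv j \<phi> y \<partial>lebesgue) = 0"
    proof -
      have "(\<lambda>y. c * indicator K y * partial_deriv j \<phi> y) = (\<lambda>y. c * partial_deriv j \<phi> y)"
        by (auto simp: fun_eq_iff K_def indicator_def partial_deriv_outside_support)
      then show ?thesis
        using integral_partial_deriv_test_function[OF test, of j] by simp
    qed
    have "?T \<phi> = - (\<integral>y. indicator K y * u y * partial_deriv j \<phi> y \<partial>lebesgue)"
      unfolding distr_deriv_def using K(2) sub
      by (subst function_distr_eq[OF \<Omega>(1), where K = K])
        (auto simp: K_def intro: partial_deriv_outside_support)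
    also have "\<dots> = - (\<integral>y. (indicator K y * u y - c * indicator K y) * partial_deriv j \<phi> y \<partial>lebesgue)"
      using integrable_mult_test_function[OF int_u \<phi>'] integrable_mult_test_function[OF int_c \<phi>'] eq0
      by (simp add: left_diff_distrib)
    finally have "ennreal \<bar>?T \<phi>\<bar> =
        ennreal (norm (\<integral>y. (indicator K y * u y - c * indicator K y) * partial_deriv j \<phi> y \<partial>lebesgue))"
      by simp
    also have "\<dots> \<le> (\<integral>\<^sup>+y. norm ((indicator K y * u y - c * indicator K y) * partial_deriv j \<phi> y) \<partial>lebesgue)"
      by (rule integral_norm_bound_ennreal[OF integrable_mult_test_function[OF int \<phi>']])
    also have "\<dots> \<le> (\<integral>\<^sup>+y. ennreal (1 / r ^ (n + 1)) * ennreal \<bar>indicator K y * u y - c * indicator K y\<bar> \<partial>lebesgue)"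
    proof (rule nn_integral_mono)
      fix y
      have "norm ((indicator K y * u y - c * indicator K y) * partial_deriv j \<phi> y) \<le>
          1 / r ^ (n + 1) * \<bar>indicator K y * u y - c * indicator K y\<bar>"
        using mult_right_mono[OF bound[of y], of "\<bar>indicator K y * u y - c * indicator K y\<bar>"]
        by (simp add: abs_mult mult.commute)
      then show "ennreal (norm ((indicator K y * u y - c * indicator K y) * partial_deriv j \<phi> y)) \<le>
          ennreal (1 / r ^ (n + 1)) * ennreal \<bar>indicator K y * u y - c * indicator K y\<bar>"
        using r(1) by (simp flip: ennreal_mult add: ennreal_leI)
    qed
    also have "\<dots> = ennreal (1 / r ^ (n + 1)) * (\<integral>\<^sup>+y. ennreal \<bar>indicator K y * u y - c * indicator K y\<bar> \<partial>lebesgue)"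
      using int by (intro nn_integral_cmult) auto
    also have "\<dots> \<le> ennreal (1 / r ^ (n + 1)) * (\<integral>\<^sup>+y\<in>ball x r. ennreal \<bar>u y - c\<bar> \<partial>lebesgue)"
      using K(2) by (intro mult_left_mono nn_integral_mono) (auto split: split_indicator)
    also have "\<dots> \<le> ennreal (1 / r ^ (n + 1)) * ennreal (45 * V * \<mu> * r ^ (n + 1))"
      by (intro mult_left_mono c) simp
    also have "\<dots> = ennreal (45 * V * \<mu>)"
      using r(1) V \<mu>(1) by (simp flip: ennreal_mult)
    finally show ?thesis
      using V \<mu>(1) by simp
  qed
  show "ennreal \<bar>?T \<phi>\<bar> \<le> ennreal (45 * V * (2 * 64 ^ n / V) powr (1 / s)) * ennreal_powr ?M (1 / s)"
  proof (cases ?M)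
    case top
    then show ?thesis
      using V by (simp add: ennreal_mult_top)
  next
    case (real m)
    show ?thesis
    proof (cases "m = 0")
      case True
      \<comment> \<open>The Poincare inequality requires \<open>\<mu> > 0\<close>, so a vanishing
        maximal function is handled by arbitrarily small \<open>\<mu>\<close>.\<close>
      have "\<bar>?T \<phi>\<bar> \<le> 0 + e" if "e > 0" for e
        using main[of "e / (45 * V)"] that V real True by simp
      then have "\<bar>?T \<phi>\<bar> \<le> 0"
        by (rule field_le_epsilon)
      then show ?thesis
        by simp
    next
      case False
      \<comment> \<open>The solution of \<open>\<mu> powr s * V / (2 * 64 ^ n) = m\<close>, the
        smallest admissible value.\<close>
      define \<mu> where "\<mu> = (2 * 64 ^ n / V * m) powr (1 / s)"
      have "\<mu> powr s = 2 * 64 ^ n / V * m"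
        using s V real by (simp add: \<mu>_def powr_powr)
      then have "\<bar>?T \<phi>\<bar> \<le> 45 * V * \<mu>"
        using V False real by (intro main) (auto simp: \<mu>_def)
      also have "\<dots> = 45 * V * (2 * 64 ^ n / V) powr (1 / s) * m powr (1 / s)"
        unfolding \<mu>_def powr_mult by (simp add: mult.assoc)
      finally show ?thesis
        using real V by (simp add: ennreal_powr_ennreal ennreal_leI flip: ennreal_mult)
    qed
  qed
qed

lemma nn_integral_lebesgue_on:
  assumes "A \<in> sets lebesgue"
  shows "(\<integral>\<^sup>+x. f x \<partial>lebesgue_on A) = (\<integral>\<^sup>+x\<in>A. f x \<partial>lebesgue)"
  using assms by (simp add: nn_integral_restrict_space)

text \<open>The maximal theorem is about nonnegative functions on the whole space. Passing to
  \<open>\<bar>g\<bar>\<close>, extended by 0, weakens the inequality and keeps the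
  integral.\<close>

lemma ball_gradient_extension:
  fixes u g :: "real^'n::finite \<Rightarrow> real"
  assumes \<Omega>: "open \<Omega>" and g: "g \<in> ball_gradients p \<Omega> u"
  obtains h F where "h \<in> borel_measurable lebesgue" "\<And>x. h x \<ge> 0" "F \<in> null_sets lebesgue"
    "pointwise_gradient \<Omega> F u h"
    "(\<integral>\<^sup>+x. ennreal (h x powr p) \<partial>lebesgue) = (\<integral>\<^sup>+x. ennreal_powr (ennreal \<bar>g x\<bar>) p \<partial>lebesgue_on \<Omega>)"
proof -
  have sets: "\<Omega> \<in> sets lebesgue"
    using \<Omega> by (intro sets_completionI_sets) simp
  obtain F where F: "F \<in> null_sets lebesgue" "pointwise_gradient \<Omega> F u g"
    using g unfolding ball_gradients_def pointwise_gradient_def by blast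
  have gm: "g \<in> borel_measurable (lebesgue_on \<Omega>)"
    using g by (simp add: ball_gradients_def Lp_space_def)
  let ?h = "\<lambda>x. if x \<in> \<Omega> then \<bar>g x\<bar> else 0"
  show thesis
  proof
    have "(\<lambda>x. \<bar>g x\<bar>) \<in> borel_measurable (lebesgue_on \<Omega>)"
      using gm by measurable
    then show "?h \<in> borel_measurable lebesgue"
      using sets by (simp add: borel_measurable_if)
    show "F \<in> null_sets lebesgue" by fact
    show "pointwise_gradient \<Omega> F u ?h"
      unfolding pointwise_gradient_def
    proof (intro ballI impI)
      fix x y
      assume xy: "x \<in> \<Omega> - F" "y \<in> \<Omega> - F" "ennreal (dist x y) \<le> min (bdist \<Omega> x) (bdist \<Omega> y) / 4"
      have "dist x y * (g x + g y) \<le> dist x y * (\<bar>g x\<bar> + \<bar>g y\<bar>)"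
        by (intro mult_left_mono add_mono) auto
      then show "\<bar>u x - u y\<bar> \<le> dist x y * (?h x + ?h y)"
        using F(2)[unfolded pointwise_gradient_def, rule_format, OF xy] xy by auto
    qed
    show "(\<integral>\<^sup>+x. ennreal (?h x powr p) \<partial>lebesgue) = (\<integral>\<^sup>+x. ennreal_powr (ennreal \<bar>g x\<bar>) p \<partial>lebesgue_on \<Omega>)"
      unfolding nn_integral_lebesgue_on[OF sets]
      by (intro nn_integral_cong) (auto simp: ennreal_powr_ennreal)
  qed auto
qed

lemma ball_gradient_imp_locally_integrable:
  fixes u g :: "real^'n::finite \<Rightarrow> real"
  assumes \<Omega>: "open \<Omega>" and u: "u \<in> borel_measurable (lebesgue_on \<Omega>)" and g: "g \<in> ball_gradients p \<Omega> u"
    and p: "real CARD('n) / (real CARD('n) + 1) < p"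
  shows "locally_integrable \<Omega> u"
  unfolding locally_integrable_def
proof (intro allI impI)
  fix K assume K: "compact K \<and> K \<subseteq> \<Omega>"
  have sets: "\<Omega> \<in> sets lebesgue"
    using \<Omega> by (intro sets_completionI_sets) simp
  obtain h F where h: "h \<in> borel_measurable lebesgue" "\<And>x. h x \<ge> 0" "F \<in> null_sets lebesgue"
    and grad: "pointwise_gradient \<Omega> F u h"
    and eq: "(\<integral>\<^sup>+x. ennreal (h x powr p) \<partial>lebesgue) = (\<integral>\<^sup>+x. ennreal_powr (ennreal \<bar>g x\<bar>) p \<partial>lebesgue_on \<Omega>)"
    using ball_gradient_extension[OF \<Omega> g] by metis
  have fin: "(\<integral>\<^sup>+x. ennreal (h x powr p) \<partial>lebesgue) < \<infinity>"
    using g unfolding eq by (simp add: ball_gradients_def Lp_space_def Lp_norm_def ennreal_powr_less_top_iff)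
  \<comment> \<open>\<open>u\<close> is only known to be measurable on \<Omega>; the extension is
    measurable everywhere and agrees with \<open>u\<close> on \<open>K\<close>.\<close>
  define v where "v x = (if x \<in> \<Omega> then u x else 0)" for x
  have v: "v \<in> borel_measurable lebesgue"
    unfolding v_def using u sets by (simp add: borel_measurable_if)
  have grad': "pointwise_gradient \<Omega> F v h"
    using grad by (simp add: pointwise_gradient_def v_def)
  have "(\<integral>\<^sup>+y\<in>K. ennreal \<bar>v y\<bar> \<partial>lebesgue) < \<infinity>"
  proof (rule nn_integral_finite_on_compact)
    show "(\<lambda>y. ennreal \<bar>v y\<bar>) \<in> borel_measurable lebesgue"
      using v by measurable
    show "compact K"
      using K by blast
    fix x assume "x \<in> K"
    then have "x \<in> \<Omega>"
      using K by blast
    from pointwise_gradient_imp_locally_bounded_integral[OF \<Omega> this h grad' v less_imp_le[OF p] fin]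
    obtain r where "r > 0" "(\<integral>\<^sup>+y\<in>ball x r. ennreal \<bar>v y\<bar> \<partial>lebesgue) < \<infinity>"
      by blast
    then show "\<exists>r>0. (\<integral>\<^sup>+y\<in>ball x r. ennreal \<bar>v y\<bar> \<partial>lebesgue) < \<infinity>"
      by blast
  qed
  moreover have "K \<in> sets lebesgue"
    using K by (intro sets_completionI_sets) (auto intro: borel_compact)
  then have "(\<lambda>x. indicator K x *\<^sub>R v x) \<in> borel_measurable lebesgue"
    using v by (intro borel_measurable_scaleR borel_measurable_indicator)
  ultimately have "integrable lebesgue (\<lambda>x. indicator K x *\<^sub>R v x)"
    by (simp add: integrable_iff_bounded ennreal_mult' ennreal_indicator[symmetric] abs_mult mult.commute)
  moreover have "(\<lambda>x. indicator K x *\<^sub>R v x) = (\<lambda>x. indicator K x *\<^sub>R u x)"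
    using K by (auto simp: fun_eq_iff v_def indicator_def)
  ultimately show "u absolutely_integrable_on K"
    by (simp add: set_integrable_def)
qed

text \<open>The maximal theorem is applied to \<open>h powr s\<close> with exponent
  \<open>p / s\<close>, which exceeds 1 exactly because \<open>p > n / (n + 1)\<close>. Taking the
  power \<open>1 / p\<close> afterwards turns its constant \<open>B\<close> into
  \<open>B powr (1 / p)\<close>.\<close>

lemma hardy_norm_le_ball_gradient:
  fixes p :: real
  assumes p: "real CARD('n::finite) / (real CARD('n) + 1) < p" and N: "N \<ge> 1"
  obtains C where "C > 0"
    "\<And>\<Omega> (u :: real^'n \<Rightarrow> real) g j. open \<Omega> \<Longrightarrow> locally_integrable \<Omega> u \<Longrightarrow> g \<in> ball_gradients p \<Omega> u \<Longrightarrow>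
      hardy_norm p N \<Omega> (distr_deriv j (function_distr \<Omega> u)) \<le> ennreal C * Lp_norm_real p \<Omega> g"
proof -
  define n where "n = CARD('n)"
  define s where "s = real n / (real n + 1)"
  define V where "V = unit_ball_vol (real n)"
  have V: "V > 0"
    by (simp add: V_def)
  have s: "s > 0" "s < p"
    using p by (auto simp: s_def n_def)
  define A where "A = 45 * V * (2 * 64 ^ n / V) powr (1 / s)"
  have A: "A > 0"
    using V by (simp add: A_def)
  have "p / s > 1"
    using s by simp
  then obtain B where B: "B > 0"
    "\<And>h :: real^'n \<Rightarrow> real. h \<in> borel_measurable lebesgue \<Longrightarrow> (\<And>x. h x \<ge> 0) \<Longrightarrow>
      (\<integral>\<^sup>+x. ennreal_powr (maximal (\<lambda>x. ennreal (h x)) x) (p / s) \<partial>lebesgue) \<le>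
      ennreal B * (\<integral>\<^sup>+x. ennreal (h x powr (p / s)) \<partial>lebesgue)"
    using maximal_strong_type[where 'a = "real^'n"] by blast
  show thesis
  proof
    show "A * B powr (1 / p) > 0"
      using A B(1) by simp
    fix \<Omega> and u g :: "real^'n \<Rightarrow> real" and j
    assume \<Omega>: "open \<Omega>" and u: "locally_integrable \<Omega> u" and g: "g \<in> ball_gradients p \<Omega> u"
    have sets: "\<Omega> \<in> sets lebesgue"
      using \<Omega> by (intro sets_completionI_sets) simp
    obtain h F where h: "h \<in> borel_measurable lebesgue" "\<And>x. h x \<ge> 0" "F \<in> null_sets lebesgue"
      and grad: "pointwise_gradient \<Omega> F u h"
      and eq: "(\<integral>\<^sup>+x. ennreal (h x powr p) \<partial>lebesgue) = (\<integral>\<^sup>+x. ennreal_powr (ennreal \<bar>g x\<bar>) p \<partial>lebesgue_on \<Omega>)"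
      using ball_gradient_extension[OF \<Omega> g] by metis
    define M where "M = maximal (\<lambda>y. ennreal (h y powr s))"
    have hs: "(\<lambda>y. h y powr s) \<in> borel_measurable lebesgue"
      using h(1) by measurable
    have M: "M \<in> borel_measurable lebesgue"
    proof -
      have "(\<lambda>y. ennreal (h y powr s)) \<in> borel_measurable lebesgue"
        using h(1) by measurable
      then show ?thesis
        unfolding M_def by (rule borel_measurable_maximal)
    qed
    have "hardy_norm p N \<Omega> (distr_deriv j (function_distr \<Omega> u)) \<le>
        ennreal A * Lp_norm p \<Omega> (\<lambda>x. ennreal_powr (M x) (1 / s))"
      unfolding hardy_norm_def
    proof (rule Lp_norm_le_cmult[OF _ A sets])
      show "(\<lambda>x. ennreal_powr (M x) (1 / s)) \<in> borel_measurable (lebesgue_on \<Omega>)"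
        using M by (intro measurable_restrict_space1) measurable
      show "grand_maximal (bdist \<Omega> x / 2) N (distr_deriv j (function_distr \<Omega> u)) x \<le>
          ennreal A * ennreal_powr (M x) (1 / s)" if "x \<in> \<Omega>" for x
        unfolding A_def V_def M_def s_def n_def
        by (rule grand_maximal_le_maximal[OF \<Omega> that u N h grad])
    qed (use s in auto)
    also have "Lp_norm p \<Omega> (\<lambda>x. ennreal_powr (M x) (1 / s)) \<le> ennreal (B powr (1 / p)) * Lp_norm_real p \<Omega> g"
    proof -
      have "(\<integral>\<^sup>+x. ennreal_powr (ennreal_powr (M x) (1 / s)) p \<partial>lebesgue_on \<Omega>) \<le>
          (\<integral>\<^sup>+x. ennreal_powr (M x) (p / s) \<partial>lebesgue)"
        unfolding nn_integral_lebesgue_on[OF sets]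
        by (intro nn_integral_mono) (auto simp: ennreal_powr_powr split: split_indicator)
      also have "\<dots> \<le> ennreal B * (\<integral>\<^sup>+x. ennreal ((h x powr s) powr (p / s)) \<partial>lebesgue)"
        unfolding M_def by (rule B(2)[OF hs]) simp
      also have "(\<lambda>x. (h x powr s) powr (p / s)) = (\<lambda>x. h x powr p)"
        using s by (simp add: powr_powr)
      also have "(\<integral>\<^sup>+x. ennreal (h x powr p) \<partial>lebesgue) = (\<integral>\<^sup>+x. ennreal_powr (ennreal \<bar>g x\<bar>) p \<partial>lebesgue_on \<Omega>)"
        by (rule eq)
      finally have "Lp_norm p \<Omega> (\<lambda>x. ennreal_powr (M x) (1 / s)) \<le>
          ennreal_powr (ennreal B * (\<integral>\<^sup>+x. ennreal_powr (ennreal \<bar>g x\<bar>) p \<partial>lebesgue_on \<Omega>)) (1 / p)"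
        unfolding Lp_norm_def using s by (intro ennreal_powr_mono) auto
      also have "\<dots> = ennreal (B powr (1 / p)) * Lp_norm_real p \<Omega> g"
        unfolding Lp_norm_def using s by (intro ennreal_powr_mult B(1)) auto
      finally show ?thesis .
    qed
    finally show "hardy_norm p N \<Omega> (distr_deriv j (function_distr \<Omega> u)) \<le>
        ennreal (A * B powr (1 / p)) * Lp_norm_real p \<Omega> g"
      using A by (simp add: ennreal_mult mult.assoc mult_left_mono)
  qed
qed

section \<open>Finite sums in the quasinorm\<close>

lemma ennreal_powr_sum_le:
  fixes a :: "'i \<Rightarrow> ennreal"
  assumes J: "finite J" "J \<noteq> {}" and p: "p > 0"
  shows "ennreal_powr (\<Sum>j\<in>J. a j) p \<le> ennreal (real (card J) powr p) * (\<Sum>j\<in>J. ennreal_powr (a j) p)"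
proof -
  \<comment> \<open>Bounding the sum by \<open>card J\<close> times its largest term works for every
    positive exponent, above or below 1.\<close>
  obtain k where k: "k \<in> J" "a k = Max (a ` J)"
    using J Max_in[of "a ` J"] by fastforce
  have "(\<Sum>j\<in>J. a j) \<le> of_nat (card J) * a k"
    using J k by (intro sum_bounded_above) auto
  also have "of_nat (card J) = ennreal (real (card J))"
    by (simp add: ennreal_of_nat_eq_real_of_nat)
  finally have "ennreal_powr (\<Sum>j\<in>J. a j) p \<le> ennreal_powr (ennreal (real (card J)) * a k) p"
    by (rule ennreal_powr_mono[OF p])
  also have "\<dots> = ennreal (real (card J) powr p) * ennreal_powr (a k) p"
    using J p by (intro ennreal_powr_mult) (auto simp: card_gt_0_iff)
  also have "\<dots> \<le> ennreal (real (card J) powr p) * (\<Sum>j\<in>J. ennreal_powr (a j) p)"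
    using J(1) k(1) by (intro mult_left_mono member_le_sum) auto
  finally show ?thesis .
qed

text \<open>The power inequality is used under the integral with exponent \<open>p\<close> and
  outside with exponent \<open>1 / p\<close>, which costs \<open>card J\<close> and
  \<open>card J powr (1 / p)\<close>.\<close>

lemma Lp_norm_sum_le:
  fixes f :: "'i \<Rightarrow> real^'n::finite \<Rightarrow> ennreal"
  assumes J: "finite J" "J \<noteq> {}" and p: "p > 0"
    and f: "\<And>j. j \<in> J \<Longrightarrow> f j \<in> borel_measurable (lebesgue_on A)"
  shows "Lp_norm p A (\<lambda>x. \<Sum>j\<in>J. f j x) \<le> ennreal (real (card J) powr (1 + 1 / p)) * (\<Sum>j\<in>J. Lp_norm p A (f j))"
proof -
  let ?c = "real (card J)"
  have c: "?c > 0"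
    using J by (simp add: card_gt_0_iff)
  have fp: "(\<lambda>x. ennreal_powr (f j x) p) \<in> borel_measurable (lebesgue_on A)" if "j \<in> J" for j
    using f[OF that] by measurable
  have "(\<integral>\<^sup>+x. ennreal_powr (\<Sum>j\<in>J. f j x) p \<partial>lebesgue_on A) \<le>
      (\<integral>\<^sup>+x. ennreal (?c powr p) * (\<Sum>j\<in>J. ennreal_powr (f j x) p) \<partial>lebesgue_on A)"
    by (intro nn_integral_mono ennreal_powr_sum_le J p)
  also have "\<dots> = ennreal (?c powr p) * (\<Sum>j\<in>J. \<integral>\<^sup>+x. ennreal_powr (f j x) p \<partial>lebesgue_on A)"
    using fp by (subst nn_integral_cmult) (auto simp: nn_integral_sum intro!: borel_measurable_sum)
  finally have "Lp_norm p A (\<lambda>x. \<Sum>j\<in>J. f j x) \<le>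
      ennreal_powr (ennreal (?c powr p) * (\<Sum>j\<in>J. \<integral>\<^sup>+x. ennreal_powr (f j x) p \<partial>lebesgue_on A)) (1 / p)"
    unfolding Lp_norm_def using p by (intro ennreal_powr_mono) auto
  also have "\<dots> = ennreal ?c * ennreal_powr (\<Sum>j\<in>J. \<integral>\<^sup>+x. ennreal_powr (f j x) p \<partial>lebesgue_on A) (1 / p)"
    using c p by (subst ennreal_powr_mult) (auto simp: powr_powr)
  also have "\<dots> \<le> ennreal ?c * (ennreal (?c powr (1 / p)) * (\<Sum>j\<in>J. Lp_norm p A (f j)))"
    unfolding Lp_norm_def using p by (intro mult_left_mono ennreal_powr_sum_le J) auto
  also have "\<dots> = ennreal (?c powr (1 + 1 / p)) * (\<Sum>j\<in>J. Lp_norm p A (f j))"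
    using c by (simp add: powr_add ennreal_mult mult.assoc)
  finally show ?thesis .
qed


section \<open>From grand maximal functions to pointwise gradients\<close>

text \<open>Common core of changing the scale and of moving the centre: if the parameter derivative
  of the kernel is minus a divergence, the derivative of its pairing with \<open>u\<close> involves
  only distributional derivatives of \<open>u\<close>. The scale case has \<open>b = 1\<close> and
  fields depending on \<open>j\<close>; the translation case has one field and the components of the
  direction as weights.\<close>

lemma mollification_has_real_derivative:
  fixes u :: "real^'n::finite \<Rightarrow> real" and \<kappa> :: "real \<Rightarrow> real^'n \<Rightarrow> real"
  assumes \<Omega>: "open \<Omega>" and u: "locally_integrable \<Omega> u"
    and B: "compact B" "B \<subseteq> \<Omega>" and d: "d > 0"
    and \<kappa>: "\<And>s. s \<in> ball s0 d \<Longrightarrow> \<kappa> s \<in> test_functions B"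
    and \<eta>: "\<And>s j. s \<in> ball s0 d \<Longrightarrow> \<eta> j s \<in> test_functions B"
    and deriv: "\<And>s y. s \<in> ball s0 d \<Longrightarrow>
      ((\<lambda>s. \<kappa> s y) has_real_derivative - (\<Sum>j\<in>UNIV. b j * partial_deriv j (\<eta> j s) y)) (at s)"
    and bound: "\<And>s j y. s \<in> ball s0 d \<Longrightarrow> \<bar>partial_deriv j (\<eta> j s) y\<bar> \<le> M j"
  shows "((\<lambda>s. function_distr \<Omega> u (\<kappa> s)) has_real_derivative
    (\<Sum>j\<in>UNIV. b j * distr_deriv j (function_distr \<Omega> u) (\<eta> j s0))) (at s0)"
proof -
  define v where "v y = indicator B y * u y" for y
  have v: "integrable lebesgue v"
    unfolding v_def by (rule integrable_indicator_locally_integrable[OF u B])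
  have zero: "f y = 0" if "f \<in> test_functions B" "y \<notin> B" for f y
    using that by (intro zero_outside_support[of _ f]) (auto simp: test_functions_def)
  have eq: "function_distr \<Omega> u f = (\<integral>y. v y * f y \<partial>lebesgue)" if "f \<in> test_functions B" for f
    unfolding v_def by (rule function_distr_eq[OF \<Omega> B(2) zero[OF that]])
  have s0: "s0 \<in> ball s0 d"
    using d by simp
  define S where "S s y = - (\<Sum>j\<in>UNIV. b j * partial_deriv j (\<eta> j s) y)" for s y
  have \<eta>': "partial_deriv j (\<eta> j s0) \<in> test_functions B" for j
    by (intro test_functions_partial_deriv \<eta> s0)
  have "((\<lambda>s. \<integral>y. v y * \<kappa> s y \<partial>lebesgue) has_real_derivative (\<integral>y. v y * S s0 y \<partial>lebesgue)) (at s0)"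
  proof (rule has_real_derivative_integral_dominated[OF d, where w = "\<lambda>y. \<bar>v y\<bar> * (\<Sum>j\<in>UNIV. \<bar>b j\<bar> * M j)"])
    show "integrable lebesgue (\<lambda>y. v y * \<kappa> s y)" if "s \<in> ball s0 d" for s
      by (rule integrable_mult_test_function[OF v \<kappa>[OF that]])
    show "((\<lambda>s. v y * \<kappa> s y) has_real_derivative v y * S s y) (at s)" if "s \<in> ball s0 d" for s y
      unfolding S_def by (intro DERIV_cmult deriv that)
    show "\<bar>v y * S s y\<bar> \<le> \<bar>v y\<bar> * (\<Sum>j\<in>UNIV. \<bar>b j\<bar> * M j)" if "s \<in> ball s0 d" for s y
    proof -
      have "\<bar>S s y\<bar> \<le> (\<Sum>j\<in>UNIV. \<bar>b j * partial_deriv j (\<eta> j s) y\<bar>)"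
        unfolding S_def abs_minus_cancel by (rule sum_abs)
      also have "\<dots> \<le> (\<Sum>j\<in>UNIV. \<bar>b j\<bar> * M j)"
        using bound[OF that] by (intro sum_mono) (auto simp: abs_mult intro: mult_left_mono)
      finally show ?thesis
        by (simp add: abs_mult mult_left_mono)
    qed
    show "integrable lebesgue (\<lambda>y. \<bar>v y\<bar> * (\<Sum>j\<in>UNIV. \<bar>b j\<bar> * M j))"
      by (intro integrable_mult_left integrable_abs v)
    have "partial_deriv j (\<eta> j s0) \<in> borel_measurable lebesgue" for j
      by (rule test_functions_measurable[OF \<eta>'])
    then show "(\<lambda>y. v y * S s0 y) \<in> borel_measurable lebesgue"
      unfolding S_def using v by (intro borel_measurable_times borel_measurable_uminus
          borel_measurable_sum borel_measurable_const) auto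
  qed
  moreover have "(\<integral>y. v y * S s0 y \<partial>lebesgue) = (\<Sum>j\<in>UNIV. b j * distr_deriv j (function_distr \<Omega> u) (\<eta> j s0))"
  proof -
    have "(\<integral>y. v y * S s0 y \<partial>lebesgue) = (\<integral>y. (\<Sum>j\<in>UNIV. - (b j * (v y * partial_deriv j (\<eta> j s0) y))) \<partial>lebesgue)"
      by (simp add: S_def sum_distrib_left sum_negf mult_ac)
    also have "\<dots> = (\<Sum>j\<in>UNIV. \<integral>y. - (b j * (v y * partial_deriv j (\<eta> j s0) y)) \<partial>lebesgue)"
      by (intro Bochner_Integration.integral_sum integrable_minus integrable_mult_right
          integrable_mult_test_function[OF v \<eta>'])
    also have "\<dots> = (\<Sum>j\<in>UNIV. b j * distr_deriv j (function_distr \<Omega> u) (\<eta> j s0))"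
      by (simp add: distr_deriv_def eq[OF \<eta>'])
    finally show ?thesis .
  qed
  moreover have "\<forall>\<^sub>F s in nhds s0. function_distr \<Omega> u (\<kappa> s) = (\<integral>y. v y * \<kappa> s y \<partial>lebesgue)"
    using eventually_nhds_in_open[OF open_ball s0] by eventually_elim (simp add: eq \<kappa>)
  ultimately show ?thesis
    by (subst DERIV_cong_ev[OF refl _ refl]) auto
qed

lemma test_functions_rescale_subset:
  "\<eta> \<in> test_functions (ball 0 1) \<Longrightarrow> t > 0 \<Longrightarrow> ball z t \<subseteq> B \<Longrightarrow> rescale z t \<eta> \<in> test_functions B"
  using test_functions_rescale test_functions_mono by blast

lemma distr_deriv_cmult:
  fixes u :: "real^'n::finite \<Rightarrow> real"
  assumes "open \<Omega>" "locally_integrable \<Omega> u" "A \<subseteq> \<Omega>" "\<phi> \<in> test_functions A"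
  shows "distr_deriv j (function_distr \<Omega> u) (\<lambda>y. c * \<phi> y) = c * distr_deriv j (function_distr \<Omega> u) \<phi>"
  using distribution_distr_deriv[OF assms(1,2), of j] test_functions_mono[OF assms(3)] assms(4)
  unfolding distribution_def by blast

definition gradient_maximal ::
    "nat \<Rightarrow> (real^'n::finite) set \<Rightarrow> (real^'n \<Rightarrow> real) \<Rightarrow> real^'n \<Rightarrow> ennreal" where
  "gradient_maximal N \<Omega> u x =
     (\<Sum>j\<in>UNIV. grand_maximal (bdist \<Omega> x / 2) N (distr_deriv j (function_distr \<Omega> u)) x)"

text \<open>Passage from extended to real values. \<open>enn2real\<close> sends \<open>top\<close>
  to 0, so finiteness of the maximal function at \<open>x\<close> has to be assumed.\<close>

lemma distr_deriv_rescale_bound: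
  fixes \<eta> :: "real^'n::finite \<Rightarrow> real"
  assumes \<eta>: "\<eta> \<in> test_functions (ball 0 1)"
  obtains K where "K > 0"
    "\<And>\<Omega> u x z t R j. open \<Omega> \<Longrightarrow> locally_integrable \<Omega> u \<Longrightarrow> x \<in> \<Omega> \<Longrightarrow> gradient_maximal N \<Omega> u x < \<infinity> \<Longrightarrow>
      0 < t \<Longrightarrow> R \<le> 2 * t \<Longrightarrow> dist x z + t \<le> R \<Longrightarrow> ennreal R \<le> bdist \<Omega> x / 2 \<Longrightarrow>
      \<bar>distr_deriv j (function_distr \<Omega> u) (rescale z t \<eta>)\<bar> \<le> K * enn2real (gradient_maximal N \<Omega> u x)"
proof -
  obtain K where K: "K > 0"
    "\<And>T x z t R \<rho>. (\<And>c \<phi>. \<phi> \<in> test_functions (ball x R) \<Longrightarrow> T (\<lambda>y. c * \<phi> y) = c * T \<phi>) \<Longrightarrow>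
      0 < t \<Longrightarrow> R \<le> 2 * t \<Longrightarrow> dist x z + t \<le> R \<Longrightarrow> ennreal R \<le> \<rho> \<Longrightarrow>
      ennreal \<bar>T (rescale z t \<eta>)\<bar> \<le> ennreal K * grand_maximal \<rho> N T x"
    using rescale_grand_maximal_bound[OF \<eta>] by blast
  show thesis
  proof
    show "K > 0" by fact
    fix \<Omega> :: "(real^'n) set" and u x z t R j
    assume \<Omega>: "open \<Omega>" and u: "locally_integrable \<Omega> u" and x: "x \<in> \<Omega>"
      and fin: "gradient_maximal N \<Omega> u x < \<infinity>"
      and t: "0 < t" "R \<le> 2 * t" "dist x z + t \<le> R" "ennreal R \<le> bdist \<Omega> x / 2"
    let ?T = "distr_deriv j (function_distr \<Omega> u)"
    have "R \<ge> 0"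
      using t(1,3) zero_le_dist[of x z] by linarith
    then have sub: "ball x R \<subseteq> \<Omega>"
      by (rule half_ball_subset(2)[OF _ x t(4)])
    have "ennreal \<bar>?T (rescale z t \<eta>)\<bar> \<le> ennreal K * grand_maximal (bdist \<Omega> x / 2) N ?T x"
      by (rule K(2)[OF distr_deriv_cmult[OF \<Omega> u sub] t])
    also have "\<dots> \<le> ennreal K * gradient_maximal N \<Omega> u x"
      unfolding gradient_maximal_def by (intro mult_left_mono member_le_sum) auto
    also have "\<dots> = ennreal (K * enn2real (gradient_maximal N \<Omega> u x))"
      using fin K(1) by (simp add: ennreal_mult)
    finally show "\<bar>?T (rescale z t \<eta>)\<bar> \<le> K * enn2real (gradient_maximal N \<Omega> u x)"
      using K(1) by (subst (asm) ennreal_le_iff) auto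
  qed
qed

text \<open>The kernels are centred at \<open>x\<close> itself, so the grand maximal function is
  used with \<open>R = t\<close>. The constant does not depend on \<open>t1\<close>, which permits
  letting \<open>t1\<close> tend to 0.\<close>

lemma mollification_scale_lipschitz:
  fixes \<psi> :: "real^'n::finite \<Rightarrow> real"
  assumes \<psi>: "\<psi> \<in> test_functions (ball 0 1)"
  obtains K where "K > 0"
    "\<And>\<Omega> u x t1 t2. open \<Omega> \<Longrightarrow> locally_integrable \<Omega> u \<Longrightarrow> x \<in> \<Omega> \<Longrightarrow> gradient_maximal N \<Omega> u x < \<infinity> \<Longrightarrow>
      0 < t1 \<Longrightarrow> t1 \<le> t2 \<Longrightarrow> ennreal t2 \<le> bdist \<Omega> x / 2 \<Longrightarrow>
      \<bar>function_distr \<Omega> u (rescale x t1 \<psi>) - function_distr \<Omega> u (rescale x t2 \<psi>)\<bar> \<le>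
        K * enn2real (gradient_maximal N \<Omega> u x) * (t2 - t1)"
proof -
  define \<Psi> where "\<Psi> j w = w $ j * \<psi> w" for j and w :: "real^'n"
  have \<Psi>: "\<Psi> j \<in> test_functions (ball 0 1)" for j
    unfolding \<Psi>_def by (rule test_functions_mult_smooth[OF \<psi> smooth_nth])
  have smooth: "smooth \<psi>" "smooth (\<Psi> j)" for j
    using \<psi> \<Psi>[of j] by (auto simp: test_functions_def)
  \<comment> \<open>Names the bound as a predicate, so that a constant can be chosen for each kernel
    \<open>\<Psi> j\<close>.\<close>
  define P where "P j K \<longleftrightarrow> K > 0 \<and> (\<forall>\<Omega> u x z t R i. open \<Omega> \<longrightarrow> locally_integrable \<Omega> u \<longrightarrow> x \<in> \<Omega> \<longrightarrow>
      gradient_maximal N \<Omega> u x < \<infinity> \<longrightarrow> 0 < t \<longrightarrow> R \<le> 2 * t \<longrightarrow> dist x z + t \<le> R \<longrightarrow> ennreal R \<le> bdist \<Omega> x / 2 \<longrightarrow>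
      \<bar>distr_deriv i (function_distr \<Omega> u) (rescale z t (\<Psi> j))\<bar> \<le> K * enn2real (gradient_maximal N \<Omega> u x))" for j K
  have "\<exists>K. P j K" for j
    using distr_deriv_rescale_bound[OF \<Psi>[of j], of N] unfolding P_def by metis
  then obtain K where K: "\<And>j. P j (K j)"
    by metis
  show thesis
  proof
    show "(\<Sum>j\<in>UNIV. K j) > 0"
      using K by (intro sum_pos) (auto simp: P_def)
    fix \<Omega> :: "(real^'n) set" and u x t1 t2
    assume \<Omega>: "open \<Omega>" and u: "locally_integrable \<Omega> u" and x: "x \<in> \<Omega>"
      and fin: "gradient_maximal N \<Omega> u x < \<infinity>"
      and t: "0 < t1" "t1 \<le> t2" "ennreal t2 \<le> bdist \<Omega> x / 2"
    let ?G = "enn2real (gradient_maximal N \<Omega> u x)"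
    \<comment> \<open>Differentiating at \<open>t \<le> t2\<close> involves scales up to
      \<open>t + t1 / 2 \<le> 3 / 2 * t2\<close>, and these balls still lie in
      \<open>ball x (2 * t2)\<close>.\<close>
    define B where "B = cball x (3 / 2 * t2)"
    have "B \<subseteq> ball x (2 * t2)"
      using t by (auto simp: B_def)
    then have B: "compact B" "B \<subseteq> \<Omega>"
      using half_ball_subset(1)[OF _ x t(3)] t by (auto simp: B_def)
    obtain L where L: "\<And>j y. \<bar>partial_deriv j (\<Psi> j) y\<bar> \<le> L j"
    proof -
      have "\<exists>L. \<forall>y. \<bar>partial_deriv j (\<Psi> j) y\<bar> \<le> L" for j
        using test_functions_bounded[OF test_functions_partial_deriv[OF \<Psi>[of j], of j]] by (auto simp: bounded_iff)
      then show thesis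
        using that by metis
    qed
    have deriv: "((\<lambda>t. function_distr \<Omega> u (rescale x t \<psi>)) has_real_derivative
        (\<Sum>j\<in>UNIV. 1 * distr_deriv j (function_distr \<Omega> u) (rescale x t (\<Psi> j)))) (at t)"
      if t': "t \<in> {t1..t2}" for t
    proof (rule mollification_has_real_derivative[OF \<Omega> u B, where d = "t1 / 2" and \<eta> = "\<lambda>j t. rescale x t (\<Psi> j)"
          and M = "\<lambda>j. L j / (t1 / 2) ^ (CARD('n) + 1)"])
      have s: "t1 / 2 < s" "s > 0" "s \<le> 3 / 2 * t2" if "s \<in> ball t (t1 / 2)" for s
        using that t' t by (auto simp: dist_real_def abs_if split: if_splits)
      then have sub: "ball x s \<subseteq> B" if "s \<in> ball t (t1 / 2)" for s
        using that by (force simp: B_def)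
      show "rescale x s \<psi> \<in> test_functions B" "rescale x s (\<Psi> j) \<in> test_functions B"
        if "s \<in> ball t (t1 / 2)" for s j
        using s[OF that] sub[OF that] by (auto intro: test_functions_rescale_subset \<psi> \<Psi>)
      show "((\<lambda>s. rescale x s \<psi> y) has_real_derivative
          - (\<Sum>j\<in>UNIV. 1 * partial_deriv j (rescale x s (\<Psi> j)) y)) (at s)" if "s \<in> ball t (t1 / 2)" for s y
        using rescale_has_real_derivative_scale[OF smooth(1) s(2)[OF that], of x y] by (simp add: \<Psi>_def[abs_def])
      show "\<bar>partial_deriv j (rescale x s (\<Psi> j)) y\<bar> \<le> L j / (t1 / 2) ^ (CARD('n) + 1)"
        if "s \<in> ball t (t1 / 2)" for s j y
        using s[OF that] t(1) by (intro rescale_partial_deriv_bound smooth L) auto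
    qed (use t in auto)
    have "\<bar>\<Sum>j\<in>UNIV. 1 * distr_deriv j (function_distr \<Omega> u) (rescale x t (\<Psi> j))\<bar> \<le> (\<Sum>j\<in>UNIV. K j) * ?G"
      if t': "t \<in> {t1..t2}" for t
    proof -
      have half: "ennreal t \<le> bdist \<Omega> x / 2"
        using t' t(3) by (auto intro: order_trans[OF ennreal_leI])
      have "\<bar>distr_deriv j (function_distr \<Omega> u) (rescale x t (\<Psi> j))\<bar> \<le> K j * ?G" for j
        by (rule K[of j, unfolded P_def, THEN conjunct2, rule_format, OF \<Omega> u x fin, where R = t])
          (use t t' half in auto)
      then have "(\<Sum>j\<in>UNIV. \<bar>1 * distr_deriv j (function_distr \<Omega> u) (rescale x t (\<Psi> j))\<bar>) \<le> (\<Sum>j\<in>UNIV. K j * ?G)"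
        by (intro sum_mono) simp
      then show ?thesis
        by (intro order_trans[OF sum_abs]) (simp add: sum_distrib_right)
    qed
    then have "norm (function_distr \<Omega> u (rescale x t1 \<psi>) - function_distr \<Omega> u (rescale x t2 \<psi>)) \<le>
        (\<Sum>j\<in>UNIV. K j) * ?G * norm (t1 - t2)"
      using t deriv by (intro field_differentiable_bound[where S = "{t1..t2}"])
        (auto intro: has_field_derivative_at_within)
    then show "\<bar>function_distr \<Omega> u (rescale x t1 \<psi>) - function_distr \<Omega> u (rescale x t2 \<psi>)\<bar> \<le>
        (\<Sum>j\<in>UNIV. K j) * ?G * (t2 - t1)"
      using t(2) by simp
  qed
qed

text \<open>Every centre on the segment lies within \<open>r\<close> of \<open>x\<close>, so the
  kernels of scale \<open>r\<close> fit into \<open>ball x (2 * r)\<close>. Only the maximal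
  function at \<open>x\<close> is needed, with \<open>R = 2 * r\<close>, the extreme case of
  \<open>R \<le> 2 * t\<close>.\<close>

lemma mollification_translate_lipschitz:
  fixes \<psi> :: "real^'n::finite \<Rightarrow> real"
  assumes \<psi>: "\<psi> \<in> test_functions (ball 0 1)"
  obtains K where "K > 0"
    "\<And>\<Omega> u x y r. open \<Omega> \<Longrightarrow> locally_integrable \<Omega> u \<Longrightarrow> x \<in> \<Omega> \<Longrightarrow> gradient_maximal N \<Omega> u x < \<infinity> \<Longrightarrow>
      0 < r \<Longrightarrow> dist x y \<le> r \<Longrightarrow> ennreal (2 * r) \<le> bdist \<Omega> x / 2 \<Longrightarrow>
      \<bar>function_distr \<Omega> u (rescale x r \<psi>) - function_distr \<Omega> u (rescale y r \<psi>)\<bar> \<le>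
        K * enn2real (gradient_maximal N \<Omega> u x) * r"
proof -
  have smooth: "smooth \<psi>"
    using \<psi> by (simp add: test_functions_def)
  obtain K where K: "K > 0"
    "\<And>\<Omega> u x z t R j. open \<Omega> \<Longrightarrow> locally_integrable \<Omega> u \<Longrightarrow> x \<in> \<Omega> \<Longrightarrow> gradient_maximal N \<Omega> u x < \<infinity> \<Longrightarrow>
      0 < t \<Longrightarrow> R \<le> 2 * t \<Longrightarrow> dist x z + t \<le> R \<Longrightarrow> ennreal R \<le> bdist \<Omega> x / 2 \<Longrightarrow>
      \<bar>distr_deriv j (function_distr \<Omega> u) (rescale z t \<psi>)\<bar> \<le> K * enn2real (gradient_maximal N \<Omega> u x)"
    using distr_deriv_rescale_bound[OF \<psi>, of N] by metis
  show thesis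
  proof
    show "real CARD('n) * K > 0"
      using K by simp
    fix \<Omega> :: "(real^'n) set" and u x y and r :: real
    assume \<Omega>: "open \<Omega>" and u: "locally_integrable \<Omega> u" and x: "x \<in> \<Omega>"
      and fin: "gradient_maximal N \<Omega> u x < \<infinity>"
      and r: "0 < r" "dist x y \<le> r" "ennreal (2 * r) \<le> bdist \<Omega> x / 2"
    let ?G = "enn2real (gradient_maximal N \<Omega> u x)"
    define b where "b = y - x"
    have b: "norm b \<le> r"
      using r(2) by (simp add: b_def dist_norm norm_minus_commute)
    \<comment> \<open>Differentiability on the closed unit interval looks at parameters up to 2 in
      absolute value: centres within \<open>2 * r\<close> of \<open>x\<close>, plus the scale
      \<open>r\<close>.\<close>
    define B where "B = cball x (3 * r)"
    have "B \<subseteq> ball x (2 * (2 * r))"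
      using r by (auto simp: B_def)
    then have B: "compact B" "B \<subseteq> \<Omega>"
      using half_ball_subset(1)[OF _ x r(3)] r by (auto simp: B_def)
    obtain L where L: "\<And>j y. \<bar>partial_deriv j \<psi> y\<bar> \<le> L j"
    proof -
      have "\<exists>L. \<forall>y. \<bar>partial_deriv j \<psi> y\<bar> \<le> L" for j
        using test_functions_bounded[OF test_functions_partial_deriv[OF \<psi>, of j]] by (auto simp: bounded_iff)
      then show thesis
        using that by metis
    qed
    have deriv: "((\<lambda>s. function_distr \<Omega> u (rescale (x + s *\<^sub>R b) r \<psi>)) has_real_derivative
        (\<Sum>j\<in>UNIV. b $ j * distr_deriv j (function_distr \<Omega> u) (rescale (x + s *\<^sub>R b) r \<psi>))) (at s)"
      if s': "s \<in> {0..1}" for s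
    proof (rule mollification_has_real_derivative[OF \<Omega> u B, where d = 1 and \<eta> = "\<lambda>j s. rescale (x + s *\<^sub>R b) r \<psi>"
          and M = "\<lambda>j. L j / r ^ (CARD('n) + 1)"])
      have sub: "ball (x + \<sigma> *\<^sub>R b) r \<subseteq> B" if "\<sigma> \<in> ball s 1" for \<sigma>
      proof -
        have "\<bar>\<sigma>\<bar> \<le> 2"
          using that s' by (auto simp: dist_real_def)
        then have "\<bar>\<sigma>\<bar> * norm b \<le> 2 * r"
          using b by (intro mult_mono) auto
        then have "cball (x + \<sigma> *\<^sub>R b) r \<subseteq> B"
          unfolding B_def by (subst cball_subset_cball_iff) (simp add: dist_norm)
        then show ?thesis
          using ball_subset_cball by blast
      qed
      show "rescale (x + \<sigma> *\<^sub>R b) r \<psi> \<in> test_functions B" "rescale (x + \<sigma> *\<^sub>R b) r \<psi> \<in> test_functions B"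
        if "\<sigma> \<in> ball s 1" for \<sigma> and j :: 'n
        using sub[OF that] r(1) by (auto intro: test_functions_rescale_subset \<psi>)
      show "((\<lambda>s. rescale (x + s *\<^sub>R b) r \<psi> y) has_real_derivative
          - (\<Sum>j\<in>UNIV. b $ j * partial_deriv j (rescale (x + \<sigma> *\<^sub>R b) r \<psi>) y)) (at \<sigma>)" for \<sigma> y
        by (rule rescale_has_real_derivative_translate[OF smooth r(1)])
      show "\<bar>partial_deriv j (rescale (x + \<sigma> *\<^sub>R b) r \<psi>) y\<bar> \<le> L j / r ^ (CARD('n) + 1)" for \<sigma> j y
        using r(1) by (intro rescale_partial_deriv_bound smooth L) auto
    qed auto
    have "\<bar>\<Sum>j\<in>UNIV. b $ j * distr_deriv j (function_distr \<Omega> u) (rescale (x + s *\<^sub>R b) r \<psi>)\<bar> \<le>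
        real CARD('n) * K * ?G * r" if s': "s \<in> {0..1}" for s
    proof -
      have "\<bar>s\<bar> * norm b \<le> 1 * r"
        using b s' by (intro mult_mono) auto
      then have dist: "dist x (x + s *\<^sub>R b) + r \<le> 2 * r"
        by (simp add: dist_norm)
      have "\<bar>b $ j * distr_deriv j (function_distr \<Omega> u) (rescale (x + s *\<^sub>R b) r \<psi>)\<bar> \<le> r * (K * ?G)" for j
        unfolding abs_mult
      proof (rule mult_mono)
        show "\<bar>b $ j\<bar> \<le> r"
          using component_le_norm_cart[of b j] b by linarith
        show "\<bar>distr_deriv j (function_distr \<Omega> u) (rescale (x + s *\<^sub>R b) r \<psi>)\<bar> \<le> K * ?G"
          by (rule K(2)[OF \<Omega> u x fin r(1) _ dist r(3)]) simp
      qed (use r in auto)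
      then have "(\<Sum>j\<in>UNIV. \<bar>b $ j * distr_deriv j (function_distr \<Omega> u) (rescale (x + s *\<^sub>R b) r \<psi>)\<bar>) \<le>
          (\<Sum>j\<in>(UNIV :: 'n set). r * (K * ?G))"
        by (intro sum_mono) simp
      then show ?thesis
        by (intro order_trans[OF sum_abs]) (simp add: mult_ac)
    qed
    then have "norm (function_distr \<Omega> u (rescale (x + 0 *\<^sub>R b) r \<psi>) - function_distr \<Omega> u (rescale (x + 1 *\<^sub>R b) r \<psi>)) \<le>
        real CARD('n) * K * ?G * r * norm (0 - 1 :: real)"
      using deriv by (intro field_differentiable_bound[where S = "{0..1}"
          and f = "\<lambda>s. function_distr \<Omega> u (rescale (x + s *\<^sub>R b) r \<psi>)"])
        (auto intro: has_field_derivative_at_within)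
    then show "\<bar>function_distr \<Omega> u (rescale x r \<psi>) - function_distr \<Omega> u (rescale y r \<psi>)\<bar> \<le>
        real CARD('n) * K * ?G * r"
      by (simp add: b_def)
  qed
qed

section \<open>Convergence of mollifications at Lebesgue points\<close>

lemma integral_rescale:
  fixes \<eta> :: "real^'n::finite \<Rightarrow> real"
  assumes \<eta>: "\<eta> \<in> test_functions (ball 0 1)" and t: "t > 0"
  shows "(\<integral>y. rescale z t \<eta> y \<partial>lebesgue) = (\<integral>y. \<eta> y \<partial>lebesgue)"
proof -
  have cont: "continuous_on UNIV \<eta>" "continuous_on UNIV (rescale z t \<eta>)"
    using \<eta> smooth_rescale[of \<eta> z t] by (auto simp: test_functions_def smooth_imp_continuous)
  have [measurable]: "\<eta> \<in> borel_measurable borel" "rescale z t \<eta> \<in> borel_measurable borel"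
    by (intro borel_measurable_continuous_onI cont)+
  have "(\<integral>y. rescale z t \<eta> y \<partial>lborel) =
      (\<integral>y. rescale z t \<eta> y \<partial>density (distr lborel borel (\<lambda>y. z + t *\<^sub>R y)) (\<lambda>_. ennreal (\<bar>t\<bar> ^ DIM(real^'n))))"
    using lborel_affine[of t z] t by simp
  also have "\<dots> = (\<integral>y. \<bar>t\<bar> ^ DIM(real^'n) *\<^sub>R rescale z t \<eta> y \<partial>distr lborel borel (\<lambda>y. z + t *\<^sub>R y))"
    by (rule integral_density) auto
  also have "\<dots> = (\<integral>y. \<bar>t\<bar> ^ DIM(real^'n) *\<^sub>R rescale z t \<eta> (z + t *\<^sub>R y) \<partial>lborel)"
    by (rule integral_distr) auto
  also have "\<dots> = (\<integral>y. \<eta> y \<partial>lborel)"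
    using t by (simp add: rescale_def)
  finally show ?thesis
    by (simp add: integral_completion)
qed

text \<open>The differentiation theorem concerns functions integrable on the whole space. It is
  applied to the countably many cut-offs of \<open>u\<close> to a compact exhaustion of \<Omega>,
  one of which agrees with \<open>u\<close> near the given point.\<close>

lemma mollification_tendsto:
  fixes u \<psi> :: "real^'n::finite \<Rightarrow> real"
  assumes \<Omega>: "open \<Omega>" and u: "locally_integrable \<Omega> u"
    and \<psi>: "\<psi> \<in> test_functions (ball 0 1)" and one: "(\<integral>y. \<psi> y \<partial>lebesgue) = 1"
  shows "AE x in lebesgue. x \<in> \<Omega> \<longrightarrow> ((\<lambda>t. function_distr \<Omega> u (rescale x t \<psi>)) \<longlongrightarrow> u x) (at_right 0)"
proof -
  obtain C where C: "\<And>n. compact (C n)" "\<And>n. C n \<subseteq> \<Omega>"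
    "\<And>n. C n \<subseteq> interior (C (Suc n))" "\<Union> (range C) = \<Omega>"
    "\<And>K. compact K \<Longrightarrow> K \<subseteq> \<Omega> \<Longrightarrow> \<exists>N. \<forall>n\<ge>N. K \<subseteq> C n"
    by (rule open_Union_compact_subsets[OF \<Omega>]) (rule that)
  define v where "v n y = indicator (C n) y * u y" for n :: nat and y
  have v: "integrable lebesgue (v n)" for n
    unfolding v_def by (rule integrable_indicator_locally_integrable[OF u C(1,2)])
  obtain L where L: "L > 0" "\<And>y. \<bar>\<psi> y\<bar> \<le> L"
    using test_functions_partial_derivs_bound[OF \<psi>, of 0] by (metis length_0_conv le_zero_eq partial_derivs_simps(1))
  have "AE x in lebesgue. \<forall>n. \<forall>e>0. \<exists>\<delta>>0. \<forall>t. 0 < t \<and> t < \<delta> \<longrightarrow>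
      (\<integral>\<^sup>+y\<in>ball x t. ennreal \<bar>v n y - v n x\<bar> \<partial>lebesgue) \<le> ennreal (e * t ^ DIM(real^'n))"
    unfolding AE_all_countable by (intro allI lebesgue_differentiation v)
  then show ?thesis
  proof (rule AE_mp, intro AE_I2 impI)
    fix x
    assume leb: "\<forall>n. \<forall>e>0. \<exists>\<delta>>0. \<forall>t. 0 < t \<and> t < \<delta> \<longrightarrow>
      (\<integral>\<^sup>+y\<in>ball x t. ennreal \<bar>v n y - v n x\<bar> \<partial>lebesgue) \<le> ennreal (e * t ^ DIM(real^'n))"
      and x: "x \<in> \<Omega>"
    obtain d where d: "d > 0" "cball x d \<subseteq> \<Omega>"
      using open_contains_cball \<Omega> x by blast
    obtain n where n: "cball x d \<subseteq> C n"
      using C(5)[OF compact_cball d(2)] by blast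
    have vx: "v n x = u x"
    proof -
      have "x \<in> cball x d"
        using d(1) by simp
      then have "x \<in> C n"
        using n by blast
      then show ?thesis
        by (simp add: v_def)
    qed
    show "((\<lambda>t. function_distr \<Omega> u (rescale x t \<psi>)) \<longlongrightarrow> u x) (at_right 0)"
      unfolding tendsto_iff
    proof (intro allI impI)
      fix e :: real assume e: "e > 0"
      \<comment> \<open>The kernel is at most \<open>L / t ^ n\<close>, so this tolerance leaves a
        total error of \<open>e / 2\<close>, strictly below \<open>e\<close>.\<close>
      define e' where "e' = e / (2 * L)"
      have e': "e' > 0"
        using e L(1) by (simp add: e'_def)
      obtain \<delta> where \<delta>: "\<delta> > 0" "\<And>t. 0 < t \<Longrightarrow> t < \<delta> \<Longrightarrow>
          (\<integral>\<^sup>+y\<in>ball x t. ennreal \<bar>v n y - v n x\<bar> \<partial>lebesgue) \<le> ennreal (e' * t ^ CARD('n))"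
        using leb[rule_format, OF e', of n] by auto
      have "dist (function_distr \<Omega> u (rescale x t \<psi>)) (u x) < e" if t: "0 < t" "t < min \<delta> d" for t
      proof -
        let ?k = "rescale x t \<psi>"
        have k: "?k \<in> test_functions (ball x t)"
          by (rule test_functions_rescale[OF \<psi> t(1)])
        have k0: "?k y = 0" if "y \<notin> ball x t" for y
          using \<psi> by (intro rescale_eq_0 t(1) that) (auto simp: test_functions_def)
        have "ball x t \<subseteq> C n"
          using n t(2) by (auto simp: subset_iff)
        then have "function_distr \<Omega> u ?k = (\<integral>y. v n y * ?k y \<partial>lebesgue)"
          unfolding v_def by (intro function_distr_eq[OF \<Omega> C(2)] k0) blast
        moreover have "u x = (\<integral>y. u x * ?k y \<partial>lebesgue)"
          using integral_rescale[OF \<psi> t(1), of x] one by simp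
        ultimately have "function_distr \<Omega> u ?k - u x = (\<integral>y. v n y * ?k y \<partial>lebesgue) - (\<integral>y. u x * ?k y \<partial>lebesgue)"
          by simp
        also have "\<dots> = (\<integral>y. v n y * ?k y - u x * ?k y \<partial>lebesgue)"
          by (intro Bochner_Integration.integral_diff[symmetric] integrable_mult_test_function[OF v k]
              integrable_mult_right integrable_test_function[OF k])
        finally have "ennreal \<bar>function_distr \<Omega> u ?k - u x\<bar> =
            ennreal (norm (\<integral>y. v n y * ?k y - u x * ?k y \<partial>lebesgue))"
          by simp
        also have "\<dots> \<le> (\<integral>\<^sup>+y. norm (v n y * ?k y - u x * ?k y) \<partial>lebesgue)"
          by (intro integral_norm_bound_ennreal Bochner_Integration.integrable_diff integrable_mult_test_function[OF v k]
              integrable_mult_right integrable_test_function[OF k])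
        also have "\<dots> \<le> (\<integral>\<^sup>+y. ennreal (L / t ^ CARD('n)) * (ennreal \<bar>v n y - v n x\<bar> * indicator (ball x t) y) \<partial>lebesgue)"
        proof (rule nn_integral_mono)
          fix y
          show "ennreal (norm (v n y * ?k y - u x * ?k y)) \<le>
              ennreal (L / t ^ CARD('n)) * (ennreal \<bar>v n y - v n x\<bar> * indicator (ball x t) y)"
          proof (cases "y \<in> ball x t")
            case True
            have "norm (v n y * ?k y - u x * ?k y) = \<bar>?k y\<bar> * \<bar>v n y - v n x\<bar>"
              by (simp add: vx abs_mult flip: left_diff_distrib)
            also have "\<bar>?k y\<bar> \<le> L / t ^ CARD('n)"
              using L(2) t(1) by (simp add: rescale_def divide_right_mono)
            finally show ?thesis
              using True L(1) t(1) by (simp add: ennreal_leI mult_right_mono flip: ennreal_mult)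
          qed (simp add: k0)
        qed
        also have "\<dots> = ennreal (L / t ^ CARD('n)) * (\<integral>\<^sup>+y\<in>ball x t. ennreal \<bar>v n y - v n x\<bar> \<partial>lebesgue)"
        proof (rule nn_integral_cmult)
          have "(\<lambda>y. ennreal \<bar>v n y - v n x\<bar>) \<in> borel_measurable lebesgue"
            using borel_measurable_integrable[OF v[of n]] by measurable
          then show "(\<lambda>y. ennreal \<bar>v n y - v n x\<bar> * indicator (ball x t) y) \<in> borel_measurable lebesgue"
            by (intro borel_measurable_times_ennreal borel_measurable_indicator sets_completionI_sets) auto
        qed
        also have "\<dots> \<le> ennreal (L / t ^ CARD('n)) * ennreal (e' * t ^ CARD('n))"
          using t by (intro mult_left_mono \<delta>(2)) auto
        also have "\<dots> = ennreal (e / 2)"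
          using t(1) L(1) e by (simp add: e'_def flip: ennreal_mult)
        finally show ?thesis
          using e by (simp add: dist_real_def)
      qed
      then show "\<forall>\<^sub>F t in at_right 0. dist (function_distr \<Omega> u (rescale x t \<psi>)) (u x) < e"
        using \<delta>(1) d(1) unfolding eventually_at_right_field by (intro exI[of _ "min \<delta> d"]) auto
    qed
  qed
qed

section \<open>Measurability of locally integrable functions and of grand maximal functions\<close>

lemma borel_measurable_locally_integrable:
  fixes u :: "real^'n::finite \<Rightarrow> real"
  assumes \<Omega>: "open \<Omega>" and u: "locally_integrable \<Omega> u"
  shows "u \<in> borel_measurable (lebesgue_on \<Omega>)"
proof -
  obtain C where C: "\<And>n. compact (C n)" "\<And>n. C n \<subseteq> \<Omega>"
    "\<And>n. C n \<subseteq> interior (C (Suc n))" "\<Union> (range C) = \<Omega>"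
    "\<And>K. compact K \<Longrightarrow> K \<subseteq> \<Omega> \<Longrightarrow> \<exists>N. \<forall>n\<ge>N. K \<subseteq> C n"
    by (rule open_Union_compact_subsets[OF \<Omega>]) (rule that)
  have "(\<lambda>x. if x \<in> \<Omega> then u x else 0) \<in> borel_measurable lebesgue"
  proof (rule borel_measurable_LIMSEQ_real)
    show "(\<lambda>x. indicator (C n) x * u x) \<in> borel_measurable lebesgue" for n
      using integrable_indicator_locally_integrable[OF u C(1,2)] by (rule borel_measurable_integrable)
    fix x
    show "(\<lambda>n. indicator (C n) x * u x) \<longlonglongrightarrow> (if x \<in> \<Omega> then u x else 0)"
    proof (cases "x \<in> \<Omega>")
      case True
      then obtain N where "\<And>n. n \<ge> N \<Longrightarrow> x \<in> C n"
        using C(5)[of "{x}"] by auto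
      then have "\<forall>\<^sub>F n in sequentially. u x = indicator (C n) x * u x"
        unfolding eventually_sequentially by (intro exI[of _ N]) auto
      then have "(\<lambda>n. indicator (C n) x * u x) \<longlonglongrightarrow> u x"
        by (rule Lim_transform_eventually[OF tendsto_const])
      with True show ?thesis
        by simp
    next
      case False
      then have "x \<notin> C n" for n
        using C(2) by blast
      with False show ?thesis
        by simp
    qed
  qed
  then show ?thesis
    by (rule borel_measurable_if_D)
qed

lemma compact_subset_ball_shrink:
  fixes x :: "'a::euclidean_space"
  assumes K: "compact K" "K \<subseteq> ball x r" and r: "r > 0"
  obtains r' where "0 < r'" "r' < r" "K \<subseteq> ball x r'"
proof (cases "K = {}")
  case True
  with r show thesis
    by (intro that[of "r / 2"]) auto
next
  case False
  obtain y where y: "y \<in> K" "\<And>z. z \<in> K \<Longrightarrow> dist x z \<le> dist x y"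
    using distance_attains_sup[OF K(1) False] by blast
  then have "dist x y < r"
    using K(2) by auto
  then obtain r' where "dist x y < r'" "r' < r"
    using dense by blast
  show thesis
  proof
    show "0 < r'"
      using \<open>dist x y < r'\<close> zero_le_dist[of x y] by linarith
    show "r' < r" by fact
    show "K \<subseteq> ball x r'"
      using y(2) \<open>dist x y < r'\<close> by force
  qed
qed

text \<open>The support of a test function is compact, so it lies in a smaller concentric ball and
  fits into a ball of radius \<open>r2 < r\<close> about any nearby centre. Shrinking the radius
  only relaxes the derivative bounds, and it compensates for the smaller boundary distance at the
  new centre.\<close>

lemma open_less_grand_maximal:
  fixes \<Omega> :: "(real^'n::finite) set"
  assumes \<Omega>: "open \<Omega>"
  shows "open {x \<in> \<Omega>. a < grand_maximal (bdist \<Omega> x / 2) N T x}"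
proof (rule openI)
  fix x :: "real^'n"
  assume "x \<in> {x \<in> \<Omega>. a < grand_maximal (bdist \<Omega> x / 2) N T x}"
  then obtain r \<phi> where x: "x \<in> \<Omega>" and r: "0 < r" "ennreal r \<le> bdist \<Omega> x / 2"
    and \<phi>: "\<phi> \<in> normalized_test_functions N x r" "a < ennreal \<bar>T \<phi>\<bar>"
    by (auto simp: grand_maximal_def less_SUP_iff)
  have supp: "compact (support \<phi>)" "support \<phi> \<subseteq> ball x r" and smooth: "smooth \<phi>"
    using \<phi>(1) by (auto simp: normalized_test_functions_def test_functions_def)
  obtain r1 where r1: "0 < r1" "r1 < r" "support \<phi> \<subseteq> ball x r1"
    using compact_subset_ball_shrink[OF supp r(1)] by blast
  obtain r2 where r2: "r1 < r2" "r2 < r"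
    using dense[OF r1(2)] by blast
  obtain d where d: "d > 0" "ball x d \<subseteq> \<Omega>"
    using openE[OF \<Omega> x] by blast
  \<comment> \<open>The three entries keep \<open>y\<close> in \<Omega>, keep
    \<open>ball x r1\<close> inside \<open>ball y r2\<close>, and limit the loss of boundary
    distance so that \<open>r2\<close> remains admissible at \<open>y\<close>.\<close>
  define e where "e = min d (min (r2 - r1) (2 * (r - r2)))"
  show "\<exists>e>0. ball x e \<subseteq> {x \<in> \<Omega>. a < grand_maximal (bdist \<Omega> x / 2) N T x}"
  proof (intro exI conjI subsetI CollectI)
    show "e > 0"
      using d(1) r2 by (simp add: e_def)
    fix y assume y: "y \<in> ball x e"
    then show "y \<in> \<Omega>"
      using d(2) by (auto simp: e_def)
    have "ball x r1 \<subseteq> ball y r2"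
      using y by (auto simp: ball_subset_ball_iff e_def)
    then have "\<phi> \<in> test_functions (ball y r2)"
      using supp(1) r1(3) smooth by (auto simp: test_functions_def)
    moreover have "\<bar>partial_derivs js \<phi> z\<bar> \<le> 1 / r2 ^ (CARD('n) + length js)" if "length js \<le> N" for js z
    proof -
      have "\<bar>partial_derivs js \<phi> z\<bar> \<le> 1 / r ^ (CARD('n) + length js)"
        using \<phi>(1) that by (simp add: normalized_test_functions_def)
      also have "\<dots> \<le> 1 / r2 ^ (CARD('n) + length js)"
        using r1(1) r2 r(1) by (intro divide_left_mono power_mono) auto
      finally show ?thesis .
    qed
    ultimately have "\<phi> \<in> normalized_test_functions N y r2"
      by (simp add: normalized_test_functions_def)
    moreover have "ennreal r2 \<le> bdist \<Omega> y / 2"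
    proof -
      have "ennreal (2 * r) \<le> bdist \<Omega> x"
        using r by (intro double_le_bdist) auto
      also have "\<dots> \<le> bdist \<Omega> y + ennreal (dist x y)"
        by (rule bdist_triangle)
      also have "\<dots> \<le> bdist \<Omega> y + ennreal (2 * (r - r2))"
        using y by (intro add_left_mono ennreal_leI) (auto simp: e_def)
      finally have "ennreal (2 * r2) \<le> bdist \<Omega> y"
        using r1(1) r2 by (cases "bdist \<Omega> y") (auto simp flip: ennreal_plus)
      then have "ennreal r2 * 2 \<le> bdist \<Omega> y"
        using r1(1) r2(1) by (simp add: ennreal_mult mult.commute)
      then show ?thesis
        by (simp add: ennreal_le_divide_iff)
    qed
    ultimately have "ennreal \<bar>T \<phi>\<bar> \<le> grand_maximal (bdist \<Omega> y / 2) N T y"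
      unfolding grand_maximal_def using r1(1) r2(1) by (intro SUP_upper UN_I[where a = r2]) auto
    with \<phi>(2) show "a < grand_maximal (bdist \<Omega> y / 2) N T y"
      by simp
  qed
qed

lemma borel_measurable_grand_maximal:
  fixes \<Omega> :: "(real^'n::finite) set"
  assumes \<Omega>: "open \<Omega>"
  shows "(\<lambda>x. grand_maximal (bdist \<Omega> x / 2) N T x) \<in> borel_measurable (lebesgue_on \<Omega>)"
proof (rule borel_measurableI_greater)
  fix a
  have sets: "\<Omega> \<in> sets lebesgue"
    using \<Omega> by (intro sets_completionI_sets) simp
  have "{x \<in> \<Omega>. a < grand_maximal (bdist \<Omega> x / 2) N T x} \<in> sets lebesgue"
    using open_less_grand_maximal[OF \<Omega>] by (intro sets_completionI_sets) simp
  then show "{x \<in> space (lebesgue_on \<Omega>). a < grand_maximal (bdist \<Omega> x / 2) N T x} \<in> sets (lebesgue_on \<Omega>)"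
    using sets by (auto simp: sets_restrict_space_iff space_restrict_space)
qed

lemma exists_mollifier:
  obtains \<psi> :: "real^'n::finite \<Rightarrow> real"
  where "\<psi> \<in> test_functions (ball 0 1)" "(\<integral>y. \<psi> y \<partial>lebesgue) = 1"
proof -
  obtain \<psi> :: "real^'n \<Rightarrow> real" where \<psi>: "smooth \<psi>" "\<And>x. \<psi> x \<ge> 0" "\<psi> 0 > 0" "\<And>x. norm x > 1 / 2 \<Longrightarrow> \<psi> x = 0"
    using exists_bump_function by blast
  have supp: "support \<psi> \<subseteq> cball 0 (1 / 2)"
    by (rule support_subsetI) (auto simp: \<psi>(4) not_le)
  then have "compact (support \<psi>)"
    using compact_Int_closed[OF compact_cball closed_support, of 0 "1 / 2" \<psi>] by (simp add: Int_absorb1)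
  then have test: "\<psi> \<in> test_functions (ball 0 1)"
    using \<psi>(1) supp by (force simp: test_functions_def)
  define I where "I = (\<integral>y. \<psi> y \<partial>lebesgue)"
  \<comment> \<open>A nonnegative function with integral 0 vanishes almost everywhere, whereas
    \<open>\<psi>\<close> is nonzero on a ball about 0 by continuity.\<close>
  have "I > 0"
  proof (rule ccontr)
    assume "\<not> I > 0"
    moreover have "I \<ge> 0"
      unfolding I_def by (intro integral_nonneg_AE AE_I2 \<psi>(2))
    ultimately have "I = 0"
      by linarith
    then have ae: "AE y in lebesgue. \<psi> y = 0"
      using integral_nonneg_eq_0_iff_AE[OF integrable_test_function[OF test]] \<psi>(2) by (simp add: I_def)
    have "isCont \<psi> 0"
      using smooth_imp_continuous[OF \<psi>(1), of UNIV] by (simp add: continuous_on_eq_continuous_at)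
    then obtain d where d: "d > 0" "\<And>y. dist y 0 < d \<Longrightarrow> dist (\<psi> y) (\<psi> 0) < \<psi> 0"
      using \<psi>(3) unfolding continuous_at_eps_delta by blast
    have nz: "\<psi> y \<noteq> 0" if "y \<in> ball 0 d" for y
      using d(2)[of y] that \<psi>(3) by (auto simp: dist_commute)
    from ae have "AE y in lebesgue. y \<notin> ball (0 :: real^'n) d"
      by eventually_elim (use nz in blast)
    then have "ball 0 d \<in> null_sets (lebesgue :: (real^'n) measure)"
      by (subst (asm) AE_iff_null_sets[symmetric]) (auto intro: sets_completionI_sets)
    then have "emeasure lebesgue (ball (0 :: real^'n) d) = 0"
      by (rule null_setsD1)
    then show False
      using d(1) by (simp add: emeasure_lebesgue_ball less_imp_neq[OF unit_ball_vol_pos, symmetric]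
          del: emeasure_completion)
  qed
  show thesis
  proof
    show "(\<lambda>y. (1 / I) * \<psi> y) \<in> test_functions (ball 0 1)"
      by (rule test_functions_cmult[OF test])
    show "(\<integral>y. (1 / I) * \<psi> y \<partial>lebesgue) = 1"
      using \<open>I > 0\<close> by (simp add: I_def)
  qed
qed

lemma ball_gradient_le_hardy_norm:
  fixes p :: real
  assumes p: "p > 0"
  obtains C where "C > 0"
    "\<And>\<Omega> (u :: real^'n::finite \<Rightarrow> real). open \<Omega> \<Longrightarrow> u \<in> hom_hardy_sobolev p N \<Omega> \<Longrightarrow>
      \<exists>g\<in>ball_gradients p \<Omega> u. Lp_norm_real p \<Omega> g \<le> ennreal C * hom_hardy_sobolev_norm p N \<Omega> u"
proof -
  obtain \<psi> :: "real^'n \<Rightarrow> real" where \<psi>: "\<psi> \<in> test_functions (ball 0 1)" "(\<integral>y. \<psi> y \<partial>lebesgue) = 1"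
    using exists_mollifier by blast
  obtain K1 where K1: "K1 > 0"
    "\<And>\<Omega> u x t1 t2. open \<Omega> \<Longrightarrow> locally_integrable \<Omega> u \<Longrightarrow> x \<in> \<Omega> \<Longrightarrow> gradient_maximal N \<Omega> u x < \<infinity> \<Longrightarrow>
      0 < t1 \<Longrightarrow> t1 \<le> t2 \<Longrightarrow> ennreal t2 \<le> bdist \<Omega> x / 2 \<Longrightarrow>
      \<bar>function_distr \<Omega> u (rescale x t1 \<psi>) - function_distr \<Omega> u (rescale x t2 \<psi>)\<bar> \<le>
        K1 * enn2real (gradient_maximal N \<Omega> u x) * (t2 - t1)"
    using mollification_scale_lipschitz[OF \<psi>(1), of N] by metis
  obtain K2 where K2: "K2 > 0"
    "\<And>\<Omega> u x y r. open \<Omega> \<Longrightarrow> locally_integrable \<Omega> u \<Longrightarrow> x \<in> \<Omega> \<Longrightarrow> gradient_maximal N \<Omega> u x < \<infinity> \<Longrightarrow>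
      0 < r \<Longrightarrow> dist x y \<le> r \<Longrightarrow> ennreal (2 * r) \<le> bdist \<Omega> x / 2 \<Longrightarrow>
      \<bar>function_distr \<Omega> u (rescale x r \<psi>) - function_distr \<Omega> u (rescale y r \<psi>)\<bar> \<le>
        K2 * enn2real (gradient_maximal N \<Omega> u x) * r"
    using mollification_translate_lipschitz[OF \<psi>(1), of N] by metis
  define K where "K = K1 + K2"
  have K: "K > 0"
    using K1(1) K2(1) by (simp add: K_def)
  show thesis
  proof
    show "K * real CARD('n) powr (1 + 1 / p) > 0"
      using K by simp
    fix \<Omega> :: "(real^'n) set" and u :: "real^'n \<Rightarrow> real"
    assume \<Omega>: "open \<Omega>" and hu: "u \<in> hom_hardy_sobolev p N \<Omega>"
    have u: "locally_integrable \<Omega> u"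
      and hardy: "\<And>j. hardy_norm p N \<Omega> (distr_deriv j (function_distr \<Omega> u)) < \<infinity>"
      using hu by (auto simp: hom_hardy_sobolev_def hardy_space_def)
    have sets: "\<Omega> \<in> sets lebesgue"
      using \<Omega> by (intro sets_completionI_sets) simp
    let ?G = "gradient_maximal N \<Omega> u"
    have G: "?G \<in> borel_measurable (lebesgue_on \<Omega>)"
      unfolding gradient_maximal_def by (intro borel_measurable_sum borel_measurable_grand_maximal \<Omega>)
    have norm_G: "Lp_norm p \<Omega> ?G \<le> ennreal (real CARD('n) powr (1 + 1 / p)) * hom_hardy_sobolev_norm p N \<Omega> u"
      unfolding gradient_maximal_def hom_hardy_sobolev_norm_def hardy_norm_def
      by (intro Lp_norm_sum_le p borel_measurable_grand_maximal \<Omega>) auto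
    also have "\<dots> < \<infinity>"
      using hardy by (simp add: hom_hardy_sobolev_norm_def ennreal_mult_less_top)
    finally have "(\<integral>\<^sup>+x. ennreal_powr (?G x) p \<partial>lebesgue_on \<Omega>) \<noteq> \<infinity>"
      by (auto simp: Lp_norm_def ennreal_powr_less_top_iff)
    then have "AE x in lebesgue_on \<Omega>. ennreal_powr (?G x) p \<noteq> \<infinity>"
      using G by (intro nn_integral_noteq_infinite) measurable
    then have "AE x in lebesgue. x \<in> \<Omega> \<longrightarrow> ?G x < \<infinity>"
      using sets by (auto simp: AE_restrict_space_iff less_top ennreal_powr_less_top_iff[unfolded less_top] elim: eventually_mono)
    with mollification_tendsto[OF \<Omega> u \<psi>]
    have "AE x in lebesgue. x \<in> \<Omega> \<longrightarrow> ?G x < \<infinity> \<and>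
        ((\<lambda>t. function_distr \<Omega> u (rescale x t \<psi>)) \<longlongrightarrow> u x) (at_right 0)"
      by eventually_elim blast
    then obtain E where E: "E \<in> null_sets lebesgue" "\<And>x. x \<in> \<Omega> - E \<Longrightarrow> ?G x < \<infinity>"
      "\<And>x. x \<in> \<Omega> - E \<Longrightarrow> ((\<lambda>t. function_distr \<Omega> u (rescale x t \<psi>)) \<longlongrightarrow> u x) (at_right 0)"
      by (auto simp: eventually_ae_filter subset_iff)
    \<comment> \<open>At points of \<Omega> with infinite \<open>?G x\<close> the conversion returns
      0, but these lie in the exceptional set \<open>E\<close>.\<close>
    define g where "g x = K * enn2real (?G x)" for x
    have g0: "g x \<ge> 0" for x
      using K by (simp add: g_def)
    have gm: "g \<in> borel_measurable (lebesgue_on \<Omega>)"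
      unfolding g_def using G by measurable
    have norm_g: "Lp_norm_real p \<Omega> g \<le> ennreal K * Lp_norm p \<Omega> ?G"
    proof (rule Lp_norm_le_cmult[OF p K sets G])
      fix x
      have "ennreal (enn2real (?G x)) \<le> ?G x"
        by (cases "?G x") auto
      then show "ennreal \<bar>g x\<bar> \<le> ennreal K * ?G x"
        using K by (simp add: g_def ennreal_mult abs_mult mult_left_mono)
    qed
    also have "\<dots> \<le> ennreal K * (ennreal (real CARD('n) powr (1 + 1 / p)) * hom_hardy_sobolev_norm p N \<Omega> u)"
      by (intro mult_left_mono norm_G) simp
    also have "\<dots> = ennreal (K * real CARD('n) powr (1 + 1 / p)) * hom_hardy_sobolev_norm p N \<Omega> u"
      using K by (simp add: ennreal_mult mult.assoc)
    finally have le: "Lp_norm_real p \<Omega> g \<le> ennreal (K * real CARD('n) powr (1 + 1 / p)) * hom_hardy_sobolev_norm p N \<Omega> u" .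
    \<comment> \<open>The Lipschitz bound between the scales \<open>t\<close> and \<open>r\<close>
      passes to the limit as \<open>t\<close> tends to 0, where the mollification becomes
      \<open>u x\<close>.\<close>
    have scale: "\<bar>u x - function_distr \<Omega> u (rescale x r \<psi>)\<bar> \<le> K1 * enn2real (?G x) * r"
      if x: "x \<in> \<Omega> - E" and r: "0 < r" "ennreal r \<le> bdist \<Omega> x / 2" for x r
    proof (rule tendsto_upperbound)
      show "((\<lambda>t. \<bar>function_distr \<Omega> u (rescale x t \<psi>) - function_distr \<Omega> u (rescale x r \<psi>)\<bar>) \<longlongrightarrow>
          \<bar>u x - function_distr \<Omega> u (rescale x r \<psi>)\<bar>) (at_right 0)"
        by (intro tendsto_intros E(3) x)
      have "\<bar>function_distr \<Omega> u (rescale x t \<psi>) - function_distr \<Omega> u (rescale x r \<psi>)\<bar> \<le> K1 * enn2real (?G x) * r"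
        if t: "0 < t" "t < r" for t
      proof -
        have "\<bar>function_distr \<Omega> u (rescale x t \<psi>) - function_distr \<Omega> u (rescale x r \<psi>)\<bar> \<le>
            K1 * enn2real (?G x) * (r - t)"
          using t x r E(2)[OF x] by (intro K1(2)[OF \<Omega> u]) auto
        also have "\<dots> \<le> K1 * enn2real (?G x) * r"
          using t K1(1) by (intro mult_left_mono) auto
        finally show ?thesis .
      qed
      then show "\<forall>\<^sub>F t in at_right 0.
          \<bar>function_distr \<Omega> u (rescale x t \<psi>) - function_distr \<Omega> u (rescale x r \<psi>)\<bar> \<le> K1 * enn2real (?G x) * r"
        using r(1) unfolding eventually_at_right_field by blast
    qed simp
    have grad: "\<bar>u x - u y\<bar> \<le> dist x y * (g x + g y)"
      if x: "x \<in> \<Omega> - E" and y: "y \<in> \<Omega> - E" and d: "ennreal (dist x y) \<le> min (bdist \<Omega> x) (bdist \<Omega> y) / 4" for x y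
    proof (cases "x = y")
      case False
      \<comment> \<open>The scale for the route from \<open>u x\<close> through the mollifications
        at \<open>x\<close> and at \<open>y\<close> to \<open>u y\<close>. The condition
        \<open>4 * r \<le> bdist\<close> at both points supplies
        \<open>2 * r \<le> bdist / 2\<close>, as moving the centre requires.\<close>
      define r where "r = dist x y"
      have r: "r > 0"
        using False by (simp add: r_def)
      have "ennreal r * 4 \<le> min (bdist \<Omega> x) (bdist \<Omega> y)"
        using d by (simp add: r_def ennreal_le_divide_iff)
      then have "ennreal (2 * r) * 2 \<le> bdist \<Omega> x" "ennreal (2 * r) * 2 \<le> bdist \<Omega> y"
        using r by (simp_all add: ennreal_mult mult_ac)
      then have 2: "ennreal (2 * r) \<le> bdist \<Omega> x / 2" "ennreal (2 * r) \<le> bdist \<Omega> y / 2"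
        by (simp_all add: ennreal_le_divide_iff)
      have "ennreal r \<le> ennreal (2 * r)"
        using r by (intro ennreal_leI) simp
      then have 1: "ennreal r \<le> bdist \<Omega> x / 2" "ennreal r \<le> bdist \<Omega> y / 2"
        using 2 by (blast intro: order_trans)+
      have "\<bar>function_distr \<Omega> u (rescale x r \<psi>) - function_distr \<Omega> u (rescale y r \<psi>)\<bar> \<le> K2 * enn2real (?G x) * r"
        using x r 2 E(2)[OF x] by (intro K2(2)[OF \<Omega> u]) (auto simp: r_def)
      then have "\<bar>u x - u y\<bar> \<le> K1 * enn2real (?G x) * r + K2 * enn2real (?G x) * r + K1 * enn2real (?G y) * r"
        using scale[OF x r 1(1)] scale[OF y r 1(2)] by linarith
      \<comment> \<open>The middle part of the route was charged to \<open>x\<close> alone; adding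
        its counterpart at \<open>y\<close> makes the bound symmetric.\<close>
      also have "\<dots> \<le> K1 * enn2real (?G x) * r + K2 * enn2real (?G x) * r + (K1 * enn2real (?G y) * r + K2 * enn2real (?G y) * r)"
        using K2(1) r by simp
      also have "\<dots> = dist x y * (g x + g y)"
        by (simp add: g_def K_def r_def algebra_simps)
      finally show ?thesis .
    qed simp
    have "g \<in> Lp_space p \<Omega>"
      using gm le_less_trans[OF le] hardy
      by (simp add: Lp_space_def hom_hardy_sobolev_norm_def ennreal_mult_less_top)
    moreover have "E \<inter> \<Omega> \<in> null_sets lebesgue"
      using E(1) sets by (rule null_set_Int2)
    ultimately have "g \<in> ball_gradients p \<Omega> u"
      unfolding ball_gradients_def using grad by (auto intro!: exI[of _ "E \<inter> \<Omega>"])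
    with le show "\<exists>g\<in>ball_gradients p \<Omega> u. Lp_norm_real p \<Omega> g \<le>
        ennreal (K * real CARD('n) powr (1 + 1 / p)) * hom_hardy_sobolev_norm p N \<Omega> u"
      by blast
  qed
qed

section \<open>Equivalence of the spaces\<close>

theorem theorem18:
  fixes \<Omega> :: "(real^'n::finite) set" and p :: real and N :: nat
  assumes "real CARD('n) / (real CARD('n) + 1) < p" and "p \<le> 1"
    and "real N > max 0 (real CARD('n) * (1 / p - 1))"
    and "open \<Omega>" and "connected \<Omega>" and "\<Omega> \<noteq> {}"
  shows "hardy_sobolev p N \<Omega> = M_ball p \<Omega> \<and>
         equivalent_norms_on (hardy_sobolev p N \<Omega>) (hardy_sobolev_norm p N \<Omega>) (M_ball_norm p \<Omega>) \<and>
         hom_hardy_sobolev p N \<Omega> = hom_M_ball p \<Omega> \<and>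
         equivalent_norms_on (hom_hardy_sobolev p N \<Omega>) (hom_hardy_sobolev_norm p N \<Omega>)
           (hom_M_ball_norm p \<Omega>)"
proof -
  have p: "p > 0"
    using assms(1) by (auto intro: le_less_trans[rotated])
  \<comment> \<open>This order guarantees that normalized test functions have controlled first
    derivatives.\<close>
  have N: "N \<ge> 1"
    using assms(3) by (cases N) auto
  obtain A where A: "A > 0"
    "\<And>\<Omega> (u :: real^'n \<Rightarrow> real) g j. open \<Omega> \<Longrightarrow> locally_integrable \<Omega> u \<Longrightarrow> g \<in> ball_gradients p \<Omega> u \<Longrightarrow>
      hardy_norm p N \<Omega> (distr_deriv j (function_distr \<Omega> u)) \<le> ennreal A * Lp_norm_real p \<Omega> g"
    using hardy_norm_le_ball_gradient[OF assms(1) N] by blast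
  obtain B where B: "B > 0"
    "\<And>\<Omega> (u :: real^'n \<Rightarrow> real). open \<Omega> \<Longrightarrow> u \<in> hom_hardy_sobolev p N \<Omega> \<Longrightarrow>
      \<exists>g\<in>ball_gradients p \<Omega> u. Lp_norm_real p \<Omega> g \<le> ennreal B * hom_hardy_sobolev_norm p N \<Omega> u"
    using ball_gradient_le_hardy_norm[OF p, of N] by blast
  have hom_eq: "hom_hardy_sobolev p N \<Omega> = hom_M_ball p \<Omega>"
  proof (intro set_eqI iffI)
    fix u assume u: "u \<in> hom_hardy_sobolev p N \<Omega>"
    then have "u \<in> borel_measurable (lebesgue_on \<Omega>)"
      by (intro borel_measurable_locally_integrable assms) (simp add: hom_hardy_sobolev_def)
    then show "u \<in> hom_M_ball p \<Omega>"
      using B(2)[OF assms(4) u] by (auto simp: hom_M_ball_def)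
  next
    fix u assume "u \<in> hom_M_ball p \<Omega>"
    then obtain g where u: "u \<in> borel_measurable (lebesgue_on \<Omega>)" and g: "g \<in> ball_gradients p \<Omega> u"
      by (auto simp: hom_M_ball_def)
    have loc: "locally_integrable \<Omega> u"
      by (rule ball_gradient_imp_locally_integrable[OF assms(4) u g assms(1)])
    have "hardy_norm p N \<Omega> (distr_deriv j (function_distr \<Omega> u)) < \<infinity>" for j
      using A(2)[OF assms(4) loc g, of j] g
      by (auto simp: ball_gradients_def Lp_space_def ennreal_mult_less_top intro: le_less_trans)
    then show "u \<in> hom_hardy_sobolev p N \<Omega>"
      using loc distribution_distr_deriv[OF assms(4) loc]
      by (simp add: hom_hardy_sobolev_def hardy_space_def)
  qed
  have le1: "hom_hardy_sobolev_norm p N \<Omega> u \<le> ennreal (real CARD('n) * A) * hom_M_ball_norm p \<Omega> u"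
    if u: "u \<in> hom_hardy_sobolev p N \<Omega>" for u
  proof -
    have "locally_integrable \<Omega> u"
      using u by (simp add: hom_hardy_sobolev_def)
    then have le: "hom_hardy_sobolev_norm p N \<Omega> u \<le> ennreal (real CARD('n) * A) * Lp_norm_real p \<Omega> g"
      if "g \<in> ball_gradients p \<Omega> u" for g
      unfolding hom_hardy_sobolev_norm_def
      using sum_bounded_above[of "UNIV :: 'n set"
          "\<lambda>j. hardy_norm p N \<Omega> (distr_deriv j (function_distr \<Omega> u))" "ennreal A * Lp_norm_real p \<Omega> g"]
        A(2)[OF assms(4) _ that] A(1)
      by (simp add: ennreal_mult ennreal_of_nat_eq_real_of_nat mult.assoc)
    have nz: "ennreal (real CARD('n) * A) \<noteq> 0"
      using A(1) by (simp add: not_le)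
    \<comment> \<open>Dividing by the constant turns the estimates for the single gradients into one
      lower bound, to which the infimum applies directly.\<close>
    have "hom_hardy_sobolev_norm p N \<Omega> u / ennreal (real CARD('n) * A) \<le> hom_M_ball_norm p \<Omega> u"
      unfolding hom_M_ball_norm_def using A(1) le by (intro INF_greatest divide_le_posI_ennreal) auto
    then show ?thesis
      using ennreal_less_divide_iff[OF nz ennreal_less_top, of "hom_M_ball_norm p \<Omega> u"
          "hom_hardy_sobolev_norm p N \<Omega> u"]
      by (simp add: not_less[symmetric] mult.commute)
  qed
  have le2: "hom_M_ball_norm p \<Omega> u \<le> ennreal B * hom_hardy_sobolev_norm p N \<Omega> u"
    if u: "u \<in> hom_hardy_sobolev p N \<Omega>" for u
    using B(2)[OF assms(4) u] unfolding hom_M_ball_norm_def by (meson INF_lower order_trans)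
  \<comment> \<open>The entry 1 lets the same constant serve the \<open>L ^ p\<close> summand shared
    by the two inhomogeneous norms.\<close>
  define C where "C = max 1 (max (real CARD('n) * A) B)"
  have C: "C > 0" "1 \<le> C" "real CARD('n) * A \<le> C" "B \<le> C"
    by (auto simp: C_def)
  have le1': "hom_hardy_sobolev_norm p N \<Omega> u \<le> ennreal C * hom_M_ball_norm p \<Omega> u"
    and le2': "hom_M_ball_norm p \<Omega> u \<le> ennreal C * hom_hardy_sobolev_norm p N \<Omega> u"
    if u: "u \<in> hom_hardy_sobolev p N \<Omega>" for u
    using le1[OF u] le2[OF u] C(3,4)
    by (meson ennreal_leI mult_right_mono order_trans zero_le)+
  have self: "a \<le> ennreal C * a" for a
    using mult_right_mono[OF ennreal_leI[OF C(2)], of a] by simp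
  have "equivalent_norms_on (hom_hardy_sobolev p N \<Omega>) (hom_hardy_sobolev_norm p N \<Omega>) (hom_M_ball_norm p \<Omega>)"
    unfolding equivalent_norms_on_def using C(1) le1' le2' by blast
  moreover have "equivalent_norms_on (hardy_sobolev p N \<Omega>) (hardy_sobolev_norm p N \<Omega>) (M_ball_norm p \<Omega>)"
    unfolding equivalent_norms_on_def hardy_sobolev_norm_def M_ball_norm_def hardy_sobolev_def distrib_left
    using C(1) by (intro exI[of _ C]) (auto intro!: add_mono le1' le2' self)
  moreover have "hardy_sobolev p N \<Omega> = M_ball p \<Omega>"
    by (simp add: hardy_sobolev_def M_ball_def hom_eq)
  ultimately show ?thesis
    using hom_eq by blast
qed

end
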